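(* Let $n\geq 4$ be an integer and let $\mathcal{A}$ be a simple projective arrangement of $n$ pseudo-lines. Then $$p_3(\mathcal{A})\leq \begin{cases} n(n-1)/3 & \text{if } n\equiv 0,4 \pmod 6,\\ (n(n-2)-2)/3 & \text{if } n\equiv 1 \pmod 6,\\ (n(n-1)-5)/3 & \text{if } n\equiv 2 \pmod 6,\\ n(n-2)/3 & \text{if } n\equiv 3,5 \pmod 6. \end{cases}$$ Furthermore, for every integer $0\leq k\leq 5$ there exist infinitely many integers $n\equiv k\pmod 6$ for which some simple projective arrangement $\mathcal{A}$ of $n$ pseudo-lines attains this bound, i.e. $p_3(\mathcal{A})$ equals the right-hand side above.
   Context: A pseudo-line in the real projective plane $\mathbb{P}^2=\mathbb{P}^2(\mathbb{R})$ is a curve $L$ for which there is a homeomorphism of $\mathbb{P}^2$ sending $L$ onto a projective line. A simple projective arrangement of $n$ pseudo-lines is a set $\mathcal{A}=\{A_1,\dots,A_n\}$ of $n$ pseudo-lines in $\mathbb{P}^2$ such that any two of them intersect transversally in exactly one point, and this point lies on no other curve of $\mathcal{A}$. The intersection points cut each pseudo-line into $n-1$ segments; the connected components of the complement of the union of the pseudo-lines are the polygons of $\mathcal{A}$. $p_3(\mathcal{A})$ denotes the number of polygons of $\mathcal{A}$ that are triangles. *)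

theory Defs
  imports "HOL-Analysis.Analysis"
begin

typedef rp2 = "{S :: (real^3) set. subspace S \<and> dim S = 1}"
proof
  have "dim (span {axis 1 1 :: real^3}) = 1"
    by (simp add: dim_span dim_singleton axis_eq_0_iff)
  then show "span {axis 1 1 :: real^3} \<in> {S. subspace S \<and> dim S = 1}"
    by simp
qed

definition proj_pt :: "real^3 \<Rightarrow> rp2" where
  "proj_pt v = Abs_rp2 (span {v})"

text \<open>The quotient topology with respect to \<^term>\<open>proj_pt\<close> on the nonzero vectors
  (which form an open subset of the ambient space).\<close>

instantiation rp2 :: topological_space
begin

definition open_rp2 :: "rp2 set \<Rightarrow> bool" where
  "open_rp2 U \<longleftrightarrow> open {v. v \<noteq> 0 \<and> proj_pt v \<in> U}"

instance
proof
  have "{v :: real^3. v \<noteq> 0 \<and> proj_pt v \<in> UNIV} = - {0}" by auto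
  then show "open (UNIV :: rp2 set)" by (simp only: open_rp2_def open_Compl closed_singleton)
next
  fix S T :: "rp2 set"
  assume "open S" "open T"
  moreover have "{v. v \<noteq> 0 \<and> proj_pt v \<in> S \<inter> T} =
      {v. v \<noteq> 0 \<and> proj_pt v \<in> S} \<inter> {v. v \<noteq> 0 \<and> proj_pt v \<in> T}" by auto
  ultimately show "open (S \<inter> T)" by (simp only: open_rp2_def open_Int)
next
  fix K :: "rp2 set set"
  assume "\<forall>S\<in>K. open S"
  moreover have "{v. v \<noteq> 0 \<and> proj_pt v \<in> \<Union>K} = (\<Union>S\<in>K. {v. v \<noteq> 0 \<and> proj_pt v \<in> S})" by auto
  ultimately show "open (\<Union>K)" by (simp only: open_rp2_def open_UN)
qed

end

definition projective_line :: "rp2 set \<Rightarrow> bool" where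
  "projective_line L \<longleftrightarrow>
     (\<exists>W :: (real^3) set. subspace W \<and> dim W = 2 \<and> L = {p. Rep_rp2 p \<subseteq> W})"

definition pseudo_line :: "rp2 set \<Rightarrow> bool" where
  "pseudo_line L \<longleftrightarrow> (\<exists>f g. homeomorphism UNIV UNIV f g \<and> projective_line (f ` L))"

text \<open>Topological transversality: in a suitable chart around the point, the two curves are the
  two coordinate axes.\<close>

definition transversal_at :: "rp2 set \<Rightarrow> rp2 set \<Rightarrow> rp2 \<Rightarrow> bool" where
  "transversal_at L M p \<longleftrightarrow>
     (\<exists>U h g. open U \<and> p \<in> U \<and> homeomorphism U (ball (0 :: real^2) 1) h g \<and> h p = 0 \<and>
        h ` (L \<inter> U) = {x \<in> ball 0 1. x $ 2 = 0} \<and>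
        h ` (M \<inter> U) = {x \<in> ball 0 1. x $ 1 = 0})"

definition simple_arrangement :: "nat \<Rightarrow> rp2 set set \<Rightarrow> bool" where
  "simple_arrangement n \<A> \<longleftrightarrow>
     finite \<A> \<and> card \<A> = n \<and> (\<forall>L\<in>\<A>. pseudo_line L) \<and>
     (\<forall>L\<in>\<A>. \<forall>M\<in>\<A>. L \<noteq> M \<longrightarrow>
        (\<exists>p. L \<inter> M = {p} \<and> transversal_at L M p \<and> (\<forall>N\<in>\<A> - {L, M}. p \<notin> N)))"

definition vertices :: "rp2 set set \<Rightarrow> rp2 set" where
  "vertices \<A> = {p. \<exists>L\<in>\<A>. \<exists>M\<in>\<A>. L \<noteq> M \<and> p \<in> L \<inter> M}"

text \<open>Segments are taken without their end points.\<close>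

definition segments :: "rp2 set set \<Rightarrow> rp2 set set" where
  "segments \<A> = (\<Union>L\<in>\<A>. components (L - vertices \<A>))"

definition polygons :: "rp2 set set \<Rightarrow> rp2 set set" where
  "polygons \<A> = components (- \<Union>\<A>)"

definition sides :: "rp2 set set \<Rightarrow> rp2 set \<Rightarrow> rp2 set set" where
  "sides \<A> P = {s \<in> segments \<A>. s \<subseteq> frontier P}"

definition p3 :: "rp2 set set \<Rightarrow> nat" where
  "p3 \<A> = card {P \<in> polygons \<A>. card (sides \<A> P) = 3}"

definition triangle_bound :: "nat \<Rightarrow> real" where
  "triangle_bound n =
     (if n mod 6 \<in> {0, 4} then real n * (real n - 1) / 3
      else if n mod 6 = 1 then (real n * (real n - 2) - 2) / 3
      else if n mod 6 = 2 then (real n * (real n - 1) - 5) / 3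
      else real n * (real n - 2) / 3)"

end

theory Submission
  imports Defs
begin

text \<open>
For the upper bound, distinct triangles share no side once \<open>n \<ge> 4\<close>, because the two sides at an end of a
shared one would lie on a common pair of lines; hence \<open>3 p\<^sub>3\<close> is at most the number \<open>n (n - 1)\<close> of segments.
If all segments of a line are sides of triangles, these triangles alternate between the two sides of the
line, and since a pseudo-line is one-sided in the projective plane, \<open>n - 1\<close> must be odd. So for odd \<open>n\<close> every line
carries an unused segment, and the remaining corrections come from divisibility by 3 and from the corners at
unused segments.

For sharpness, one line is put at infinity and the others become graphs (wires) that are determined up to
isotopy by the times at which they cross; any crossing times for which \<open>X i k\<close> lies between
\<open>X i j\<close> and \<open>X j k\<close> whenever \<open>i < j < k\<close> are realizable. If the triangles at infinity alternate, the \<open>M\<close> wires can be doubled to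
\<open>2 M - 1\<close> wires, by adding wires that behave like the sides of a regular polygon around the old crossings, without
changing the number of unused segments. Starting from 3 wires this gives the residues 0 and 4, starting
from an explicit arrangement of 49 wires it gives the residue 2. Deleting a line on the fewest triangles
gives the residues 3, 5 and 1.
\<close>

section \<open>Collars of pseudo-lines\<close>

lemma Rep_proj_pt:
  assumes "v \<noteq> 0" shows "Rep_rp2 (proj_pt v) = span {v}"
proof -
  have "dim (span {v}) = 1" using assms by (simp add: dim_span dim_singleton)
  then show ?thesis by (simp add: proj_pt_def Abs_rp2_inverse)
qed

lemma proj_pt_surj:
  obtains v where "v \<noteq> 0" "p = proj_pt v"
proof -
  have S: "subspace (Rep_rp2 p)" "dim (Rep_rp2 p) = 1" using Rep_rp2[of p] by auto
  obtain B where B: "B \<subseteq> Rep_rp2 p" "independent B" "Rep_rp2 p \<subseteq> span B" "card B = 1"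
    using basis_exists[of "Rep_rp2 p"] S by metis
  then obtain v where v: "B = {v}" by (meson card_1_singletonE)
  have "v \<noteq> 0" using B v by (metis dependent_zero singletonI)
  moreover have "Rep_rp2 p = span {v}"
    using B v S(1) by (metis span_minimal subset_antisym)
  ultimately show thesis using that[of v] by (metis Rep_proj_pt Rep_rp2_inject)
qed

lemma proj_pt_eq_iff:
  assumes "v \<noteq> 0" "w \<noteq> 0"
  shows "proj_pt v = proj_pt w \<longleftrightarrow> (\<exists>c. c \<noteq> 0 \<and> w = c *\<^sub>R v)"
proof
  assume "proj_pt v = proj_pt w"
  then have "span {v} = span {w}" using Rep_proj_pt assms by metis
  then have "w \<in> span {v}" by (simp add: span_base)
  then obtain c where "w = c *\<^sub>R v" by (auto simp: span_singleton)
  then show "\<exists>c. c \<noteq> 0 \<and> w = c *\<^sub>R v" using assms by (intro exI[of _ c]) auto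
next
  assume "\<exists>c. c \<noteq> 0 \<and> w = c *\<^sub>R v"
  then obtain c where c: "c \<noteq> 0" "w = c *\<^sub>R v" by auto
  have "v = (1 / c) *\<^sub>R w" using c by simp
  then have "v \<in> span {w}" "w \<in> span {v}" using c by (metis span_base span_scale insertI1)+
  then have "span {w} = span {v}" by (simp add: span_minimal subset_antisym)
  then show "proj_pt v = proj_pt w" by (simp add: proj_pt_def)
qed

lemma proj_pt_scale: "c \<noteq> 0 \<Longrightarrow> v \<noteq> 0 \<Longrightarrow> proj_pt (c *\<^sub>R v) = proj_pt v"
  using proj_pt_eq_iff[of v "c *\<^sub>R v"] by auto

lemma continuous_on_proj_pt:
  assumes "continuous_on S f" "\<And>x. x \<in> S \<Longrightarrow> f x \<noteq> 0"
  shows "continuous_on S (\<lambda>x. proj_pt (f x))"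
  unfolding continuous_on_open_invariant
proof (intro allI impI)
  fix B :: "rp2 set" assume "open B"
  then have "open {v. v \<noteq> 0 \<and> proj_pt v \<in> B}" by (simp add: open_rp2_def)
  then obtain A where "open A" "A \<inter> S = f -` {v. v \<noteq> 0 \<and> proj_pt v \<in> B} \<inter> S"
    using assms(1) unfolding continuous_on_open_invariant by blast
  then show "\<exists>A. open A \<and> A \<inter> S = (\<lambda>x. proj_pt (f x)) -` B \<inter> S"
    using assms(2) by (intro exI[of _ A]) auto
qed

text \<open>The vectors that project into the image form the union of all nonzero multiples of
  \<open>S\<close>, each of which is open.\<close>

lemma open_rp2_cone:
  fixes S :: "(real^3) set"
  assumes "open S" "0 \<notin> S"
  shows "open (proj_pt ` S)"
proof -
  have "{v. v \<noteq> 0 \<and> proj_pt v \<in> proj_pt ` S} = (\<Union>c\<in>-{0}. (\<lambda>x. c *\<^sub>R x) ` S)" (is "?l = ?r")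
  proof (intro equalityI subsetI)
    fix v assume "v \<in> ?l"
    then obtain w where "w \<in> S" "v \<noteq> 0" "proj_pt w = proj_pt v" by auto
    then show "v \<in> ?r" using proj_pt_eq_iff[of w v] assms(2) by auto
  next
    fix v assume "v \<in> ?r"
    then obtain c w where "w \<in> S" "c \<noteq> 0" "v = c *\<^sub>R w" by auto
    moreover have "w \<noteq> 0" using \<open>w \<in> S\<close> assms(2) by auto
    ultimately show "v \<in> ?l" using proj_pt_scale[of c w] by auto
  qed
  moreover have "open ?r" using assms(1) by (intro open_UN ballI open_scaling) auto
  ultimately show ?thesis unfolding open_rp2_def by simp
qed

text \<open>A collar parametrises a neighbourhood of a pseudo-line by the universal cover of a
  Moebius band: the sign of the second coordinate is the side, and it flips after one turn.\<close>

definition is_collar :: "rp2 set \<Rightarrow> (real \<times> real \<Rightarrow> rp2) \<Rightarrow> bool" where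
  "is_collar L G \<longleftrightarrow> continuous_on UNIV G \<and> (\<forall>S. open S \<longrightarrow> open (G ` S)) \<and>
     (\<forall>x t y s. G (x, t) = G (y, s) \<longleftrightarrow>
        (\<exists>k::int. y = x + of_int k * pi \<and> s = (if even k then t else - t))) \<and>
     (\<forall>x t. G (x, t) \<in> L \<longleftrightarrow> t = 0) \<and> (\<forall>p\<in>L. \<exists>x. p = G (x, 0))"

text \<open>Proportional unit vectors differ by a sign, that is, by a number of half turns. The
  parity of this number later decides on which side of the line a point lies.\<close>

lemma polar_scale_eq:
  assumes "cos y = c * cos x" "sin y = c * sin x"
  shows "\<exists>k::int. y = x + of_int k * pi \<and> c = (if even k then 1 else -1)"
proof -
  have "(cos y)\<^sup>2 + (sin y)\<^sup>2 = c\<^sup>2 * ((cos x)\<^sup>2 + (sin x)\<^sup>2)"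
    by (simp only: assms power_mult_distrib distrib_left)
  then have "c\<^sup>2 = 1" by simp
  then consider "c = 1" | "c = -1" using power2_eq_1_iff by blast
  then show ?thesis
  proof cases
    case 1
    then obtain n::int where "y = x + 2 * pi * n"
      using assms sin_cos_eq_iff[of y x] by auto
    then show ?thesis using 1 by (intro exI[of _ "2*n"]) auto
  next
    case 2
    have "sin y = sin (x + pi) \<and> cos y = cos (x + pi)" using assms 2 by simp
    then obtain n::int where "y = x + pi + 2 * pi * n"
      using sin_cos_eq_iff[of y "x+pi"] by auto
    then show ?thesis using 2 by (intro exI[of _ "2*n+1"]) (auto simp: algebra_simps)
  qed
qed

lemma polar_shift:
  "cos (x + of_int k * pi) = (if even k then 1 else -1) * cos x"
  "sin (x + of_int k * pi) = (if even k then 1 else -1) * sin x"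
proof -
  have "sin (of_int k * pi) = 0" by (metis mult.commute sin_npi_int)
  moreover have "cos (of_int k * pi) = (if even k then 1 else -1)"
    using cos_npi_int[of k] by (simp add: mult.commute)
  ultimately show "cos (x + of_int k * pi) = (if even k then 1 else -1) * cos x"
    "sin (x + of_int k * pi) = (if even k then 1 else -1) * sin x"
    by (auto simp: cos_add sin_add)
qed

text \<open>Coordinates adapted to the plane over a projective line: \<open>a\<close> and
  \<open>b\<close> run along the line, and the coefficient of \<open>c\<close> measures the
  departure from it.\<close>

lemma dim2_basis:
  fixes W :: "(real^3) set"
  assumes "subspace W" "dim W = 2"
  obtains a b c where "\<And>r s t. r *\<^sub>R a + s *\<^sub>R b + t *\<^sub>R c = 0 \<Longrightarrow> r = 0 \<and> s = 0 \<and> t = 0"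
    "\<And>r s t. r *\<^sub>R a + s *\<^sub>R b + t *\<^sub>R c \<in> W \<longleftrightarrow> t = 0"
    "\<And>v. v \<in> W \<Longrightarrow> \<exists>r s. v = r *\<^sub>R a + s *\<^sub>R b"
proof -
  obtain B where B: "B \<subseteq> W" "independent B" "W \<subseteq> span B" "card B = 2"
    using basis_exists[of W] assms by metis
  then obtain a b where ab: "B = {a, b}" "a \<noteq> b" by (meson card_2_iff)
  have "dim (UNIV :: (real^3) set) = 3" by simp
  then have "W \<noteq> UNIV" using assms by auto
  then obtain c where c: "c \<notin> W" by auto
  have W: "r *\<^sub>R a + s *\<^sub>R b \<in> W" for r s
    using B(1) ab assms(1) by (simp add: subspace_add subspace_scale)
  have W3: "r *\<^sub>R a + s *\<^sub>R b + t *\<^sub>R c \<in> W \<longleftrightarrow> t = 0" for r s t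
  proof
    assume "r *\<^sub>R a + s *\<^sub>R b + t *\<^sub>R c \<in> W"
    then have "(r *\<^sub>R a + s *\<^sub>R b + t *\<^sub>R c) - (r *\<^sub>R a + s *\<^sub>R b) \<in> W"
      using W assms(1) subspace_diff by blast
    then have "t *\<^sub>R c \<in> W" by simp
    then have "t \<noteq> 0 \<Longrightarrow> (1/t) *\<^sub>R (t *\<^sub>R c) \<in> W" using assms(1) subspace_scale by blast
    then show "t = 0" using c by auto
  qed (use W in auto)
  have ind: "r = 0 \<and> s = 0" if "r *\<^sub>R a + s *\<^sub>R b = 0" for r s
  proof -
    have "a \<notin> span {b}" "b \<noteq> 0" using B(2) ab by (auto simp: independent_insert)
    moreover have "r \<noteq> 0 \<Longrightarrow> a = (- s / r) *\<^sub>R b"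
    proof -
      assume "r \<noteq> 0"
      have "r *\<^sub>R a = (- s) *\<^sub>R b" using that by (simp add: eq_neg_iff_add_eq_0)
      then have "(1/r) *\<^sub>R (r *\<^sub>R a) = (1/r) *\<^sub>R ((- s) *\<^sub>R b)" by simp
      then show ?thesis using \<open>r \<noteq> 0\<close> by simp
    qed
    ultimately have "r = 0" by (metis rangeI span_singleton)
    then show ?thesis using that \<open>b \<noteq> 0\<close> by simp
  qed
  show thesis
  proof (rule that[of a b c])
    fix r s t assume *: "r *\<^sub>R a + s *\<^sub>R b + t *\<^sub>R c = 0"
    then have "t = 0" using W3[of r s t] assms(1) by (simp add: subspace_0)
    then show "r = 0 \<and> s = 0 \<and> t = 0" using * ind by simp
  next
    fix v assume "v \<in> W"
    then have "v \<in> span {a, b}" using B ab by auto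
    then obtain r where "v - r *\<^sub>R a \<in> span {b}" by (auto simp: span_insert)
    then obtain s where "v - r *\<^sub>R a = s *\<^sub>R b" by (auto simp: span_singleton)
    then have "v = r *\<^sub>R a + s *\<^sub>R b" by (simp add: algebra_simps)
    then show "\<exists>r s. v = r *\<^sub>R a + s *\<^sub>R b" by blast
  qed (rule W3)
qed

text \<open>The collar is the image of \<open>cos x a + sin x b + t c\<close>. Moving
  \<open>x\<close> by \<open>pi\<close> negates the first two terms, so the same projective point
  returns only with \<open>t\<close> negated; this is the Moebius twist.\<close>

lemma pseudo_line_collar:
  assumes "pseudo_line L"
  obtains G where "is_collar L G"
proof -
  obtain f g where fg: "homeomorphism UNIV UNIV f g" and "projective_line (f ` L)"
    using assms unfolding pseudo_line_def by blast
  then obtain W :: "(real^3) set" where W: "subspace W" "dim W = 2" "f ` L = {p. Rep_rp2 p \<subseteq> W}"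
    unfolding projective_line_def by blast
  obtain a b c where ind: "\<And>r s t. r *\<^sub>R a + s *\<^sub>R b + t *\<^sub>R c = 0 \<Longrightarrow> r = 0 \<and> s = 0 \<and> t = 0"
    and inW: "\<And>r s t. r *\<^sub>R a + s *\<^sub>R b + t *\<^sub>R c \<in> W \<longleftrightarrow> t = 0"
    and W2: "\<And>v. v \<in> W \<Longrightarrow> \<exists>r s. v = r *\<^sub>R a + s *\<^sub>R b"
    using dim2_basis[OF W(1,2)] by metis
  have gf: "g (f x) = x" "f (g x) = x" for x
    using fg by (auto simp: homeomorphism_def)
  have openg: "open (g ` S)" if "open S" for S
  proof -
    have "g ` S = f -` S"
    proof (intro equalityI subsetI)
      fix x assume "x \<in> f -` S" then show "x \<in> g ` S" using gf(1)[of x] by (metis imageI vimageE)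
    qed (use gf in auto)
    then show ?thesis using fg that unfolding homeomorphism_def
      by (metis continuous_on_open_vimage open_UNIV inf_top_right)
  qed
  define e where "e x t = cos x *\<^sub>R a + sin x *\<^sub>R b + t *\<^sub>R c" for x t
  have e0: "e x t \<noteq> 0" for x t
  proof
    assume "e x t = 0"
    then have "cos x = 0 \<and> sin x = 0" using ind unfolding e_def by blast
    then show False using sin_cos_squared_add[of x] by simp
  qed
  have eq: "(\<exists>k::int. y = x + of_int k * pi \<and> c' = (if even k then 1 else -1) \<and> s = c' * t)"
    if "e y s = c' *\<^sub>R e x t" for x t y s c'
  proof -
    have "(cos y - c' * cos x) *\<^sub>R a + (sin y - c' * sin x) *\<^sub>R b + (s - c' * t) *\<^sub>R c = 0"
      using that unfolding e_def by (simp add: algebra_simps)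
    from ind[OF this] have "cos y = c' * cos x" "sin y = c' * sin x" "s = c' * t" by auto
    then show ?thesis using polar_scale_eq by metis
  qed
  define G where "G = (\<lambda>(x, t). g (proj_pt (e x t)))"
  have inj: "G (x, t) = G (y, s) \<longleftrightarrow>
        (\<exists>k::int. y = x + of_int k * pi \<and> s = (if even k then t else - t))" for x t y s
  proof
    assume "G (x, t) = G (y, s)"
    then have "proj_pt (e x t) = proj_pt (e y s)" unfolding G_def using gf by (metis case_prod_conv)
    then obtain c' where "e y s = c' *\<^sub>R e x t" using proj_pt_eq_iff e0 by metis
    from eq[OF this] show "\<exists>k::int. y = x + of_int k * pi \<and> s = (if even k then t else - t)"
      by (metis mult_1 mult_minus_left)
  next
    assume "\<exists>k::int. y = x + of_int k * pi \<and> s = (if even k then t else - t)"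
    then obtain k::int where k: "y = x + of_int k * pi" "s = (if even k then t else - t)" by auto
    have "e y s = (if even k then 1 else -1) *\<^sub>R e x t"
      unfolding e_def k(1) polar_shift k(2) by (auto simp: algebra_simps)
    then have "proj_pt (e y s) = proj_pt (e x t)" using proj_pt_scale[OF _ e0] by simp
    then show "G (x, t) = G (y, s)" by (simp add: G_def)
  qed
  have cont_e: "continuous_on S (\<lambda>z. e (fst z) (snd z))" for S
    unfolding e_def by (intro continuous_intros)
  have contG: "continuous_on UNIV G"
  proof -
    have "continuous_on UNIV (\<lambda>z. proj_pt (e (fst z) (snd z)))"
      using continuous_on_proj_pt[OF cont_e] e0 by blast
    moreover have "continuous_on UNIV g" using fg by (simp add: homeomorphism_def)
    ultimately have "continuous_on UNIV (\<lambda>z. g (proj_pt (e (fst z) (snd z))))"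
      using continuous_on_compose2 by blast
    then show ?thesis by (simp add: G_def case_prod_beta')
  qed
  \<comment> \<open>The radial coordinate \<open>r\<close> makes this a map between spaces of
    dimension 3, so that invariance of domain applies. It is injective on strips of width
    \<open>pi\<close>, in which no half turn fits.\<close>
  define H where "H = (\<lambda>(r::real, x, t). r *\<^sub>R e x t)"
  have openH: "open (H ` ({0<..} \<times> (S \<inter> {z<..<z+pi} \<times> UNIV)))" if "open S" for S z
  proof (rule invariance_of_domain_gen)
    show "open ({0::real<..} \<times> (S \<inter> {z<..<z+pi} \<times> (UNIV::real set)))"
      using that by (intro open_Times open_Int) auto
    show "continuous_on ({0<..} \<times> (S \<inter> {z<..<z + pi} \<times> UNIV)) H"
      unfolding H_def case_prod_beta' e_def by (intro continuous_intros)
    show "inj_on H ({0<..} \<times> (S \<inter> {z<..<z + pi} \<times> UNIV))"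
    proof (rule inj_onI, clarsimp simp: H_def)
      fix r x t r' x' t' assume *: "0 < r" "0 < r'" "z < x" "x < z + pi" "z < x'" "x' < z + pi"
        "r *\<^sub>R e x t = r' *\<^sub>R e x' t'"
      have "e x' t' = (r / r') *\<^sub>R e x t"
      proof -
        have "(1 / r') *\<^sub>R (r' *\<^sub>R e x' t') = (1 / r') *\<^sub>R (r *\<^sub>R e x t)" using * by simp
        then show ?thesis using *(1,2) by simp
      qed
      from eq[OF this] obtain k :: int where k: "x' = x + of_int k * pi"
        "r / r' = (if even k then 1 else -1)" "t' = r / r' * t" by blast
      have "r / r' > 0" using * by simp
      then have "r / r' = 1" using k(2) by (auto split: if_splits)
      moreover have "\<bar>of_int k * pi\<bar> < pi" using * k(1) by linarith
      then have "\<bar>real_of_int k\<bar> < 1" by (simp add: abs_mult)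
      then have "k = 0" by linarith
      ultimately show "r = r' \<and> x = x' \<and> t = t'" using k * by auto
    qed
    show "DIM(real^3) \<le> DIM(real \<times> real \<times> real)" by simp
  qed
  have openG: "open (G ` S)" if "open S" for S
  proof -
    have "G ` S = g ` (\<Union>z. proj_pt ` H ` ({0<..} \<times> (S \<inter> {z<..<z+pi} \<times> UNIV)))" (is "_ = g ` ?R")
    proof (intro equalityI subsetI)
      fix q assume "q \<in> G ` S"
      then obtain x t where xt: "(x, t) \<in> S" "q = g (proj_pt (e x t))" unfolding G_def by auto
      have "e x t = H (1, x, t)" by (simp add: H_def)
      moreover have "(1::real, x, t) \<in> {0<..} \<times> (S \<inter> {x - 1<..<x - 1 + pi} \<times> UNIV)"
        using xt pi_gt3 by auto
      ultimately show "q \<in> g ` ?R" using xt by blast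
    next
      fix q assume "q \<in> g ` ?R"
      then obtain r x t where "0 < r" "(x, t) \<in> S" "q = g (proj_pt (r *\<^sub>R e x t))"
        unfolding H_def by auto
      then show "q \<in> G ` S" unfolding G_def using proj_pt_scale[OF _ e0, of r x t] by force
    qed
    moreover have "open (proj_pt ` H ` ({0<..} \<times> (S \<inter> {z<..<z+pi} \<times> UNIV)))" for z
      using openH[OF that] by (rule open_rp2_cone) (auto simp: H_def e0)
    then have "open ?R" by (intro open_UN) auto
    ultimately show ?thesis using openg[of ?R] by simp
  qed
  have inL: "q \<in> L \<longleftrightarrow> Rep_rp2 (f q) \<subseteq> W" for q
    using W(3) gf by (metis image_eqI imageE mem_Collect_eq)
  have spanW: "span {v} \<subseteq> W \<longleftrightarrow> v \<in> W" for v
    using W(1) by (metis empty_subsetI insert_subset span_minimal span_superset subset_trans)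
  have GL: "G (x, t) \<in> L \<longleftrightarrow> t = 0" for x t
  proof -
    have "G (x, t) \<in> L \<longleftrightarrow> e x t \<in> W"
      by (simp add: inL G_def gf Rep_proj_pt[OF e0] spanW)
    then show ?thesis by (simp add: e_def inW)
  qed
  have "\<exists>x. q = G (x, 0)" if "q \<in> L" for q
  proof -
    obtain v where v: "v \<noteq> 0" "f q = proj_pt v" using proj_pt_surj by blast
    then have "v \<in> W" using that inL spanW Rep_proj_pt by metis
    then obtain r s where rs: "v = r *\<^sub>R a + s *\<^sub>R b" using W2 by blast
    define \<rho> where "\<rho> = sqrt (r\<^sup>2 + s\<^sup>2)"
    have "\<rho> > 0" unfolding \<rho>_def using v rs
      by (metis add_0 real_sqrt_gt_0_iff scaleR_zero_left sum_power2_gt_zero_iff)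
    have "\<rho>\<^sup>2 = r\<^sup>2 + s\<^sup>2" unfolding \<rho>_def by simp
    moreover have "(r/\<rho>)\<^sup>2 + (s/\<rho>)\<^sup>2 = (r\<^sup>2 + s\<^sup>2) / \<rho>\<^sup>2"
      by (simp add: power_divide add_divide_distrib)
    moreover have "\<rho>\<^sup>2 \<noteq> 0" using \<open>\<rho> > 0\<close> by simp
    ultimately have "(r/\<rho>)\<^sup>2 + (s/\<rho>)\<^sup>2 = 1" by (metis divide_self)
    then obtain x where "r/\<rho> = cos x" "s/\<rho> = sin x" using sincos_total_2pi by metis
    then have "r = \<rho> * cos x" "s = \<rho> * sin x" using \<open>\<rho> > 0\<close> by (auto simp: field_simps)
    then have "v = \<rho> *\<^sub>R e x 0" using rs unfolding e_def by (simp add: algebra_simps)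
    then have "f q = proj_pt (e x 0)" using v proj_pt_scale[OF _ e0] \<open>\<rho> > 0\<close> by simp
    then show ?thesis unfolding G_def using gf by (metis case_prod_conv)
  qed
  then have "is_collar L G"
    unfolding is_collar_def using contG openG inj GL by blast
  then show thesis by (rule that)
qed

lemma pseudo_line_closed:
  assumes "pseudo_line L" shows "closed L"
proof -
  obtain f g where fg: "homeomorphism UNIV UNIV f g" and "projective_line (f ` L)"
    using assms unfolding pseudo_line_def by blast
  then obtain W :: "(real^3) set" where W: "subspace W" "dim W = 2" "f ` L = {p. Rep_rp2 p \<subseteq> W}"
    unfolding projective_line_def by blast
  have gf: "g (f x) = x" "f (g x) = x" for x
    using fg by (auto simp: homeomorphism_def)
  have "{v. v \<noteq> 0 \<and> proj_pt v \<in> - f ` L} = - W"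
  proof -
    have "v \<noteq> 0 \<Longrightarrow> proj_pt v \<in> f ` L \<longleftrightarrow> v \<in> W" for v
      unfolding W(3) using W(1)
      by (simp add: Rep_proj_pt) (metis empty_subsetI insert_subset span_minimal span_superset subset_trans)
    moreover have "0 \<in> W" using W(1) by (rule subspace_0)
    ultimately show ?thesis by (metis (mono_tags, lifting) Collect_cong Compl_eq Compl_iff)
  qed
  then have "open (- f ` L)" unfolding open_rp2_def
    using closed_subspace[OF W(1)] by (simp add: open_Compl)
  then have "closed (f ` L)" by (simp add: closed_open)
  moreover have "L = f -` (f ` L)" using gf by (auto, metis)
  ultimately show ?thesis using fg unfolding homeomorphism_def
    by (metis continuous_on_closed_vimage closed_UNIV inf_top_right)
qed

section \<open>Segments along a pseudo-line\<close>

text \<open>On the universal cover of a line the crossings form a periodic set. Sorting one period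
  and repeating it numbers them so that adding \<open>m\<close> to the index is one full turn.
  Natural numbers suffice as indices because every point of the line has a parameter above
  \<open>th 0\<close>.\<close>

lemma periodic_enumeration:
  fixes V :: "real set" and c :: real
  assumes c: "c > 0" and per: "\<And>x. x \<in> V \<longleftrightarrow> x + c \<in> V"
    and fin: "finite (V \<inter> {0..<c})" and m: "card (V \<inter> {0..<c}) = m" "m > 0"
  shows "\<exists>th :: nat \<Rightarrow> real. strict_mono th \<and> (\<forall>k. th (k + m) = th k + c) \<and> (\<forall>k. th k \<in> V) \<and>
    (\<forall>x\<in>V. th 0 \<le> x \<longrightarrow> (\<exists>k. x = th k))"
proof -
  define xs where "xs = sorted_list_of_set (V \<inter> {0..<c})"
  have len: "length xs = m" and set: "set xs = V \<inter> {0..<c}" and srt: "sorted_wrt (<) xs"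
    using fin m by (auto simp: xs_def)
  define th where "th k = xs ! (k mod m) + c * real (k div m)" for k
  have nthx: "xs ! i \<in> V \<inter> {0..<c}" if "i < m" for i using that len set nth_mem by blast
  have perV: "x + c * real j \<in> V \<longleftrightarrow> x \<in> V" for x j
  proof (induction j)
    case (Suc j)
    have "x + c * real (Suc j) = (x + c * real j) + c" by (simp add: algebra_simps)
    then show ?case using per Suc by metis
  qed simp
  have step: "th k < th (Suc k)" for k
  proof (cases "Suc k mod m = 0")
    case True
    then have "Suc k div m = Suc (k div m)" by (simp add: div_Suc)
    then have "th (Suc k) = xs ! 0 + c * real (k div m) + c"
      unfolding th_def using True by (simp add: algebra_simps)
    moreover have "xs ! (k mod m) < c" "0 \<le> xs ! 0" using nthx m by auto
    ultimately show ?thesis unfolding th_def by simp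
  next
    case False
    then have "Suc k div m = k div m" "Suc k mod m = Suc (k mod m)"
      by (auto simp: div_Suc mod_Suc split: if_splits)
    moreover have "Suc (k mod m) < m"
      using m(2) calculation(2) by (metis mod_less_divisor)
    then have "xs ! (k mod m) < xs ! Suc (k mod m)"
      using srt len by (simp add: sorted_wrt_iff_nth_less)
    ultimately show ?thesis unfolding th_def by simp
  qed
  have "\<exists>k. x = th k" if "x \<in> V" "th 0 \<le> x" for x
  proof -
    have "0 \<le> xs ! 0" using nthx m by auto
    then have x0: "0 \<le> x" using that unfolding th_def by simp
    define j where "j = nat \<lfloor>x / c\<rfloor>"
    have "0 \<le> x / c" using x0 c by simp
    then have j: "real j \<le> x / c" "x / c < real j + 1" unfolding j_def by linarith+
    define y where "y = x - c * real j"
    have "0 \<le> y" "y < c" using j c unfolding y_def by (auto simp: field_simps)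
    moreover have "y \<in> V" using perV[of y j] that unfolding y_def by simp
    ultimately obtain i where "i < m" "y = xs ! i" using set len by (metis IntI atLeastLessThan_iff in_set_conv_nth)
    then have "x = th (j * m + i)" unfolding th_def y_def by simp
    then show ?thesis by blast
  qed
  moreover have "th (k + m) = th k + c" for k unfolding th_def using m by (simp add: algebra_simps)
  moreover have "th k \<in> V" for k unfolding th_def using perV nthx m by simp
  moreover have "strict_mono th" using step by (simp add: strict_mono_Suc_iff)
  ultimately show ?thesis by blast
qed

text \<open>A larger connected subset would be split by the relatively open pieces, so each piece is
  maximal.\<close>

lemma components_eqI:
  assumes "\<Union>F = S" and con: "\<And>C. C \<in> F \<Longrightarrow> connected C \<and> C \<noteq> {}"
    and op: "\<And>C. C \<in> F \<Longrightarrow> \<exists>U. open U \<and> C = S \<inter> U"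
    and dis: "\<And>C D. C \<in> F \<Longrightarrow> D \<in> F \<Longrightarrow> C \<noteq> D \<Longrightarrow> C \<inter> D = {}"
  shows "components S = F"
proof -
  have sub: "C \<in> components S" if C: "C \<in> F" for C
    unfolding in_components_maximal
  proof (intro conjI allI impI)
    show "C \<noteq> {}" "C \<subseteq> S" "connected C" using C con assms(1) by auto
    fix D assume D: "D \<noteq> {} \<and> C \<subseteq> D \<and> D \<subseteq> S \<and> connected D"
    obtain u where u: "\<And>C. C \<in> F \<Longrightarrow> open (u C) \<and> C = S \<inter> u C" using op by metis
    show "D = C"
    proof (rule ccontr)
      assume "D \<noteq> C"
      have "D \<subseteq> u C \<union> \<Union>(u ` (F - {C}))"
      proof
        fix x assume "x \<in> D"
        then obtain E where "E \<in> F" "x \<in> E" using D assms(1) by blast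
        then show "x \<in> u C \<union> \<Union>(u ` (F - {C}))" using u[of E] by (cases "E = C") auto
      qed
      moreover have "u C \<inter> u E \<inter> D = {}" if "E \<in> F - {C}" for E
      proof -
        have "C \<inter> E = {}" using that C dis by auto
        moreover have "x \<in> C \<inter> E" if "x \<in> u C" "x \<in> u E" "x \<in> D" for x
          using that D u[OF C] u[of E] \<open>E \<in> F - {C}\<close> by blast
        ultimately show ?thesis by blast
      qed
      then have "u C \<inter> \<Union>(u ` (F - {C})) \<inter> D = {}" by auto
      moreover have "u C \<inter> D \<noteq> {}" using D u[OF C] con[OF C] by auto
      moreover have "\<Union>(u ` (F - {C})) \<inter> D \<noteq> {}"
      proof -
        obtain x where "x \<in> D" "x \<notin> C" using D \<open>D \<noteq> C\<close> by blast
        then obtain E where "E \<in> F" "x \<in> E" "E \<noteq> C" using D assms(1) by blast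
        then show ?thesis using u[of E] \<open>x \<in> D\<close> by blast
      qed
      moreover have "open (u C)" "open (\<Union>(u ` (F - {C})))" using u C by auto
      ultimately show False using D unfolding connected_def by meson
    qed
  qed
  show ?thesis
  proof (intro equalityI subsetI)
    fix K assume K: "K \<in> components S"
    then obtain x where "x \<in> K" "x \<in> S" using in_components_nonempty in_components_subset by blast
    then obtain C where "C \<in> F" "x \<in> C" using assms(1) by blast
    then have "K = C" using sub K \<open>x \<in> K\<close> components_eq by blast
    then show "K \<in> F" using \<open>C \<in> F\<close> by simp
  qed (rule sub)
qed

lemma shift_pi: "\<exists>k::int. z \<le> x + of_int k * pi \<and> x + of_int k * pi < z + pi"
proof -
  define k where "k = - \<lfloor>(x - z) / pi\<rfloor>"
  have "of_int \<lfloor>(x - z) / pi\<rfloor> \<le> (x - z) / pi" "(x - z) / pi < of_int \<lfloor>(x - z) / pi\<rfloor> + 1" by linarith+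
  then have "of_int \<lfloor>(x - z) / pi\<rfloor> * pi \<le> x - z" "x - z < (of_int \<lfloor>(x - z) / pi\<rfloor> + 1) * pi"
    by (metis pi_gt_zero pos_le_divide_eq) (metis pi_gt_zero pos_divide_less_eq \<open>(x - z) / pi < of_int \<lfloor>(x - z) / pi\<rfloor> + 1\<close>)
  then show ?thesis by (intro exI[of _ k]) (auto simp: k_def algebra_simps)
qed

lemma image_add_pi: "(\<lambda>x. x + pi) ` {a<..<b} = {a + pi<..<b + pi}"
proof (intro equalityI subsetI)
  fix x assume "x \<in> {a + pi<..<b + pi}"
  then show "x \<in> (\<lambda>x. x + pi) ` {a<..<b}" by (intro image_eqI[of _ _ "x - pi"]) auto
qed auto

lemma in_closure_meets: "x \<in> closure S \<Longrightarrow> open U \<Longrightarrow> x \<in> U \<Longrightarrow> U \<inter> S \<noteq> {}"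
  using open_Int_closure_eq_empty by blast

lemma closureI_meets: "(\<And>U. open U \<Longrightarrow> x \<in> U \<Longrightarrow> U \<inter> S \<noteq> {}) \<Longrightarrow> x \<in> closure S"
proof (rule ccontr)
  assume *: "\<And>U. open U \<Longrightarrow> x \<in> U \<Longrightarrow> U \<inter> S \<noteq> {}" and "x \<notin> closure S"
  then have "- closure S \<inter> S \<noteq> {}" by (intro *) auto
  then show False using closure_subset by auto
qed

section \<open>Vertices and segments in their cyclic order along a pseudo-line\<close>

locale arrangement =
  fixes A :: "rp2 set set" and n :: nat
  assumes arr: "simple_arrangement n A" and n4: "4 \<le> n"
begin

text \<open>The number of segments on each line, and at the same time the period of the vertex
  indices.\<close>

definition m :: nat where "m = n - 1"

lemma m3: "3 \<le> m" using n4 by (simp add: m_def)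

lemma finA: "finite A" and cardA: "card A = n"
  using arr by (auto simp: simple_arrangement_def)

lemma pl: "L \<in> A \<Longrightarrow> pseudo_line L"
  using arr by (auto simp: simple_arrangement_def)

lemma closed_rest: "closed (\<Union>(A - {L}))"
  using finA pl pseudo_line_closed by (intro closed_Union) auto

lemma meet_ex:
  assumes "L \<in> A" "M \<in> A" "L \<noteq> M"
  shows "\<exists>p. L \<inter> M = {p} \<and> transversal_at L M p \<and> (\<forall>N\<in>A - {L, M}. p \<notin> N)"
  using arr assms unfolding simple_arrangement_def by simp

lemma meet_unique:
  assumes "L \<in> A" "M \<in> A" "L \<noteq> M" "p \<in> L" "p \<in> M" "q \<in> L" "q \<in> M"
  shows "p = q"
proof -
  obtain r where "L \<inter> M = {r}" using meet_ex[OF assms(1-3)] by auto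
  then have "p \<in> {r}" "q \<in> {r}" using assms by auto
  then show ?thesis by simp
qed

lemma no_triple:
  assumes "L \<in> A" "M \<in> A" "N \<in> A" "L \<noteq> M" "L \<noteq> N" "p \<in> L" "p \<in> M" "p \<in> N"
  shows "M = N"
proof (rule ccontr)
  assume "M \<noteq> N"
  obtain r where r: "L \<inter> M = {r}" "\<forall>N\<in>A - {L, M}. r \<notin> N"
    using meet_ex[OF assms(1,2,4)] by auto
  then have "p \<in> {r}" using assms by auto
  then show False using r(2) assms \<open>M \<noteq> N\<close> by auto
qed

definition cl :: "rp2 set \<Rightarrow> real \<times> real \<Rightarrow> rp2" where
  "cl L = (SOME G. is_collar L G)"

lemma collar: "L \<in> A \<Longrightarrow> is_collar L (cl L)"
  unfolding cl_def using pseudo_line_collar[OF pl] by (metis someI_ex)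

lemma cl_cont: "L \<in> A \<Longrightarrow> continuous_on S (cl L)"
  using collar continuous_on_subset unfolding is_collar_def by blast

lemma cl_vimage: "L \<in> A \<Longrightarrow> open U \<Longrightarrow> open (cl L -` U)"
  using cl_cont[of L UNIV] by (simp add: continuous_on_open_vimage)

lemma cl_open: "L \<in> A \<Longrightarrow> open S \<Longrightarrow> open (cl L ` S)"
  using collar unfolding is_collar_def by blast

lemma cl_eq: "L \<in> A \<Longrightarrow> cl L (x, t) = cl L (y, s) \<longleftrightarrow>
        (\<exists>k::int. y = x + of_int k * pi \<and> s = (if even k then t else - t))"
  using collar unfolding is_collar_def by blast

lemma cl_in: "L \<in> A \<Longrightarrow> cl L (x, t) \<in> L \<longleftrightarrow> t = 0"
  using collar unfolding is_collar_def by blast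

lemma cl_ex: "L \<in> A \<Longrightarrow> p \<in> L \<Longrightarrow> \<exists>x. p = cl L (x, 0)"
  using collar unfolding is_collar_def by blast

lemma cl_pi: "L \<in> A \<Longrightarrow> cl L (x + pi, t) = cl L (x, - t)"
  using cl_eq[of L x "-t" "x + pi" t] by (metis minus_minus of_int_1 mult_1 odd_one)

lemma cl_inj:
  assumes "L \<in> A" "cl L (x, t) = cl L (y, s)" "\<bar>x - y\<bar> < pi"
  shows "x = y \<and> t = s"
proof -
  obtain k :: int where k: "y = x + of_int k * pi" "s = (if even k then t else - t)"
    using assms cl_eq by blast
  have "\<bar>of_int k * pi\<bar> < pi" using k(1) assms(3) by (simp add: abs_minus_commute)
  then have "\<bar>real_of_int k\<bar> < 1" by (simp add: abs_mult)
  then have "k = 0" by linarith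
  then show ?thesis using k by simp
qed

lemma cl_ex_from:
  assumes "L \<in> A" "p \<in> L"
  shows "\<exists>x. z \<le> x \<and> x < z + pi \<and> p = cl L (x, 0)"
proof -
  obtain y where y: "p = cl L (y, 0)" using cl_ex assms by blast
  obtain k::int where k: "z \<le> y + of_int k * pi" "y + of_int k * pi < z + pi" using shift_pi by blast
  have "cl L (y, 0) = cl L (y + of_int k * pi, 0)" using cl_eq[OF assms(1)] by auto
  then show ?thesis using k y by (intro exI[of _ "y + of_int k * pi"]) simp
qed

definition va :: "rp2 set \<Rightarrow> real set" where
  "va L = {x. cl L (x, 0) \<in> \<Union>(A - {L})}"

lemma va_pi: "L \<in> A \<Longrightarrow> x \<in> va L \<longleftrightarrow> x + pi \<in> va L"
  by (simp add: va_def cl_pi)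

text \<open>Within one turn, sending a parameter to the other line through that crossing is a
  bijection: injective because two lines meet only once, onto because no third line passes through a
  crossing.\<close>

lemma va_card:
  assumes L: "L \<in> A"
  shows "finite (va L \<inter> {0..<pi})" "card (va L \<inter> {0..<pi}) = m"
proof -
  have "\<exists>M\<in>A - {L}. cl L (x, 0) \<in> M" if "x \<in> va L" for x using that by (auto simp: va_def)
  then obtain f where f: "\<And>x. x \<in> va L \<Longrightarrow> f x \<in> A - {L} \<and> cl L (x, 0) \<in> f x" by metis
  have "bij_betw f (va L \<inter> {0..<pi}) (A - {L})"
    unfolding bij_betw_def
  proof
    show "inj_on f (va L \<inter> {0..<pi})"
    proof (rule inj_onI)
      fix x y assume x: "x \<in> va L \<inter> {0..<pi}" and y: "y \<in> va L \<inter> {0..<pi}" and e: "f x = f y"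
      have "cl L (x, 0) = cl L (y, 0)"
        using f[of x] f[of y] x y e L cl_in[OF L]
        by (intro meet_unique[of L "f x"]) auto
      moreover have "\<bar>x - y\<bar> < pi" using x y by auto
      ultimately show "x = y" using cl_inj[OF L] by blast
    qed
    show "f ` (va L \<inter> {0..<pi}) = A - {L}"
    proof (intro equalityI subsetI)
      fix M assume M: "M \<in> A - {L}"
      then have "M \<in> A" "L \<noteq> M" by auto
      then obtain p where "L \<inter> M = {p}" using meet_ex[OF L, of M] by auto
      then have p: "p \<in> L" "p \<in> M" by auto
      then obtain x where x: "0 \<le> x" "x < 0 + pi" "p = cl L (x, 0)" using cl_ex_from[OF L p(1), of 0] by blast
      then have "x \<in> va L" using p M by (auto simp: va_def)
      then have "f x = M" using f[of x] x p M no_triple[OF L, of "f x" M p] by auto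
      then show "M \<in> f ` (va L \<inter> {0..<pi})" using x \<open>x \<in> va L\<close> by auto
    qed (use f in auto)
  qed
  moreover have "card (A - {L}) = m" using L cardA finA by (simp add: m_def)
  ultimately show "finite (va L \<inter> {0..<pi})" "card (va L \<inter> {0..<pi}) = m"
    using finA by (auto simp: bij_betw_finite bij_betw_same_card)
qed

definition th :: "rp2 set \<Rightarrow> nat \<Rightarrow> real" where
  "th L = (SOME t. strict_mono t \<and> (\<forall>k. t (k + m) = t k + pi) \<and> (\<forall>k. t k \<in> va L) \<and>
    (\<forall>x\<in>va L. t 0 \<le> x \<longrightarrow> (\<exists>k. x = t k)))"

lemma th_all:
  assumes L: "L \<in> A"
  shows "strict_mono (th L) \<and> (\<forall>k. th L (k + m) = th L k + pi) \<and> (\<forall>k. th L k \<in> va L) \<and>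
    (\<forall>x\<in>va L. th L 0 \<le> x \<longrightarrow> (\<exists>k. x = th L k))"
  unfolding th_def
  by (rule someI_ex[OF periodic_enumeration[OF pi_gt_zero va_pi[OF L] va_card[OF L]]]) (use m3 in simp)

lemma th_mono: "L \<in> A \<Longrightarrow> th L j < th L k \<longleftrightarrow> j < k"
  using th_all strict_mono_less by blast

lemma th_mono_le: "L \<in> A \<Longrightarrow> th L j \<le> th L k \<longleftrightarrow> j \<le> k"
  using th_all strict_mono_less_eq by blast

lemma th_per: "L \<in> A \<Longrightarrow> th L (k + m) = th L k + pi"
  using th_all by blast

lemma th_va: "L \<in> A \<Longrightarrow> th L k \<in> va L"
  using th_all by blast

lemma th_surj: "L \<in> A \<Longrightarrow> x \<in> va L \<Longrightarrow> th L 0 \<le> x \<Longrightarrow> \<exists>k. x = th L k"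
  using th_all by blast

lemma th_gap: "L \<in> A \<Longrightarrow> th L k < x \<Longrightarrow> x < th L (Suc k) \<Longrightarrow> x \<notin> va L"
proof
  assume *: "L \<in> A" "th L k < x" "x < th L (Suc k)" "x \<in> va L"
  then have "th L 0 \<le> x" using th_mono_le[of L 0 k] by linarith
  then obtain j where "x = th L j" using th_surj * by blast
  then show False using * th_mono[of L k j] th_mono[of L j "Suc k"] by simp
qed

lemma th_locate:
  assumes L: "L \<in> A" and x: "th L j \<le> x" "x < th L (j + l)"
  shows "\<exists>k. j \<le> k \<and> k < j + l \<and> th L k \<le> x \<and> x < th L (Suc k)"
  using x(2)
proof (induction l)
  case 0 then show ?case using x(1) by simp
next
  case (Suc l)
  then show ?case
    by (cases "x < th L (j + l)") (use Suc in \<open>fastforce intro: exI[of _ "j + l"]\<close>)+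
qed

definition seg :: "rp2 set \<Rightarrow> nat \<Rightarrow> rp2 set" where
  "seg L k = (\<lambda>x. cl L (x, 0)) ` {th L k<..<th L (Suc k)}"

lemma seg_per: "L \<in> A \<Longrightarrow> seg L (k + m) = seg L k"
proof -
  assume L: "L \<in> A"
  have "th L (Suc k + m) = th L (Suc k) + pi" by (rule th_per[OF L])
  then have "{th L (k + m)<..<th L (Suc (k + m))} = (\<lambda>x. x + pi) ` {th L k<..<th L (Suc k)}"
    using th_per[OF L, of k] by (simp add: image_add_pi)
  then show ?thesis unfolding seg_def image_image by (simp add: cl_pi[OF L] image_image)
qed

lemma seg_subset: "L \<in> A \<Longrightarrow> seg L k \<subseteq> L"
  using cl_in by (auto simp: seg_def)

lemma seg_disj_line: "L \<in> A \<Longrightarrow> M \<in> A \<Longrightarrow> L \<noteq> M \<Longrightarrow> seg L k \<inter> M = {}"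
  using th_gap by (fastforce simp: seg_def va_def)

lemma seg_nonempty: "L \<in> A \<Longrightarrow> seg L k \<noteq> {}"
  using th_mono[of L k "Suc k"] by (simp add: seg_def)

text \<open>The two parameters of a common point would be less than \<open>pi\<close> apart, where
  the collar is injective.\<close>

lemma seg_inj_point:
  assumes L: "L \<in> A" and p: "p \<in> seg L j" "p \<in> seg L k" and jk: "j \<le> k" "k < j + m"
  shows "j = k"
proof -
  obtain x where x: "th L j < x" "x < th L (Suc j)" "p = cl L (x, 0)" using p by (auto simp: seg_def)
  obtain y where y: "th L k < y" "y < th L (Suc k)" "p = cl L (y, 0)" using p by (auto simp: seg_def)
  have "th L j \<le> th L k" "th L (Suc j) \<le> th L (j + m)" "th L (Suc k) \<le> th L (j + m)"
    using jk m3 th_mono_le[OF L] by auto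
  then have "\<bar>x - y\<bar> < pi" using th_per[OF L, of j] x y by linarith
  then have "x = y" using cl_inj[OF L] x y by metis
  then have "th L k < th L (Suc j)" using x y by linarith
  then have "k < Suc j" using th_mono[OF L] by blast
  then show ?thesis using jk by simp
qed

lemma seg_neq_Suc: "L \<in> A \<Longrightarrow> seg L j \<noteq> seg L (Suc j)"
proof
  assume L: "L \<in> A" and "seg L j = seg L (Suc j)"
  then obtain p where "p \<in> seg L j" "p \<in> seg L (Suc j)" using seg_nonempty[OF L] by blast
  then show False using seg_inj_point[OF L, of p j "Suc j"] m3 by simp
qed

lemma vertices_iff: "L \<in> A \<Longrightarrow> p \<in> L \<Longrightarrow> p \<in> vertices A \<longleftrightarrow> p \<in> \<Union>(A - {L})"
  unfolding vertices_def by blast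

lemma seg_not_vertex: "L \<in> A \<Longrightarrow> p \<in> seg L k \<Longrightarrow> p \<notin> vertices A"
proof
  assume L: "L \<in> A" and p: "p \<in> seg L k" and "p \<in> vertices A"
  then have "p \<in> \<Union>(A - {L})" using vertices_iff[OF L, of p] seg_subset[OF L, of k] by auto
  then obtain M where "M \<in> A" "M \<noteq> L" "p \<in> M" by auto
  then show False using seg_disj_line[OF L, of M k] p by auto
qed

text \<open>Images of collar boxes over the parameter intervals are open and cut the segments out of
  the line, so \<open>components_eqI\<close> applies.\<close>

lemma seg_components:
  assumes L: "L \<in> A"
  shows "components (L - vertices A) = seg L ` {..<m}"
proof (rule components_eqI)
  show "\<Union>(seg L ` {..<m}) = L - vertices A"
  proof (intro equalityI subsetI)
    fix p assume "p \<in> \<Union>(seg L ` {..<m})"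
    then obtain k where "p \<in> seg L k" by blast
    then show "p \<in> L - vertices A" using seg_subset[OF L, of k] seg_not_vertex[OF L] by auto
  next
    fix p assume p: "p \<in> L - vertices A"
    then have "p \<in> L" by simp
    then obtain x where x: "th L 0 \<le> x" "x < th L 0 + pi" "p = cl L (x, 0)"
      using cl_ex_from[OF L, of p "th L 0"] by blast
    have "p \<notin> \<Union>(A - {L})" using p vertices_iff[OF L, of p] by simp
    then have "x \<notin> va L" unfolding va_def x(3) by simp
    obtain k where "k < m" "th L k \<le> x" "x < th L (Suc k)"
      using th_locate[OF L, of 0 x m] x th_per[OF L, of 0] by auto
    moreover have "th L k \<noteq> x" using th_va[OF L] \<open>x \<notin> va L\<close> by blast
    ultimately have "x \<in> {th L k<..<th L (Suc k)}" by simp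
    then have "p \<in> seg L k" unfolding seg_def x(3) by (rule imageI)
    then show "p \<in> \<Union>(seg L ` {..<m})" using \<open>k < m\<close> by auto
  qed
next
  fix C assume "C \<in> seg L ` {..<m}"
  then obtain k where k: "k < m" "C = seg L k" by blast
  have "continuous_on {th L k<..<th L (Suc k)} (\<lambda>x. cl L (x, 0))"
    by (intro continuous_on_compose2[OF cl_cont[OF L]] continuous_intros) auto
  then show "connected C \<and> C \<noteq> {}"
    unfolding k using seg_nonempty[OF L] by (auto simp: seg_def intro: connected_continuous_image)
  show "\<exists>U. open U \<and> C = (L - vertices A) \<inter> U"
  proof (intro exI conjI)
    show "open (cl L ` ({th L k<..<th L (Suc k)} \<times> UNIV))"
      by (intro cl_open[OF L] open_Times) auto
    have "C \<inter> vertices A = {}"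
      unfolding k using seg_not_vertex[OF L] by auto
    then show "C = (L - vertices A) \<inter> cl L ` ({th L k<..<th L (Suc k)} \<times> UNIV)"
      unfolding k seg_def using cl_in[OF L] by auto
  qed
next
  fix C D assume "C \<in> seg L ` {..<m}" "D \<in> seg L ` {..<m}" "C \<noteq> D"
  then obtain j k where *: "j < m" "k < m" "C = seg L j" "D = seg L k" "j \<noteq> k" by blast
  then show "C \<inter> D = {}" using seg_inj_point[OF L, of _ j k] seg_inj_point[OF L, of _ k j]
    by (cases "j \<le> k") force+
qed

lemma segments_eq: "segments A = (\<Union>L\<in>A. seg L ` {..<m})"
  unfolding segments_def using seg_components by simp

lemma seg_in_segments: "L \<in> A \<Longrightarrow> seg L k \<in> segments A"
proof -
  assume L: "L \<in> A"
  have "seg L k = seg L (k mod m)"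
  proof (induction k rule: less_induct)
    case (less k)
    show ?case
    proof (cases "k < m")
      case False
      then have "seg L k = seg L (k - m)" using seg_per[OF L, of "k - m"] by simp
      then show ?thesis using less[of "k - m"] False m3 by (simp add: le_mod_geq)
    qed simp
  qed
  moreover have "k mod m < m" using m3 by simp
  ultimately show ?thesis unfolding segments_eq using L by auto
qed

text \<open>The index is taken positive so that both ends, \<open>th L (Suc k)\<close> and
  \<open>th L (Suc (Suc k))\<close>, have the successor form that \<open>corner\<close> works with;
  index 0 is replaced by \<open>m\<close>.\<close>

lemma segments_cases:
  assumes "s \<in> segments A"
  obtains L k where "L \<in> A" "k < m" "s = seg L (Suc k)"
proof -
  obtain L k where L: "L \<in> A" "k < m" "s = seg L k" using assms unfolding segments_eq by blast
  show thesis
  proof (cases k)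
    case 0
    then have "s = seg L (Suc (m - 1))" using L seg_per[of L 0] m3 by simp
    then show ?thesis using that[of L "m - 1"] L m3 by simp
  next
    case (Suc i)
    then show ?thesis using that[of L i] L by simp
  qed
qed

lemma card_segments: "card (seg L ` {..<m}) = m" if L: "L \<in> A" for L
proof -
  have "inj_on (seg L) {..<m}"
  proof (rule inj_onI)
    fix j k assume *: "j \<in> {..<m}" "k \<in> {..<m}" "seg L j = seg L k"
    then obtain p where "p \<in> seg L j" "p \<in> seg L k" using seg_nonempty[OF L] by blast
    then show "j = k" using seg_inj_point[OF L, of p j k] seg_inj_point[OF L, of p k j] *
      by (cases "j \<le> k") force+
  qed
  then show ?thesis by (simp add: card_image)
qed

end

section \<open>Polygons and corners\<close>

context arrangement
begin

section \<open>The two polygons next to a segment\<close>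

lemma box_ex:
  assumes L: "L \<in> A" and U: "open U" "cl L (x, t) \<in> U"
  shows "\<exists>d>0. \<forall>y s. \<bar>y - x\<bar> < d \<longrightarrow> \<bar>s - t\<bar> < d \<longrightarrow> cl L (y, s) \<in> U"
proof -
  have "open (cl L -` U)" using cl_vimage[OF L U(1)] .
  moreover have "(x, t) \<in> cl L -` U" using U(2) by simp
  ultimately obtain X T where XT: "open X" "open T" "x \<in> X" "t \<in> T" "X \<times> T \<subseteq> cl L -` U"
    by (rule open_prod_elim) auto
  obtain d1 where d1: "d1 > 0" "\<And>y. dist y x < d1 \<Longrightarrow> y \<in> X" using XT(1,3) open_dist by metis
  obtain d2 where d2: "d2 > 0" "\<And>y. dist y t < d2 \<Longrightarrow> y \<in> T" using XT(2,4) open_dist by metis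
  have "cl L (y, s) \<in> U" if "\<bar>y - x\<bar> < min d1 d2" "\<bar>s - t\<bar> < min d1 d2" for y s
  proof -
    have "y \<in> X" "s \<in> T" using d1 d2 that by (auto simp: dist_real_def)
    then show ?thesis using XT(5) by blast
  qed
  then show ?thesis using d1(1) d2(1) by (intro exI[of _ "min d1 d2"]) auto
qed

lemma box_free:
  assumes L: "L \<in> A" and x: "x \<notin> va L"
  shows "\<exists>d>0. \<forall>y s. \<bar>y - x\<bar> < d \<longrightarrow> \<bar>s\<bar> < d \<longrightarrow> cl L (y, s) \<notin> \<Union>(A - {L})"
  using box_ex[OF L, of "- \<Union>(A - {L})" x 0] closed_rest[of L] x by (auto simp: va_def)

lemma box_half_connected:
  assumes L: "L \<in> A"
  shows "connected ((\<lambda>z. cl L (fst z, e * snd z)) ` ({a<..<b} \<times> {0<..<d}))"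
proof (rule connected_continuous_image)
  show "continuous_on ({a<..<b} \<times> {0<..<d}) (\<lambda>z. cl L (fst z, e * snd z))"
    by (rule continuous_on_compose2[OF cl_cont[OF L, of UNIV]]) (auto intro!: continuous_intros)
  show "connected ({a<..<b} \<times> {0<..<d})" by (intro connected_Times) auto
qed

text \<open>Only half-boxes around interior points have to lie in the polygon. Their size depends on
  the point, since other lines come close near the ends of the segment.\<close>

definition faces_side :: "rp2 set \<Rightarrow> nat \<Rightarrow> real \<Rightarrow> rp2 set \<Rightarrow> bool" where
  "faces_side L k e P \<longleftrightarrow> P \<in> polygons A \<and> (\<forall>x. th L k < x \<longrightarrow> x < th L (Suc k) \<longrightarrow>
     (\<exists>d>0. \<forall>y t. \<bar>y - x\<bar> < d \<longrightarrow> 0 < t \<longrightarrow> t < d \<longrightarrow> cl L (y, e * t) \<in> P))"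

text \<open>Each interior point has a half-box free of lines, which lies in a single polygon.
  Half-boxes of nearby points overlap, so this polygon is locally constant along the segment, hence
  constant.\<close>

lemma faces_side_ex:
  assumes L: "L \<in> A" and e: "e = 1 \<or> e = -1"
  shows "\<exists>P. faces_side L k e P"
proof -
  let ?J = "{th L k<..<th L (Suc k)}"
  have "\<exists>P d. P \<in> polygons A \<and> d > 0 \<and> (\<forall>y t. \<bar>y - x\<bar> < d \<longrightarrow> 0 < t \<longrightarrow> t < d \<longrightarrow> cl L (y, e * t) \<in> P)"
    if "x \<in> ?J" for x
  proof -
    have "x \<notin> va L" using that th_gap[OF L, of k x] by simp
    then obtain d where d: "d > 0" "\<And>y s. \<bar>y - x\<bar> < d \<Longrightarrow> \<bar>s\<bar> < d \<Longrightarrow> cl L (y, s) \<notin> \<Union>(A - {L})"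
      using box_free[OF L] by blast
    let ?H = "(\<lambda>z. cl L (fst z, e * snd z)) ` ({x - d<..<x + d} \<times> {0<..<d})"
    have sub: "?H \<subseteq> - \<Union>A"
    proof
      fix p assume "p \<in> ?H"
      then obtain y t where yt: "\<bar>y - x\<bar> < d" "0 < t" "t < d" "p = cl L (y, e * t)" by force
      have "\<bar>e * t\<bar> < d" using yt e by auto
      then have "p \<notin> \<Union>(A - {L})" using d(2) yt by blast
      moreover have "p \<notin> L" using cl_in[OF L] yt e by auto
      ultimately show "p \<in> - \<Union>A" by blast
    qed
    have "cl L (x, e * (d/2)) \<in> ?H" using d(1) by (intro image_eqI[of _ _ "(x, d/2)"]) auto
    then have "- \<Union>A \<noteq> {}" using sub by auto
    then obtain P where P: "P \<in> components (- \<Union>A)" "?H \<subseteq> P"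
      using exists_component_superset[OF sub _ box_half_connected[OF L]] by auto
    have "cl L (y, e * t) \<in> P" if "\<bar>y - x\<bar> < d" "0 < t" "t < d" for y t
    proof -
      have "cl L (y, e * t) \<in> ?H" using that by (intro image_eqI[of _ _ "(y, t)"]) auto
      then show ?thesis using P(2) by blast
    qed
    then show ?thesis using P(1) d(1) unfolding polygons_def by blast
  qed
  then obtain P d where Pd: "\<And>x. x \<in> ?J \<Longrightarrow> P x \<in> polygons A \<and> d x > 0 \<and>
      (\<forall>y t. \<bar>y - x\<bar> < d x \<longrightarrow> 0 < t \<longrightarrow> t < d x \<longrightarrow> cl L (y, e * t) \<in> P x)"
    by metis
  have const: "P x = P z" if "x \<in> ?J" "z \<in> ?J" for x z
  proof (rule connected_local_const[of ?J])
    show "\<forall>a\<in>?J. \<forall>\<^sub>F b in at a within ?J. P a = P b"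
    proof
      fix a assume a: "a \<in> ?J"
      have "P a = P b" if b: "b \<in> ?J" "dist b a < d a" for b
      proof -
        define t where "t = min (d a) (d b) / 2"
        have "d a > 0" "d b > 0" using Pd[OF a] Pd[OF b(1)] by auto
        then have t: "0 < t" "t < d a" "t < d b" unfolding t_def by auto
        have "cl L (b, e * t) \<in> P a" using Pd[OF a] b(2) t by (simp add: dist_real_def)
        moreover have "cl L (b, e * t) \<in> P b" using Pd[OF b(1)] t by simp
        ultimately show ?thesis using Pd[OF a] Pd[OF b(1)] components_eq unfolding polygons_def by blast
      qed
      then show "\<forall>\<^sub>F b in at a within ?J. P a = P b"
        using Pd[OF a] unfolding eventually_at by blast
    qed
  qed (use that in auto)
  define z where "z = (th L k + th L (Suc k)) / 2"
  have z: "z \<in> ?J" using th_mono[OF L, of k "Suc k"] by (auto simp: z_def)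
  have "\<exists>d>0. \<forall>y t. \<bar>y - x\<bar> < d \<longrightarrow> 0 < t \<longrightarrow> t < d \<longrightarrow> cl L (y, e * t) \<in> P z" if "x \<in> ?J" for x
    using Pd[OF that] const[OF that z] by metis
  then have "faces_side L k e (P z)" unfolding faces_side_def using Pd[OF z] by simp
  then show ?thesis by blast
qed

definition pol :: "rp2 set \<Rightarrow> nat \<Rightarrow> real \<Rightarrow> rp2 set" where
  "pol L k e = (SOME P. faces_side L k e P)"

lemma pol: "L \<in> A \<Longrightarrow> e = 1 \<or> e = -1 \<Longrightarrow> faces_side L k e (pol L k e)"
  unfolding pol_def using faces_side_ex someI_ex by metis

lemma pol_polygon: "L \<in> A \<Longrightarrow> e = 1 \<or> e = -1 \<Longrightarrow> pol L k e \<in> polygons A"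
  using pol unfolding faces_side_def by blast

lemma pol_near:
  assumes "L \<in> A" "e = 1 \<or> e = -1" "th L k < x" "x < th L (Suc k)"
  shows "\<exists>d>0. \<forall>y t. \<bar>y - x\<bar> < d \<longrightarrow> 0 < t \<longrightarrow> t < d \<longrightarrow> cl L (y, e * t) \<in> pol L k e"
  using pol[OF assms(1,2), of k] assms(3,4) unfolding faces_side_def by blast

lemma polygon_eq: "P \<in> polygons A \<Longrightarrow> Q \<in> polygons A \<Longrightarrow> p \<in> P \<Longrightarrow> p \<in> Q \<Longrightarrow> P = Q"
  using components_eq unfolding polygons_def by blast

lemma polygon_disj: "P \<in> polygons A \<Longrightarrow> L \<in> A \<Longrightarrow> P \<inter> L = {}"
  using in_components_subset unfolding polygons_def by blast

lemma polygon_superset: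
  assumes "P \<in> polygons A" "connected S" "S \<inter> \<Union>A = {}" "p \<in> S" "p \<in> P"
  shows "S \<subseteq> P"
  using components_maximal[of P "- \<Union>A" S] assms unfolding polygons_def by blast

lemma mid_point:
  assumes "L \<in> A"
  obtains x where "th L k < x" "x < th L (Suc k)"
  using th_mono[OF assms, of k "Suc k"] dense by auto

text \<open>The point at parameter \<open>x + pi\<close> and height \<open>t\<close> is the point at
  \<open>x\<close> and height \<open>-t\<close>, so one turn exchanges the sides. Here one-sidedness
  becomes a statement about polygons.\<close>

lemma pol_per:
  assumes L: "L \<in> A" and e: "e = 1 \<or> e = -1"
  shows "pol L (k + m) e = pol L k (- e)"
proof -
  obtain x where x: "th L k < x" "x < th L (Suc k)" by (rule mid_point[OF L])
  have e': "- e = 1 \<or> - e = -1" using e by auto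
  have x': "th L (k + m) < x + pi" "x + pi < th L (Suc (k + m))"
    using x th_per[OF L, of k] th_per[OF L, of "Suc k"] by auto
  obtain d1 where d1: "d1 > 0" "\<And>y t. \<bar>y - x\<bar> < d1 \<Longrightarrow> 0 < t \<Longrightarrow> t < d1 \<Longrightarrow> cl L (y, - e * t) \<in> pol L k (- e)"
    using pol_near[OF L e' x] by blast
  obtain d2 where d2: "d2 > 0" "\<And>y t. \<bar>y - (x + pi)\<bar> < d2 \<Longrightarrow> 0 < t \<Longrightarrow> t < d2 \<Longrightarrow> cl L (y, e * t) \<in> pol L (k + m) e"
    using pol_near[OF L e x'] by blast
  define t where "t = min d1 d2 / 2"
  have t: "0 < t" "t < d1" "t < d2" unfolding t_def using d1 d2 by auto
  have "cl L (x + pi, e * t) = cl L (x, - e * t)" using cl_pi[OF L] by simp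
  moreover have "cl L (x + pi, e * t) \<in> pol L (k + m) e" using d2 t by simp
  moreover have "cl L (x, - e * t) \<in> pol L k (- e)" using d1 t by simp
  ultimately show ?thesis using polygon_eq pol_polygon[OF L e] pol_polygon[OF L e'] by metis
qed

lemma seg_closure_pol:
  assumes L: "L \<in> A" and e: "e = 1 \<or> e = -1" and p: "p \<in> seg L k"
  shows "p \<in> closure (pol L k e)"
proof (rule closureI_meets)
  fix U assume U: "open U" "p \<in> U"
  obtain x where x: "th L k < x" "x < th L (Suc k)" "p = cl L (x, 0)" using p by (auto simp: seg_def)
  obtain d1 where d1: "d1 > 0" "\<And>y t. \<bar>y - x\<bar> < d1 \<Longrightarrow> 0 < t \<Longrightarrow> t < d1 \<Longrightarrow> cl L (y, e * t) \<in> pol L k e"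
    using pol_near[OF L e x(1,2)] by blast
  obtain d2 where d2: "d2 > 0" "\<And>y s. \<bar>y - x\<bar> < d2 \<Longrightarrow> \<bar>s - 0\<bar> < d2 \<Longrightarrow> cl L (y, s) \<in> U"
    using box_ex[OF L U(1), of x 0] U(2) x(3) by blast
  define t where "t = min d1 d2 / 2"
  have t: "0 < t" "t < d1" "t < d2" unfolding t_def using d1 d2 by auto
  have "cl L (x, e * t) \<in> pol L k e" using d1 t by simp
  moreover have "cl L (x, e * t) \<in> U" using d2 t e by auto
  ultimately show "U \<inter> pol L k e \<noteq> {}" by blast
qed

lemma seg_side_pol:
  assumes L: "L \<in> A" and e: "e = 1 \<or> e = -1"
  shows "seg L k \<in> sides A (pol L k e)"
proof -
  have "p \<in> frontier (pol L k e)" if "p \<in> seg L k" for p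
  proof -
    have "p \<in> L" using that seg_subset[OF L] by blast
    then have "p \<notin> pol L k e" using polygon_disj[OF pol_polygon[OF L e, of k] L] by blast
    then show ?thesis using seg_closure_pol[OF L e that] interior_subset unfolding frontier_def by blast
  qed
  then show ?thesis unfolding sides_def using seg_in_segments[OF L] by blast
qed

text \<open>Near an interior point of a segment the complement of the line consists of two
  half-boxes, so no third polygon comes close.\<close>

lemma closure_seg_pol:
  assumes L: "L \<in> A" and P: "P \<in> polygons A" and p: "p \<in> seg L k" "p \<in> closure P"
  shows "\<exists>e. (e = 1 \<or> e = -1) \<and> P = pol L k e"
proof -
  obtain x where x: "th L k < x" "x < th L (Suc k)" "p = cl L (x, 0)" using p by (auto simp: seg_def)
  obtain d1 where d1: "d1 > 0" "\<And>y t. \<bar>y - x\<bar> < d1 \<Longrightarrow> 0 < t \<Longrightarrow> t < d1 \<Longrightarrow> cl L (y, 1 * t) \<in> pol L k 1"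
    using pol_near[OF L _ x(1,2), of 1] by blast
  obtain d2 where d2: "d2 > 0" "\<And>y t. \<bar>y - x\<bar> < d2 \<Longrightarrow> 0 < t \<Longrightarrow> t < d2 \<Longrightarrow> cl L (y, (-1) * t) \<in> pol L k (-1)"
    using pol_near[OF L _ x(1,2), of "-1"] by blast
  define d where "d = min d1 d2"
  have d: "d > 0" "d \<le> d1" "d \<le> d2" unfolding d_def using d1 d2 by auto
  let ?B = "{x - d<..<x + d} \<times> {-d<..<d}"
  have "open (cl L ` ?B)" by (intro cl_open[OF L] open_Times) auto
  moreover have "p \<in> cl L ` ?B" unfolding x(3) using d by (intro imageI) auto
  ultimately have "cl L ` ?B \<inter> P \<noteq> {}" using in_closure_meets p(2) by blast
  then obtain y t where yt: "\<bar>y - x\<bar> < d" "\<bar>t\<bar> < d" "cl L (y, t) \<in> P" by force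
  have "t \<noteq> 0" using cl_in[OF L, of y t] yt(3) polygon_disj[OF P L] by blast
  then consider "t > 0" | "t < 0" by linarith
  then show ?thesis
  proof cases
    case 1
    then have "cl L (y, t) \<in> pol L k 1" using d1(2)[of y t] yt d by simp
    then show ?thesis using polygon_eq[OF P pol_polygon[OF L] yt(3)] by blast
  next
    case 2
    then have "cl L (y, t) \<in> pol L k (-1)" using d2(2)[of y "-t"] yt d by simp
    then show ?thesis using polygon_eq[OF P pol_polygon[OF L] yt(3)] by blast
  qed
qed

text \<open>Replaces the frontier condition in \<open>sides\<close> by an equation that can be
  handled with indices and signs.\<close>

lemma side_iff_pol:
  assumes L: "L \<in> A" and P: "P \<in> polygons A"
  shows "seg L k \<in> sides A P \<longleftrightarrow> (\<exists>e. (e = 1 \<or> e = -1) \<and> P = pol L k e)"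
proof
  assume s: "seg L k \<in> sides A P"
  obtain p where p: "p \<in> seg L k" using seg_nonempty[OF L] by blast
  then have "p \<in> closure P" using s unfolding sides_def frontier_def by blast
  then show "\<exists>e. (e = 1 \<or> e = -1) \<and> P = pol L k e" using closure_seg_pol[OF L P p] by blast
qed (use seg_side_pol[OF L] in blast)

lemma closure_seg_side:
  assumes "L \<in> A" "P \<in> polygons A" "p \<in> seg L k" "p \<in> closure P"
  shows "seg L k \<in> sides A P"
  using closure_seg_pol[OF assms] side_iff_pol[OF assms(1,2)] by blast

end

section \<open>The four polygons around a crossing\<close>

lemma quadrant_connected:
  "connected {x :: real^2. x \<in> ball 0 r \<and> a * x$1 > 0 \<and> b * x$2 > 0}"
  "connected {x :: real^2. x \<in> ball 0 r \<and> b * x$2 > 0}"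
proof -
  have h: "convex {x :: real^2. b * x$i > 0}" for b i
  proof -
    have "{x :: real^2. b * x$i > 0} = {x. inner (b *\<^sub>R axis i 1) x > 0}"
      by (simp add: inner_axis')
    then show ?thesis by (simp only: convex_halfspace_gt)
  qed
  have "{x :: real^2. x \<in> ball 0 r \<and> a * x$1 > 0 \<and> b * x$2 > 0} =
      ball 0 r \<inter> ({x. a * x$1 > 0} \<inter> {x. b * x$2 > 0})" by auto
  then show "connected {x :: real^2. x \<in> ball 0 r \<and> a * x$1 > 0 \<and> b * x$2 > 0}"
    using h by (simp only:) (intro convex_connected convex_Int convex_ball h)
  have "{x :: real^2. x \<in> ball 0 r \<and> b * x$2 > 0} = ball 0 r \<inter> {x. b * x$2 > 0}" by auto
  then show "connected {x :: real^2. x \<in> ball 0 r \<and> b * x$2 > 0}"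
    using h by (simp only:) (intro convex_connected convex_Int convex_ball h)
qed

lemma connected_pick:
  assumes "connected S" "open U" "open V" "S \<subseteq> U \<union> V" "U \<inter> V = {}"
  shows "S \<subseteq> U \<or> S \<subseteq> V"
  using connectedD[OF assms(1-3)] assms(4,5) by blast

lemma sign_pick:
  fixes u :: "real \<Rightarrow> real"
  assumes "continuous_on {a<..<b} u" "\<And>y. a < y \<Longrightarrow> y < b \<Longrightarrow> u y \<noteq> 0"
  shows "\<exists>s. (s = 1 \<or> s = -1) \<and> (\<forall>y. a < y \<longrightarrow> y < b \<longrightarrow> s * u y > 0)"
proof -
  have "connected (u ` {a<..<b})" by (rule connected_continuous_image[OF assms(1)]) simp
  moreover have "u ` {a<..<b} \<subseteq> {0<..} \<union> {..<0}"
    using assms(2) by (auto simp: image_subset_iff) (metis linorder_neqE_linordered_idom)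
  moreover have "({0<..} :: real set) \<inter> {..<0} = {}" by auto
  ultimately have "u ` {a<..<b} \<subseteq> {0<..} \<or> u ` {a<..<b} \<subseteq> {..<0}"
    using connected_pick[OF _ open_greaterThan open_lessThan] by blast
  then show ?thesis
  proof
    assume "u ` {a<..<b} \<subseteq> {0<..}"
    then show ?thesis by (intro exI[of _ 1]) (auto simp: image_subset_iff)
  next
    assume "u ` {a<..<b} \<subseteq> {..<0}"
    then show ?thesis by (intro exI[of _ "-1"]) (auto simp: image_subset_iff)
  qed
qed

lemma real2_eq_0_iff: "(x :: real^2) = 0 \<longleftrightarrow> x$1 = 0 \<and> x$2 = 0"
  by (simp add: vec_eq_iff forall_2)

lemma nonzero_sign: "(r::real) \<noteq> 0 \<Longrightarrow> \<exists>s. (s = 1 \<or> s = -1) \<and> s * r > 0"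
  by (cases "r > 0") (auto intro: exI[of _ 1] exI[of _ "-1"])

context arrangement
begin

text \<open>The quadrants of the transversality chart lie in the polygons \<open>pol L k e\<close>
  and \<open>pol L (Suc k) e\<close>. On either side \<open>e\<close> of \<open>L\<close> the branch
  of \<open>M\<close> found there separates these two and so bounds both. \<open>c e\<close> is the
  index of this branch; the two sides of \<open>L\<close> receive different branches.\<close>

lemma corner:
  assumes L: "L \<in> A" and M: "M \<in> A" and LM: "L \<noteq> M"
    and pt: "cl L (th L (Suc k), 0) = cl M (th M (Suc j), 0)"
  shows "\<exists>c :: real \<Rightarrow> nat. c 1 \<noteq> c (-1) \<and> (\<forall>e. e = 1 \<or> e = -1 \<longrightarrow> (c e = j \<or> c e = Suc j) \<and>
     seg M (c e) \<in> sides A (pol L k e) \<and> seg M (c e) \<in> sides A (pol L (Suc k) e))"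
proof -
  define a where "a = th L (Suc k)"
  define b0 where "b0 = th M (Suc j)"
  define p where "p = cl L (a, 0)"
  have pM': "p = cl M (b0, 0)" using pt by (simp add: p_def a_def b0_def)
  have pL: "p \<in> L" unfolding p_def using cl_in[OF L] by simp
  have pM: "p \<in> M" unfolding pM' using cl_in[OF M] by simp
  obtain q where q: "L \<inter> M = {q}" "transversal_at L M q" "\<forall>N\<in>A - {L, M}. q \<notin> N"
    using meet_ex[OF L M LM] by auto
  have "q = p" using q(1) pL pM by auto
  obtain U h g where U: "open U" "p \<in> U" and hom: "homeomorphism U (ball (0 :: real^2) 1) h g"
    and hp: "h p = 0" and hL: "h ` (L \<inter> U) = {x \<in> ball 0 1. x $ 2 = 0}"
    and hM: "h ` (M \<inter> U) = {x \<in> ball 0 1. x $ 1 = 0}"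
    using q(2) unfolding \<open>q = p\<close> transversal_at_def by blast
  have gh: "g (h y) = y" if "y \<in> U" for y using homeomorphism_apply1[OF hom that] .
  have hg: "h (g x) = x" if "x \<in> ball 0 1" for x using homeomorphism_apply2[OF hom that] .
  have gU: "g x \<in> U" if "x \<in> ball 0 1" for x using homeomorphism_image2[OF hom] that by blast
  have gL: "g x \<in> L \<longleftrightarrow> x $ 2 = 0" if x: "x \<in> ball 0 1" for x
  proof
    assume "g x \<in> L"
    then have "h (g x) \<in> h ` (L \<inter> U)" using gU[OF x] by blast
    then show "x $ 2 = 0" using hL hg[OF x] by simp
  next
    assume "x $ 2 = 0"
    then have "x \<in> h ` (L \<inter> U)" using hL x by simp
    then obtain y where "y \<in> L" "y \<in> U" "x = h y" by blast
    then show "g x \<in> L" using gh by simp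
  qed
  have gM: "g x \<in> M \<longleftrightarrow> x $ 1 = 0" if x: "x \<in> ball 0 1" for x
  proof
    assume "g x \<in> M"
    then have "h (g x) \<in> h ` (M \<inter> U)" using gU[OF x] by blast
    then show "x $ 1 = 0" using hM hg[OF x] by simp
  next
    assume "x $ 1 = 0"
    then have "x \<in> h ` (M \<inter> U)" using hM x by simp
    then obtain y where "y \<in> M" "y \<in> U" "x = h y" by blast
    then show "g x \<in> M" using gh by simp
  qed
  have g0: "g 0 = p" using gh[OF U(2)] hp by simp
  have g_eq0: "x = 0" if "x \<in> ball 0 1" "g x = p" for x
    using hg[OF that(1)] that(2) hp by simp
  have contg: "continuous_on (ball 0 1) g" using homeomorphism_cont2[OF hom] .
  have openg: "open (g ` S)" if S: "open S" "S \<subseteq> ball 0 1" for S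
  proof -
    have "openin (top_of_set (ball 0 1)) S" using S by (simp add: openin_open_eq)
    then have "openin (top_of_set U) (g ` S)"
      by (rule homeomorphism_imp_open_map[OF homeomorphism_symD[OF hom]])
    then show ?thesis using U(1) by (simp add: openin_open_eq)
  qed
  have vimg: "open (g -` V \<inter> ball 0 1)" if "open V" for V
    using contg that by (simp add: continuous_on_open_vimage)
  have small: "\<exists>r>0. r \<le> 1 \<and> g ` ball 0 r \<subseteq> V" if V: "open V" "p \<in> V" for V
  proof -
    have "0 \<in> g -` V \<inter> ball 0 1" using V g0 by simp
    then obtain r where "r > 0" "ball 0 r \<subseteq> g -` V \<inter> ball 0 1"
      using vimg[OF V(1)] open_contains_ball by metis
    then have "ball 0 (min r 1) \<subseteq> g -` V" by auto
    then show ?thesis using \<open>r > 0\<close> by (intro exI[of _ "min r 1"]) auto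
  qed
  define d0 where "d0 = min (a - th L k) (min (th L (Suc (Suc k)) - a) 1)"
  have d0: "d0 > 0" "d0 \<le> a - th L k" "d0 \<le> th L (Suc (Suc k)) - a" "d0 \<le> 1"
    unfolding d0_def a_def using th_mono[OF L, of k "Suc k"] th_mono[OF L, of "Suc k" "Suc (Suc k)"] by auto
  let ?W = "\<Union>(A - {L, M})"
  have "closed ?W" using finA pl pseudo_line_closed by (intro closed_Union) auto
  moreover have "p \<notin> ?W" using q(3) \<open>q = p\<close> by blast
  moreover have "open (cl L ` ({a - d0<..<a + d0} \<times> {-d0<..<d0}))"
    by (intro cl_open[OF L] open_Times) auto
  moreover have "p \<in> cl L ` ({a - d0<..<a + d0} \<times> {-d0<..<d0})"
    unfolding p_def using d0(1) by (intro imageI) auto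
  \<comment> \<open>Over this ball no third line occurs and the collar of \<open>L\<close> is
    available, so signs in the chart can be compared with sides of \<open>L\<close>.\<close>
  ultimately obtain r1 where r1: "r1 > 0" "r1 \<le> 1"
    "g ` ball 0 r1 \<subseteq> cl L ` ({a - d0<..<a + d0} \<times> {-d0<..<d0}) \<inter> - ?W"
    using small[of "cl L ` ({a - d0<..<a + d0} \<times> {-d0<..<d0}) \<inter> - ?W"] by (auto simp: open_Int open_Compl)
  have b1: "x \<in> ball 0 1" if "x \<in> ball 0 r1" for x using that r1(2) by auto
  have rep: "\<exists>y t. \<bar>y - a\<bar> < d0 \<and> \<bar>t\<bar> < d0 \<and> g x = cl L (y, t)" if "x \<in> ball 0 r1" for x
  proof -
    have "g x \<in> cl L ` ({a - d0<..<a + d0} \<times> {-d0<..<d0})" using r1(3) that by blast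
    then obtain y t where "y \<in> {a - d0<..<a + d0}" "t \<in> {-d0<..<d0}" "g x = cl L (y, t)" by blast
    then show ?thesis by (intro exI[of _ y] exI[of _ t]) auto
  qed
  have noW: "g x \<notin> ?W" if "x \<in> ball 0 r1" for x using r1(3) that by blast
  define Np where "Np e = cl L ` ({a - d0<..<a + d0} \<times> {t. -d0 < t \<and> t < d0 \<and> e * t > 0})" for e :: real
  have NpI: "cl L (y, t) \<in> Np e" if "\<bar>y - a\<bar> < d0" "\<bar>t\<bar> < d0" "e * t > 0" for y t e
    unfolding Np_def using that by (intro imageI) auto
  have openNp: "open (Np e)" for e
  proof -
    have "open {t. -d0 < t \<and> t < d0 \<and> e * t > 0}"
      by (intro open_Collect_conj open_Collect_less continuous_intros)
    then show ?thesis unfolding Np_def by (intro cl_open[OF L] open_Times) auto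
  qed
  have Np_disj: "Np 1 \<inter> Np (-1) = {}"
  proof -
    have False if p1: "y \<in> {a - d0<..<a + d0}" "t > 0" and p2: "y' \<in> {a - d0<..<a + d0}" "t' < 0"
      and e: "cl L (y, t) = cl L (y', t')" for y t y' t'
    proof -
      have "\<bar>y - y'\<bar> < 2 * d0" using p1(1) p2(1) by auto
      then have "\<bar>y - y'\<bar> < pi" using d0(4) pi_gt3 by linarith
      then show False using cl_inj[OF L e] p1 p2 by simp
    qed
    then show ?thesis unfolding Np_def by fastforce
  qed
  have half: "\<exists>e. (e = 1 \<or> e = -1) \<and> g ` {x :: real^2. x \<in> ball 0 r1 \<and> b * x$2 > 0} \<subseteq> Np e" for b
  proof -
    let ?H = "{x :: real^2. x \<in> ball 0 r1 \<and> b * x$2 > 0}"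
    have "continuous_on ?H g" by (rule continuous_on_subset[OF contg]) (use b1 in blast)
    then have cn: "connected (g ` ?H)" by (intro connected_continuous_image quadrant_connected(2))
    have sb: "g ` ?H \<subseteq> Np 1 \<union> Np (-1)"
    proof (rule image_subsetI)
      fix x assume x: "x \<in> ?H"
      then obtain y t where yt: "\<bar>y - a\<bar> < d0" "\<bar>t\<bar> < d0" "g x = cl L (y, t)" using rep by blast
      have "g x \<notin> L" using gL[OF b1] x by auto
      then have "t \<noteq> 0" using cl_in[OF L] yt(3) by auto
      then show "g x \<in> Np 1 \<union> Np (-1)" using NpI[OF yt(1,2), of 1] NpI[OF yt(1,2), of "-1"] yt(3)
        by (cases "t > 0") auto
    qed
    have "g ` ?H \<subseteq> Np 1 \<or> g ` ?H \<subseteq> Np (-1)"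
      by (rule connected_pick[OF cn openNp openNp sb Np_disj])
    then show ?thesis by metis
  qed
  \<comment> \<open>The half-disc on which the second coordinate has sign \<open>b\<close> is mapped
    to a single side of \<open>L\<close>. That side gets a name because the chart need not respect
    the orientation of the collar.\<close>
  define be where "be b = (SOME e. (e = 1 \<or> e = -1) \<and> g ` {x :: real^2. x \<in> ball 0 r1 \<and> b * x$2 > 0} \<subseteq> Np e)" for b
  have be: "(be b = 1 \<or> be b = -1) \<and> g ` {x :: real^2. x \<in> ball 0 r1 \<and> b * x$2 > 0} \<subseteq> Np (be b)" for b
    unfolding be_def by (rule someI_ex[OF half])
  have opB: "open (g ` ball 0 r1)" by (rule openg) (use r1 in auto)
  have pB: "p \<in> g ` ball 0 r1" using g0 r1(1) by (metis centre_in_ball imageI)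
  obtain d2' where d2': "d2' > 0" "\<And>y s. \<bar>y - a\<bar> < d2' \<Longrightarrow> \<bar>s - 0\<bar> < d2' \<Longrightarrow> cl L (y, s) \<in> g ` ball 0 r1"
    using box_ex[OF L opB pB[unfolded p_def]] by blast
  define d2 where "d2 = min d2' d0"
  have d2: "d2 > 0" "d2 \<le> d2'" "d2 \<le> d0" unfolding d2_def using d2'(1) d0(1) by auto
  have Np_sep: "e = e'" if "w \<in> Np e" "w \<in> Np e'" "e = 1 \<or> e = -1" "e' = 1 \<or> e' = -1" for w e e'
    using that Np_disj by auto
  \<comment> \<open>A collar point just off the crossing on the opposite side also lies in the range
    of the chart, so both sides must occur.\<close>
  have be_inj: "be 1 \<noteq> be (-1)"
  proof
    assume eq: "be 1 = be (-1)"
    define e where "e = be 1"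
    have e: "e = 1 \<or> e = -1" using be e_def by simp
    have "cl L (a, - e * (d2/2)) \<in> g ` ball 0 r1" using d2'(2)[of a "- e * (d2/2)"] d2 e by auto
    then obtain x where x: "x \<in> ball 0 r1" "cl L (a, - e * (d2/2)) = g x" by blast
    have "g x \<notin> L" using cl_in[OF L, of a "- e * (d2/2)"] x(2) d2 e by auto
    then have "x $ 2 \<noteq> 0" using gL[OF b1[OF x(1)]] by simp
    then have "(1 * x $ 2 > 0) \<or> (-1) * x $ 2 > 0" by linarith
    then have "g x \<in> Np (be 1) \<or> g x \<in> Np (be (-1))" using be[of 1] be[of "-1"] x(1) by blast
    then have "g x \<in> Np e" using eq e_def by auto
    moreover have "g x \<in> Np (- e)" using NpI[of a "- e * (d2/2)" "- e"] x(2) d2 d0(1) e by auto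
    ultimately show False using Np_sep[of "g x" e "- e"] e by auto
  qed
  \<comment> \<open>A quadrant adjoins one half of the axis that represents \<open>L\<close>, hence
    a piece of segment \<open>i\<close>. Since it is connected and avoids all lines, it stays in the
    polygon met next to that piece.\<close>
  have quad: "\<exists>\<alpha>. (\<alpha> = 1 \<or> \<alpha> = -1) \<and>
      g ` {x :: real^2. x \<in> ball 0 r1 \<and> \<alpha> * x$1 > 0 \<and> b * x$2 > 0} \<subseteq> pol L i (be b)"
    if b: "b = 1 \<or> b = -1" and i: "i = k \<or> i = Suc k" for b i
  proof -
    define e where "e = be b"
    have e: "e = 1 \<or> e = -1" using be e_def by simp
    define y where "y = (if i = k then a - d2/2 else a + d2/2)"
    have ya: "\<bar>y - a\<bar> < d2" "y \<noteq> a" unfolding y_def using d2(1) by auto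
    have yi: "th L i < y" "y < th L (Suc i)"
      using i d2 d0 unfolding y_def a_def by auto
    have "cl L (y, 0) \<in> g ` ball 0 r1" using d2'(2)[of y 0] ya d2 by auto
    then obtain z where z: "z \<in> ball 0 r1" "cl L (y, 0) = g z" by blast
    have "g z \<in> L" using cl_in[OF L, of y 0] z(2) by simp
    then have "z $ 2 = 0" using gL[OF b1[OF z(1)]] by simp
    moreover have "z \<noteq> 0"
    proof
      assume "z = 0"
      then have "cl L (y, 0) = cl L (a, 0)" using z(2) g0 p_def by simp
      moreover have "\<bar>y - a\<bar> < pi" using ya d2 d0 pi_gt3 by linarith
      ultimately show False using cl_inj[OF L] ya by blast
    qed
    ultimately have "z $ 1 \<noteq> 0" using real2_eq_0_iff by blast
    then obtain \<alpha> where \<alpha>: "\<alpha> = 1 \<or> \<alpha> = -1" "\<alpha> * z $ 1 > 0" using nonzero_sign by blast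
    let ?S = "{x :: real^2. x \<in> ball 0 r1 \<and> \<alpha> * x$1 > 0}"
    have "open ?S" unfolding mem_ball by (intro open_Collect_conj open_Collect_less continuous_intros)
    then have "open (g ` ?S)" by (rule openg) (use b1 in blast)
    moreover have "cl L (y, 0) \<in> g ` ?S" using z \<alpha> by blast
    ultimately obtain d3 where d3: "d3 > 0" "\<And>y' s. \<bar>y' - y\<bar> < d3 \<Longrightarrow> \<bar>s - 0\<bar> < d3 \<Longrightarrow> cl L (y', s) \<in> g ` ?S"
      using box_ex[OF L, of "g ` ?S" y 0] by blast
    obtain d4 where d4: "d4 > 0" "\<And>y' t. \<bar>y' - y\<bar> < d4 \<Longrightarrow> 0 < t \<Longrightarrow> t < d4 \<Longrightarrow> cl L (y', e * t) \<in> pol L i e"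
      using pol_near[OF L e yi] by blast
    define t where "t = min d0 (min d3 d4) / 2"
    have t: "0 < t" "t < d3" "t < d4" "t < d0" unfolding t_def using d0(1) d3(1) d4(1) by auto
    have et: "\<bar>e * t\<bar> = t" "e * (e * t) = t" using e t(1) by auto
    have "cl L (y, e * t) \<in> g ` ?S" using d3(2)[of y "e * t"] t et d3(1) by auto
    then obtain x where x: "x \<in> ball 0 r1" "\<alpha> * x$1 > 0" "cl L (y, e * t) = g x" by blast
    have "g x \<notin> L" using cl_in[OF L, of y "e * t"] x(3) t e by auto
    then have "x $ 2 \<noteq> 0" using gL[OF b1[OF x(1)]] by simp
    then obtain b' where b': "b' = 1 \<or> b' = -1" "b' * x $ 2 > 0" using nonzero_sign by blast
    have "g x \<in> Np (be b')" using be[of b'] x(1) b'(2) by blast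
    moreover have "g x \<in> Np e" using NpI[of y "e * t" e] x(3) t et ya d2 by auto
    ultimately have "be b' = e" using Np_sep be e by blast
    then have "b' = b" using be_inj b b'(1) e_def by auto
    let ?Q = "{x :: real^2. x \<in> ball 0 r1 \<and> \<alpha> * x$1 > 0 \<and> b * x$2 > 0}"
    have "continuous_on ?Q g" by (rule continuous_on_subset[OF contg]) (use b1 in blast)
    then have "connected (g ` ?Q)" by (intro connected_continuous_image quadrant_connected(1))
    moreover have "g ` ?Q \<inter> \<Union>A = {}"
    proof -
      have "g x \<notin> \<Union>A" if "x \<in> ?Q" for x
      proof -
        have "x \<in> ball 0 r1" "x $ 1 \<noteq> 0" "x $ 2 \<noteq> 0" using that by auto
        then have "g x \<notin> L" "g x \<notin> M" "g x \<notin> ?W" using gL[OF b1] gM[OF b1] noW by auto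
        then show ?thesis by blast
      qed
      then show ?thesis by blast
    qed
    moreover have "g x \<in> g ` ?Q" using x b' \<open>b' = b\<close> by blast
    moreover have "g x \<in> pol L i e" using d4(2)[of y t] x(3) t d4(1) by auto
    ultimately have "g ` ?Q \<subseteq> pol L i e" using polygon_superset[OF pol_polygon[OF L e]] by blast
    then show ?thesis using \<alpha>(1) e_def by blast
  qed
  have clos: "g x \<in> closure (pol L i (be b))"
    if b: "b = 1 \<or> b = -1" and i: "i = k \<or> i = Suc k" and x: "x \<in> ball 0 r1" "x $ 1 = 0" "b * x $ 2 > 0" for b i x
  proof (rule closureI_meets)
    fix V assume V: "open V" "g x \<in> V"
    obtain \<alpha> where \<alpha>: "\<alpha> = 1 \<or> \<alpha> = -1"
      "g ` {x :: real^2. x \<in> ball 0 r1 \<and> \<alpha> * x$1 > 0 \<and> b * x$2 > 0} \<subseteq> pol L i (be b)" using quad[OF b i] by blast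
    have "open ((g -` V \<inter> ball 0 1) \<inter> ball 0 r1)" using vimg[OF V(1)] by auto
    moreover have "x \<in> (g -` V \<inter> ball 0 1) \<inter> ball 0 r1" using V(2) x(1) b1[OF x(1)] by simp
    ultimately obtain \<rho> where \<rho>: "\<rho> > 0" "ball x \<rho> \<subseteq> (g -` V \<inter> ball 0 1) \<inter> ball 0 r1"
      using open_contains_ball by metis
    define x' where "x' = x + (\<rho>/2 * \<alpha>) *\<^sub>R axis 1 1"
    have "dist x x' = \<rho>/2" unfolding x'_def dist_norm using \<alpha>(1) \<rho>(1) by auto
    then have "x' \<in> ball x \<rho>" using \<rho>(1) by simp
    then have x'2: "x' \<in> ball 0 r1" "g x' \<in> V" using \<rho>(2) by auto
    have "x' $ 1 = \<rho>/2 * \<alpha>" "x' $ 2 = x $ 2" unfolding x'_def using x(2) by (auto simp: axis_def)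
    then have "\<alpha> * x' $ 1 > 0" "b * x' $ 2 > 0" using \<alpha>(1) \<rho>(1) x(3) by auto
    then have "g x' \<in> pol L i (be b)" using \<alpha>(2) x'2(1) by blast
    then show "V \<inter> pol L i (be b) \<noteq> {}" using x'2(2) by blast
  qed
  \<comment> \<open>the two branches of \<open>M\<close> at the crossing lie on different sides of \<open>L\<close>\<close>
  obtain d1' where d1': "d1' > 0" "\<And>y s. \<bar>y - b0\<bar> < d1' \<Longrightarrow> \<bar>s - 0\<bar> < d1' \<Longrightarrow> cl M (y, s) \<in> g ` ball 0 r1"
    using box_ex[OF M opB pB[unfolded pM']] by blast
  define d1 where "d1 = min d1' (min (b0 - th M j) (min (th M (Suc (Suc j)) - b0) 1))"
  have d1: "d1 > 0" "d1 \<le> d1'" "d1 \<le> b0 - th M j" "d1 \<le> th M (Suc (Suc j)) - b0" "d1 \<le> 1"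
    unfolding d1_def b0_def
    using th_mono[OF M, of j "Suc j"] th_mono[OF M, of "Suc j" "Suc (Suc j)"] d1'(1) by auto
  have br: "\<exists>x. x \<in> ball 0 r1 \<and> cl M (y, 0) = g x \<and> x $ 1 = 0 \<and> x $ 2 \<noteq> 0 \<and> h (cl M (y, 0)) = x"
    if y: "\<bar>y - b0\<bar> < d1" "y \<noteq> b0" for y
  proof -
    have "cl M (y, 0) \<in> g ` ball 0 r1" using d1'(2)[of y 0] y d1 d1'(1) by auto
    then obtain x where x: "x \<in> ball 0 r1" "cl M (y, 0) = g x" by blast
    have "g x \<in> M" using cl_in[OF M, of y 0] x(2) by simp
    then have x1: "x $ 1 = 0" using gM[OF b1[OF x(1)]] by simp
    have "x \<noteq> 0"
    proof
      assume "x = 0"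
      then have "cl M (y, 0) = cl M (b0, 0)" using x(2) g0 pM' by simp
      moreover have "\<bar>y - b0\<bar> < pi" using y d1 pi_gt3 by linarith
      ultimately show False using cl_inj[OF M] y by blast
    qed
    then have "x $ 2 \<noteq> 0" using x1 real2_eq_0_iff by blast
    then show ?thesis using x x1 hg[OF b1[OF x(1)]] by auto
  qed
  define u where "u y = h (cl M (y, 0)) $ 2" for y
  have gB_U: "g ` ball 0 r1 \<subseteq> U" using gU b1 by blast
  have contu: "continuous_on {b0 - d1<..<b0 + d1} u"
  proof -
    have "continuous_on {b0 - d1<..<b0 + d1} (\<lambda>y. cl M (y, 0))"
      by (rule continuous_on_compose2[OF cl_cont[OF M, of UNIV]]) (auto intro!: continuous_intros)
    moreover have "(\<lambda>y. cl M (y, 0)) ` {b0 - d1<..<b0 + d1} \<subseteq> U"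
    proof (rule image_subsetI)
      fix y assume "y \<in> {b0 - d1<..<b0 + d1}"
      then have "cl M (y, 0) \<in> g ` ball 0 r1" using d1'(2)[of y 0] d1 by auto
      then show "cl M (y, 0) \<in> U" using gB_U by blast
    qed
    ultimately have "continuous_on {b0 - d1<..<b0 + d1} (\<lambda>y. h (cl M (y, 0)))"
      using continuous_on_compose2[OF homeomorphism_cont1[OF hom]] by blast
    then show ?thesis unfolding u_def by (intro continuous_intros)
  qed
  have u0: "u y \<noteq> 0" if "\<bar>y - b0\<bar> < d1" "y \<noteq> b0" for y using br[OF that] unfolding u_def by auto
  have "continuous_on {b0<..<b0 + d1} u" by (rule continuous_on_subset[OF contu]) (use d1 in auto)
  then obtain s where s: "s = 1 \<or> s = -1" "\<And>y. b0 < y \<Longrightarrow> y < b0 + d1 \<Longrightarrow> s * u y > 0"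
    using sign_pick[of b0 "b0 + d1" u] u0 by fastforce
  have "continuous_on {b0 - d1<..<b0} u" by (rule continuous_on_subset[OF contu]) (use d1 in auto)
  then obtain s' where s': "s' = 1 \<or> s' = -1" "\<And>y. b0 - d1 < y \<Longrightarrow> y < b0 \<Longrightarrow> s' * u y > 0"
    using sign_pick[of "b0 - d1" b0 u] u0 by fastforce
  \<comment> \<open>If both branches had the same sign, the points of \<open>M\<close> in the chart
    with the other sign would not be reached by the parametrisation of \<open>M\<close>.\<close>
  have ss: "s' = - s"
  proof -
    have "open (cl M ` ({b0 - d1<..<b0 + d1} \<times> UNIV))" by (intro cl_open[OF M] open_Times) auto
    moreover have "p \<in> cl M ` ({b0 - d1<..<b0 + d1} \<times> UNIV)"
      unfolding pM' using d1(1) by (intro imageI) auto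
    ultimately obtain r2 where r2: "r2 > 0" "r2 \<le> 1" "g ` ball 0 r2 \<subseteq> cl M ` ({b0 - d1<..<b0 + d1} \<times> UNIV)"
      using small by blast
    define x :: "real^2" where "x = (- s * (r2/2)) *\<^sub>R axis 2 1"
    have nx: "norm x = r2/2" unfolding x_def using s(1) r2(1) by auto
    have x12: "x $ 1 = 0" "x $ 2 = - s * (r2/2)" unfolding x_def by (auto simp: axis_def)
    have xb: "x \<in> ball 0 r2" "x \<in> ball 0 1" using nx r2 by auto
    have "g x \<in> cl M ` ({b0 - d1<..<b0 + d1} \<times> UNIV)" using xb r2(3) by blast
    then obtain y t where yt: "y \<in> {b0 - d1<..<b0 + d1}" "g x = cl M (y, t)" by blast
    have "g x \<in> M" using gM[OF xb(2)] x12 by simp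
    then have "t = 0" using cl_in[OF M] yt(2) by auto
    then have uy: "u y = - s * (r2/2)" unfolding u_def using yt(2) hg[OF xb(2)] x12 by simp
    have "y \<noteq> b0"
    proof
      assume "y = b0"
      then have "g x = p" using yt(2) \<open>t = 0\<close> pM' by simp
      then show False using g_eq0[OF xb(2)] nx r2(1) by simp
    qed
    have "\<not> y > b0"
    proof
      assume "y > b0"
      then have "s * u y > 0" using s(2) yt(1) by auto
      then show False using uy s(1) r2(1) by auto
    qed
    then have "s' * u y > 0" using s'(2)[of y] yt(1) \<open>y \<noteq> b0\<close> by auto
    then show ?thesis using uy s(1) s'(1) r2(1) by auto
  qed
  define cc where "cc b = (if b = s then Suc j else j)" for b :: real
  have side: "seg M (cc b) \<in> sides A (pol L i (be b))"
    if b: "b = 1 \<or> b = -1" and i: "i = k \<or> i = Suc k" for b i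
  proof -
    define y where "y = (if b = s then b0 + d1/2 else b0 - d1/2)"
    have y: "\<bar>y - b0\<bar> < d1" "y \<noteq> b0" unfolding y_def using d1(1) by auto
    have "b * u y > 0"
    proof (cases "b = s")
      case True
      then show ?thesis using s(2)[of y] d1(1) unfolding y_def by simp
    next
      case False
      then have "b = s'" using b s(1) ss by auto
      then show ?thesis using s'(2)[of y] d1(1) False unfolding y_def by simp
    qed
    moreover obtain x where x: "x \<in> ball 0 r1" "cl M (y, 0) = g x" "x $ 1 = 0" "h (cl M (y, 0)) = x"
      using br[OF y] by blast
    ultimately have "g x \<in> closure (pol L i (be b))" using clos[OF b i x(1,3)] unfolding u_def by simp
    moreover have "cl M (y, 0) \<in> seg M (cc b)"
    proof -
      have "th M (cc b) < y" "y < th M (Suc (cc b))"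
        unfolding cc_def y_def using d1 unfolding b0_def by auto
      then show ?thesis unfolding seg_def by (intro imageI) auto
    qed
    ultimately show ?thesis
      using closure_seg_side[OF M pol_polygon[OF L]] x(2) be by metis
  qed
  define c where "c e = cc (if be 1 = e then 1 else -1)" for e
  have cs: "be (if be 1 = e then 1 else -1) = e" if "e = 1 \<or> e = -1" for e
    using that be[of 1] be[of "-1"] be_inj by auto
  have "c 1 \<noteq> c (-1)"
    unfolding c_def cc_def using be[of 1] s(1) by auto
  moreover have "(c e = j \<or> c e = Suc j) \<and> seg M (c e) \<in> sides A (pol L k e) \<and> seg M (c e) \<in> sides A (pol L (Suc k) e)"
    if e: "e = 1 \<or> e = -1" for e
  proof (intro conjI)
    show "c e = j \<or> c e = Suc j" unfolding c_def cc_def by simp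
    let ?b = "if be 1 = e then 1 else -1 :: real"
    have "?b = 1 \<or> ?b = -1" by simp
    from side[OF this] cs[OF e]
    show "seg M (c e) \<in> sides A (pol L k e)" "seg M (c e) \<in> sides A (pol L (Suc k) e)"
      unfolding c_def by metis+
  qed
  ultimately show ?thesis by blast
qed

end

section \<open>The upper bound\<close>

lemma triple_bound_real:
  assumes "3 * a + b \<le> n * (n - c)" "c \<le> n"
  shows "3 * real a + real b \<le> real n * (real n - real c)"
proof -
  have "real (3 * a + b) \<le> real (n * (n - c))" using assms(1) by (simp only: of_nat_le_iff)
  then show ?thesis using assms(2) by (simp add: of_nat_diff)
qed

context arrangement
begin

section \<open>Sides and vertices of triangles\<close>

definition tri :: "rp2 set \<Rightarrow> bool" where
  "tri P \<longleftrightarrow> P \<in> polygons A \<and> card (sides A P) = 3"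

text \<open>The search starts at \<open>th L 2\<close> in order to obtain \<open>1 \<le> j\<close>.
  Then both segments \<open>j\<close> and \<open>Suc j\<close> at the vertex have positive index,
  which \<open>end_line_side\<close> asks for.\<close>

lemma vertex_index:
  assumes L: "L \<in> A" and M: "M \<in> A" "L \<noteq> M" and p: "p \<in> L" "p \<in> M"
  shows "\<exists>j\<ge>1. p = cl L (th L (Suc j), 0)"
proof -
  obtain x where x: "th L 2 \<le> x" "p = cl L (x, 0)" using cl_ex_from[OF L p(1)] by blast
  have "x \<in> va L" unfolding va_def using x(2) p(2) M by auto
  moreover have "th L 0 \<le> x" using x(1) th_mono_le[OF L, of 0 2] by linarith
  ultimately obtain i where i: "x = th L i" using th_surj[OF L] by blast
  then have "2 \<le> i" using x(1) th_mono_le[OF L] by simp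
  then show ?thesis using i x(2) by (intro exI[of _ "i - 1"]) auto
qed

lemma vertex_line:
  assumes "L \<in> A"
  obtains M where "M \<in> A" "L \<noteq> M" "cl L (th L k, 0) \<in> M"
  using th_va[OF assms, of k] unfolding va_def by blast

definition turns :: "rp2 set \<Rightarrow> nat \<Rightarrow> rp2 set \<Rightarrow> nat \<Rightarrow> (real \<Rightarrow> nat) \<Rightarrow> bool" where
  "turns L k M j c \<longleftrightarrow> c 1 \<noteq> c (-1) \<and> (\<forall>e. e = 1 \<or> e = -1 \<longrightarrow> (c e = j \<or> c e = Suc j) \<and>
     seg M (c e) \<in> sides A (pol L k e) \<and> seg M (c e) \<in> sides A (pol L (Suc k) e))"

lemma turnsD:
  assumes "turns L k M j c"
  shows "c 1 \<noteq> c (-1)" "e = 1 \<or> e = -1 \<Longrightarrow> c e = j \<or> c e = Suc j"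
    "e = 1 \<or> e = -1 \<Longrightarrow> seg M (c e) \<in> sides A (pol L k e)"
    "e = 1 \<or> e = -1 \<Longrightarrow> seg M (c e) \<in> sides A (pol L (Suc k) e)"
  using assms unfolding turns_def by auto

lemma turns_neq: "turns L k M j c \<Longrightarrow> e = 1 \<or> e = -1 \<Longrightarrow> e' = 1 \<or> e' = -1 \<Longrightarrow> e \<noteq> e' \<Longrightarrow> c e \<noteq> c e'"
  using turnsD(1)[of L k M j c] by auto

lemma corner_ex:
  assumes L: "L \<in> A" and M: "M \<in> A" "L \<noteq> M" and p: "cl L (th L (Suc k), 0) \<in> M"
  obtains j c where "1 \<le> j" "cl L (th L (Suc k), 0) = cl M (th M (Suc j), 0)" "turns L k M j c"
proof -
  have "cl L (th L (Suc k), 0) \<in> L" using cl_in[OF L] by simp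
  then obtain j where j: "1 \<le> j" "cl L (th L (Suc k), 0) = cl M (th M (Suc j), 0)"
    using vertex_index[OF M(1) L M(2)[symmetric] p] by auto
  obtain c where "turns L k M j c" using corner[OF L M j(2)] unfolding turns_def by blast
  then show thesis using j by (intro that[of j c])
qed

lemma sides_segments: "s \<in> sides A P \<Longrightarrow> s \<in> segments A"
  by (simp add: sides_def)

lemma segment_on_line:
  assumes "s \<in> segments A" "L \<in> A" "s \<subseteq> L"
  obtains k where "k < m" "s = seg L (Suc k)"
proof -
  obtain L' k where L': "L' \<in> A" "k < m" "s = seg L' (Suc k)" by (rule segments_cases[OF assms(1)])
  have "L' = L"
  proof (rule ccontr)
    assume "L' \<noteq> L"
    then have "s \<inter> L = {}" using seg_disj_line[OF L'(1) assms(2)] L'(3) by simp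
    moreover have "s \<noteq> {}" using seg_nonempty[OF L'(1)] L'(3) by simp
    ultimately show False using assms(3) by auto
  qed
  then show thesis using that L' by simp
qed

lemma segment_one_line:
  assumes "s \<in> segments A" "L \<in> A" "s \<subseteq> L" "M \<in> A" "s \<subseteq> M"
  shows "L = M"
proof (rule ccontr)
  assume "L \<noteq> M"
  obtain k where "s = seg L (Suc k)" by (rule segment_on_line[OF assms(1-3)])
  then have "s \<inter> M = {}" "s \<noteq> {}"
    using seg_disj_line[OF assms(2,4) \<open>L \<noteq> M\<close>] seg_nonempty[OF assms(2)] by auto
  then show False using assms(5) by auto
qed

lemma side_pol_cases:
  assumes "L \<in> A" "P \<in> polygons A" "seg L k \<in> sides A P"
  obtains e where "e = 1 \<or> e = -1" "P = pol L k e"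
  using side_iff_pol[OF assms(1,2), of k] assms(3) by auto

text \<open>At an end of a side the boundary of the polygon turns into the other line, by the local
  picture in \<open>corner\<close>.\<close>

lemma end_line_side:
  assumes M: "M \<in> A" and P: "P \<in> polygons A" and s: "seg M i \<in> sides A P" and i: "1 \<le> i"
    and K: "K \<in> A" "M \<noteq> K" and w: "cl M (th M v, 0) \<in> K" and v: "v = i \<or> v = Suc i"
  shows "\<exists>s\<in>sides A P. s \<subseteq> K"
proof -
  obtain e where e: "e = 1 \<or> e = -1" "P = pol M i e" by (rule side_pol_cases[OF M P s])
  obtain k where k: "v = Suc k" using v i by (cases v) auto
  then have "i = k \<or> i = Suc k" using v by auto
  obtain j c where c: "turns M k K j c" by (rule corner_ex[OF M K w[unfolded k]])
  have "seg K (c e) \<in> sides A P" using turnsD(3,4)[OF c e(1)] e(2) \<open>i = k \<or> i = Suc k\<close> by auto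
  then show ?thesis using seg_subset[OF K(1)] by blast
qed

text \<open>Two lines meet once, and the collar separates parameters that are less than one turn
  apart.\<close>

lemma vertices_distinct:
  assumes L: "L \<in> A" and N: "N \<in> A" "L \<noteq> N"
    and i: "cl L (th L i, 0) \<in> N" "cl L (th L j, 0) \<in> N" "i < j" "j < i + m"
  shows False
proof -
  have "cl L (th L i, 0) = cl L (th L j, 0)"
    by (rule meet_unique[OF L N]) (use cl_in[OF L] i in auto)
  moreover have "\<bar>th L i - th L j\<bar> < pi"
    using th_mono[OF L] th_per[OF L, of i] i(3,4) by (smt (verit))
  ultimately have "th L i = th L j" using cl_inj[OF L] by blast
  then show False using th_mono[OF L, of i j] i(3) by simp
qed

text \<open>The lines through the two ends of a side contribute one side each. These are three
  different lines, and a triangle has no further sides.\<close>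

lemma tri_sides:
  assumes P: "tri P" and L: "L \<in> A" and s: "seg L (Suc k) \<in> sides A P"
    and M: "M \<in> A" "L \<noteq> M" "cl L (th L (Suc k), 0) \<in> M"
    and N: "N \<in> A" "L \<noteq> N" "cl L (th L (Suc (Suc k)), 0) \<in> N"
  obtains sM sN where "sides A P = {seg L (Suc k), sM, sN}" "sM \<subseteq> M" "sN \<subseteq> N" "M \<noteq> N"
proof -
  have P': "P \<in> polygons A" "card (sides A P) = 3" using P by (auto simp: tri_def)
  have MN: "M \<noteq> N" using vertices_distinct[OF L N(1,2), of "Suc k" "Suc (Suc k)"] M(3) N(3) m3 by auto
  obtain sM where sM: "sM \<in> sides A P" "sM \<subseteq> M"
    using end_line_side[OF L P'(1) s _ M] by auto
  obtain sN where sN: "sN \<in> sides A P" "sN \<subseteq> N"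
    using end_line_side[OF L P'(1) s _ N] by auto
  have sL: "seg L (Suc k) \<subseteq> L" by (rule seg_subset[OF L])
  have "seg L (Suc k) \<noteq> sM" using segment_one_line[OF seg_in_segments[OF L] L sL M(1)] sM(2) M(2) by metis
  moreover have "seg L (Suc k) \<noteq> sN" using segment_one_line[OF seg_in_segments[OF L] L sL N(1)] sN(2) N(2) by metis
  moreover have "sM \<noteq> sN" using segment_one_line[OF sides_segments[OF sM(1)] M(1) sM(2) N(1)] sN(2) MN by metis
  ultimately have "card {seg L (Suc k), sM, sN} = 3" by simp
  moreover have "{seg L (Suc k), sM, sN} \<subseteq> sides A P" using s sM sN by auto
  moreover have "finite (sides A P)" using P'(2) by (metis card.infinite zero_neq_numeral)
  ultimately have "sides A P = {seg L (Suc k), sM, sN}" using P'(2) by (metis card_subset_eq)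
  then show thesis using that sM(2) sN(2) MN by blast
qed

lemma tri_unique_side:
  assumes P: "tri P" and L: "L \<in> A" and s: "s \<in> sides A P" "s \<subseteq> L" "s' \<in> sides A P" "s' \<subseteq> L"
  shows "s = s'"
proof -
  obtain k where k: "s = seg L (Suc k)" by (rule segment_on_line[OF sides_segments[OF s(1)] L s(2)])
  obtain M where M: "M \<in> A" "L \<noteq> M" "cl L (th L (Suc k), 0) \<in> M" by (rule vertex_line[OF L])
  obtain N where N: "N \<in> A" "L \<noteq> N" "cl L (th L (Suc (Suc k)), 0) \<in> N" by (rule vertex_line[OF L])
  obtain sM sN where S: "sides A P = {seg L (Suc k), sM, sN}" "sM \<subseteq> M" "sN \<subseteq> N"
    by (rule tri_sides[OF P L s(1)[unfolded k] M N])
  have "s' \<noteq> sM" using segment_one_line[OF sides_segments[OF s(3)] L s(4) M(1)] S(2) M(2) by metis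
  moreover have "s' \<noteq> sN" using segment_one_line[OF sides_segments[OF s(3)] L s(4) N(1)] S(3) N(2) by metis
  ultimately show ?thesis using s(3) S(1) k by auto
qed

text \<open>The line through the far end of the side on \<open>M\<close> carries a side as well. It
  is neither \<open>M\<close> nor \<open>L\<close>, so it must be \<open>N\<close>.\<close>

lemma tri_third_vertex:
  assumes P: "tri P" and L: "L \<in> A" and s: "seg L (Suc k) \<in> sides A P"
    and M: "M \<in> A" "L \<noteq> M" "cl L (th L (Suc k), 0) \<in> M"
    and N: "N \<in> A" "L \<noteq> N" "cl L (th L (Suc (Suc k)), 0) \<in> N"
    and i: "seg M i \<in> sides A P" "1 \<le> i" and v: "v = i \<or> v = Suc i" and w: "cl M (th M v, 0) \<notin> L"
  shows "cl M (th M v, 0) \<in> N"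
proof -
  obtain sM sN where S: "sides A P = {seg L (Suc k), sM, sN}" "sM \<subseteq> M" "sN \<subseteq> N"
    by (rule tri_sides[OF P L s M N])
  obtain K where K: "K \<in> A" "M \<noteq> K" "cl M (th M v, 0) \<in> K" by (rule vertex_line[OF M(1)])
  obtain t where t: "t \<in> sides A P" "t \<subseteq> K"
    using end_line_side[OF M(1) _ i K v] P by (auto simp: tri_def)
  have "K \<noteq> L" using w K by auto
  have tt: "t \<in> segments A" using sides_segments[OF t(1)] .
  have "t = seg L (Suc k) \<or> t = sM \<or> t = sN" using t(1) S(1) by auto
  then have "K = L \<or> K = M \<or> K = N"
    using segment_one_line[OF tt K(1) t(2)] L M(1) N(1) S(2,3) seg_subset[OF L, of "Suc k"] by auto
  then show ?thesis using K \<open>K \<noteq> L\<close> by auto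
qed

text \<open>Triangles on both sides of one segment would use both segments of \<open>M\<close> at
  its end, and both far ends would lie on \<open>N\<close>. These are the vertices \<open>j\<close>
  and \<open>j + 2\<close> of \<open>M\<close>; they differ because \<open>3 \<le> m\<close>, that
  is \<open>4 \<le> n\<close>, whereas \<open>M\<close> and \<open>N\<close> meet only once.\<close>

lemma tri_share_side:
  assumes P: "tri P" and Q: "tri Q" and s: "s \<in> sides A P" "s \<in> sides A Q"
  shows "P = Q"
proof -
  obtain L k where L: "L \<in> A" and k: "s = seg L (Suc k)"
    by (rule segments_cases[OF sides_segments[OF s(1)]])
  have P': "P \<in> polygons A" and Q': "Q \<in> polygons A" using P Q by (auto simp: tri_def)
  obtain e where e: "e = 1 \<or> e = -1" "P = pol L (Suc k) e" by (rule side_pol_cases[OF L P' s(1)[unfolded k]])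
  obtain e' where e': "e' = 1 \<or> e' = -1" "Q = pol L (Suc k) e'" by (rule side_pol_cases[OF L Q' s(2)[unfolded k]])
  obtain M where M: "M \<in> A" "L \<noteq> M" "cl L (th L (Suc k), 0) \<in> M" by (rule vertex_line[OF L])
  obtain N where N: "N \<in> A" "L \<noteq> N" "cl L (th L (Suc (Suc k)), 0) \<in> N" by (rule vertex_line[OF L])
  obtain j c where j: "1 \<le> j" and pt: "cl L (th L (Suc k), 0) = cl M (th M (Suc j), 0)"
    and c: "turns L k M j c"
    by (rule corner_ex[OF L M])
  have MN: "M \<noteq> N" using vertices_distinct[OF L N(1,2), of "Suc k" "Suc (Suc k)"] M(3) N(3) m3 by auto
  have pL: "cl M (th M (Suc j), 0) \<in> L" using pt cl_in[OF L] by metis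
  have nL: "cl M (th M j, 0) \<notin> L" "cl M (th M (Suc (Suc j)), 0) \<notin> L"
    using vertices_distinct[OF M(1) L M(2)[symmetric], of j "Suc j"]
      vertices_distinct[OF M(1) L M(2)[symmetric], of "Suc j" "Suc (Suc j)"] pL m3 by auto
  have third: "cl M (th M (if c f = j then j else Suc (Suc j)), 0) \<in> N"
    if f: "f = 1 \<or> f = -1" and R: "tri R" "R = pol L (Suc k) f" for f R
  proof -
    have "seg L (Suc k) \<in> sides A R" unfolding R(2) by (rule seg_side_pol[OF L f])
    moreover have "seg M (c f) \<in> sides A R" using turnsD(4)[OF c f] R(2) by simp
    ultimately show ?thesis
      using tri_third_vertex[OF R(1) L _ M N, of "c f"] turnsD(2)[OF c f] j nL by auto
  qed
  have "e = e'"
  proof (rule ccontr)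
    assume "e \<noteq> e'"
    then have "c e \<noteq> c e'" using turns_neq[OF c e(1) e'(1)] by simp
    then have "cl M (th M j, 0) \<in> N \<and> cl M (th M (Suc (Suc j)), 0) \<in> N"
      using third[OF e(1) P e(2)] third[OF e'(1) Q e'(2)] turnsD(2)[OF c e(1)] turnsD(2)[OF c e'(1)] by (auto split: if_splits)
    then show False using vertices_distinct[OF M(1) N(1) MN, of j "Suc (Suc j)"] m3 by auto
  qed
  then show ?thesis using e e' by simp
qed

text \<open>Both triangles would have the branch of \<open>M\<close> between them as a side, so they
  would coincide and have two sides on \<open>L\<close>.\<close>

lemma tri_alternate:
  assumes L: "L \<in> A" and e: "e = 1 \<or> e = -1"
  shows "\<not> (tri (pol L k e) \<and> tri (pol L (Suc k) e))"
proof
  assume T: "tri (pol L k e) \<and> tri (pol L (Suc k) e)"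
  obtain M where M: "M \<in> A" "L \<noteq> M" "cl L (th L (Suc k), 0) \<in> M" by (rule vertex_line[OF L])
  obtain j c where c: "turns L k M j c" by (rule corner_ex[OF L M])
  have "pol L k e = pol L (Suc k) e" using tri_share_side[OF _ _ turnsD(3)[OF c e] turnsD(4)[OF c e]] T by simp
  then have "seg L k \<in> sides A (pol L k e)" "seg L (Suc k) \<in> sides A (pol L k e)"
    using seg_side_pol[OF L e] by metis+
  then have "seg L k = seg L (Suc k)" using tri_unique_side[of "pol L k e" L] T L seg_subset[OF L] by auto
  then show False using seg_neq_Suc[OF L] by blast
qed

section \<open>Segments on triangles: parity, propagation and counting\<close>

definition used :: "rp2 set set" where
  "used = {s. \<exists>P. tri P \<and> s \<in> sides A P}"

lemma used_iff: "L \<in> A \<Longrightarrow> seg L k \<in> used \<longleftrightarrow> tri (pol L k 1) \<or> tri (pol L k (-1))"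
proof
  assume L: "L \<in> A" and "seg L k \<in> used"
  then obtain P where P: "tri P" "seg L k \<in> sides A P" by (auto simp: used_def)
  then have "P \<in> polygons A" by (simp add: tri_def)
  from side_pol_cases[OF L this P(2)] obtain e where "e = 1 \<or> e = -1" "P = pol L k e" by metis
  then show "tri (pol L k 1) \<or> tri (pol L k (-1))" using P(1) by auto
qed (use seg_side_pol in \<open>auto simp: used_def\<close>)

text \<open>Along a line all of whose segments are used, the triangles alternate between the two sides;
  since a pseudo-line is one-sided, this forces the number of its segments to be odd.\<close>

lemma odd_unused:
  assumes L: "L \<in> A" and "odd n"
  shows "\<exists>k<m. seg L k \<notin> used"
proof (rule ccontr)
  assume "\<not> (\<exists>k<m. seg L k \<notin> used)"
  then have u: "seg L k \<in> used" if "k < m" for k using that by auto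
  have m: "even m" using assms(2) n4 by (simp add: m_def)
  obtain e where e: "e = 1 \<or> e = -1" "tri (pol L 0 e)" using used_iff[OF L, of 0] u[of 0] m3 by auto
  have alt: "tri (pol L k (e * (-1) ^ k))" if "k < m" for k
    using that
  proof (induction k)
    case (Suc k)
    let ?e = "e * (-1) ^ k"
    have e': "?e = 1 \<or> ?e = -1" using e(1) by (cases "even k") auto
    have "tri (pol L k ?e)" using Suc by simp
    then have "\<not> tri (pol L (Suc k) ?e)" using tri_alternate[OF L e'] by blast
    then have "tri (pol L (Suc k) (- ?e))" using used_iff[OF L, of "Suc k"] u[of "Suc k"] Suc(2) e' by auto
    then show ?case by simp
  qed (use e in simp)
  obtain i where i: "m = Suc i" using m3 by (cases m) auto
  then have "odd i" using m by simp
  then have "tri (pol L i (- e))" using alt[of i] i by simp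
  then have "\<not> tri (pol L (Suc i) (- e))" using tri_alternate[OF L, of "- e" i] e(1) by auto
  then have "\<not> tri (pol L 0 e)" using pol_per[OF L, of "- e" 0] e(1) i by auto
  then show False using e(2) by simp
qed

text \<open>If both segments of \<open>M\<close> at the vertex are used, their triangles lie on
  opposite sides of \<open>M\<close> by \<open>tri_alternate\<close>. Each then takes a different
  branch of \<open>L\<close> at this vertex, so both branches of \<open>L\<close> are used.\<close>

lemma unused_neighbour:
  assumes L: "L \<in> A" and s: "seg L i \<notin> used" "1 \<le> i" and v: "v = i \<or> v = Suc i"
    and M: "M \<in> A" "L \<noteq> M" "cl L (th L v, 0) \<in> M"
  shows "\<exists>s\<in>segments A. s \<subseteq> M \<and> s \<notin> used"
proof (rule ccontr)
  assume no: "\<not> (\<exists>s\<in>segments A. s \<subseteq> M \<and> s \<notin> used)"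
  have "cl L (th L v, 0) \<in> L" using cl_in[OF L] by simp
  then obtain j where j: "cl L (th L v, 0) = cl M (th M (Suc j), 0)"
    using vertex_index[OF M(1) L M(2)[symmetric] M(3)] by auto
  obtain k where k: "v = Suc k" using v s(2) by (cases v) auto
  have pL: "cl M (th M (Suc j), 0) \<in> L" using j cl_in[OF L] by metis
  obtain l c where l: "1 \<le> l" "cl M (th M (Suc j), 0) = cl L (th L (Suc l), 0)" and c: "turns M j L l c"
    by (rule corner_ex[OF M(1) L M(2)[symmetric] pL])
  have "seg M j \<in> used" "seg M (Suc j) \<in> used"
    using no seg_in_segments[OF M(1)] seg_subset[OF M(1)] by auto
  then obtain e e' where e: "e = 1 \<or> e = -1" "tri (pol M j e)" and e': "e' = 1 \<or> e' = -1" "tri (pol M (Suc j) e')"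
    using used_iff[OF M(1)] by blast
  have "e \<noteq> e'" using tri_alternate[OF M(1) e(1), of j] e e' by auto
  then have "c e \<noteq> c e'" using turns_neq[OF c e(1) e'(1)] by simp
  then have "{c e, c e'} = {l, Suc l}" using turnsD(2)[OF c e(1)] turnsD(2)[OF c e'(1)] by auto
  moreover have "seg L (c e) \<in> used" "seg L (c e') \<in> used"
    using turnsD(3)[OF c e(1)] turnsD(4)[OF c e'(1)] e(2) e'(2) unfolding used_def by blast+
  ultimately have both: "seg L l \<in> used" "seg L (Suc l) \<in> used" by (auto simp: doubleton_eq_iff)
  \<comment> \<open>A vertex determines its index on \<open>L\<close> only up to multiples of
    \<open>m\<close>; what remains is to match the two numberings.\<close>
  have "cl L (th L (Suc k), 0) = cl L (th L (Suc l), 0)" using j l k by simp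
  then obtain z :: int where z: "th L (Suc l) = th L (Suc k) + of_int z * pi" using cl_eq[OF L] by blast
  have per: "th L (a + b * m) = th L a + real b * pi" for a b
  proof (induction b)
    case (Suc b)
    have "th L (a + Suc b * m) = th L ((a + b * m) + m)" by (simp add: algebra_simps)
    then show ?case using th_per[OF L, of "a + b * m"] Suc by (simp add: algebra_simps)
  qed simp
  have segper: "seg L (a + b * m) = seg L a" for a b
  proof (induction b)
    case (Suc b)
    have "seg L (a + Suc b * m) = seg L ((a + b * m) + m)" by (simp add: algebra_simps)
    then show ?case using seg_per[OF L, of "a + b * m"] Suc by simp
  qed simp
  have "seg L i = seg L l \<or> seg L i = seg L (Suc l)"
  proof (cases "z \<ge> 0")
    case True
    then have "th L (Suc l) = th L (Suc k + nat z * m)" using z per[of "Suc k" "nat z"] by simp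
    then have "Suc l = Suc k + nat z * m" using th_mono[OF L] by (metis linorder_neqE_nat less_irrefl)
    then have "l = k + nat z * m" "Suc l = Suc k + nat z * m" by auto
    then have "seg L l = seg L k" "seg L (Suc l) = seg L (Suc k)" using segper by metis+
    then show ?thesis using v k by auto
  next
    case False
    then have "th L (Suc k) = th L (Suc l + nat (- z) * m)" using z per[of "Suc l" "nat (- z)"] by simp
    then have "Suc k = Suc l + nat (- z) * m" using th_mono[OF L] by (metis linorder_neqE_nat less_irrefl)
    then have "k = l + nat (- z) * m" "Suc k = Suc l + nat (- z) * m" by auto
    then have "seg L k = seg L l" "seg L (Suc k) = seg L (Suc l)" using segper by metis+
    then show ?thesis using v k by auto
  qed
  then show False using both s(1) by auto
qed

lemma finite_segments: "finite (segments A)"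
  unfolding segments_eq using finA by auto

lemma card_all_segments: "card (segments A) = n * m"
proof -
  have "card (segments A) = (\<Sum>L\<in>A. card (seg L ` {..<m}))"
    unfolding segments_eq
  proof (rule card_UN_disjoint)
    show "\<forall>L\<in>A. \<forall>M\<in>A. L \<noteq> M \<longrightarrow> seg L ` {..<m} \<inter> seg M ` {..<m} = {}"
    proof (intro ballI impI)
      fix L M assume *: "L \<in> A" "M \<in> A" "L \<noteq> M"
      have "seg L j \<noteq> seg M k" for j k
        using segment_one_line[OF seg_in_segments[OF *(1)] *(1) seg_subset[OF *(1)] *(2), of j] seg_subset[OF *(2), of k] *(3) by auto
      then show "seg L ` {..<m} \<inter> seg M ` {..<m} = {}" by auto
    qed
  qed (use finA in auto)
  then show ?thesis using card_segments cardA by simp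
qed

lemma used_subset: "used \<subseteq> segments A"
  using sides_segments by (auto simp: used_def)

lemma finite_tri: "finite {P. tri P}"
proof -
  have inj: "inj_on (sides A) {P. tri P}"
  proof (rule inj_onI)
    fix P Q assume *: "P \<in> {P. tri P}" "Q \<in> {P. tri P}" "sides A P = sides A Q"
    then have "sides A P \<noteq> {}" by (auto simp: tri_def)
    then show "P = Q" using tri_share_side * by blast
  qed
  have "sides A ` {P. tri P} \<subseteq> Pow (segments A)" using sides_segments by auto
  then have "finite (sides A ` {P. tri P})" using finite_segments finite_subset by blast
  then show ?thesis using inj finite_imageD by blast
qed

lemma p3_eq_card_tri: "p3 A = card {P. tri P}"
  by (simp add: p3_def tri_def)

text \<open>Triangles share no sides, so their side sets partition the used segments into
  triples.\<close>

lemma card_used: "card used = 3 * p3 A"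
proof -
  let ?T = "{P. tri P}"
  have "used = (\<Union>P\<in>?T. sides A P)" by (auto simp: used_def)
  also have "card \<dots> = (\<Sum>P\<in>?T. card (sides A P))"
  proof (rule card_UN_disjoint[OF finite_tri])
    show "\<forall>P\<in>?T. finite (sides A P)" using finite_segments sides_segments
      by (metis finite_subset subsetI)
    show "\<forall>P\<in>?T. \<forall>Q\<in>?T. P \<noteq> Q \<longrightarrow> sides A P \<inter> sides A Q = {}" using tri_share_side by blast
  qed
  also have "\<dots> = (\<Sum>P\<in>?T. 3)" by (rule sum.cong) (auto simp: tri_def)
  finally show ?thesis by (simp add: p3_eq_card_tri)
qed

lemma p3_le: "3 * p3 A \<le> n * (n - 1)"
  using card_mono[OF finite_segments used_subset] card_used card_all_segments by (simp add: m_def)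

text \<open>Each of the \<open>n\<close> lines loses one of its \<open>n - 1\<close>
  segments.\<close>

lemma p3_le_odd:
  assumes "odd n" shows "3 * p3 A \<le> n * (n - 2)"
proof -
  obtain u where u: "\<And>L. L \<in> A \<Longrightarrow> u L < m \<and> seg L (u L) \<notin> used" using odd_unused assms by metis
  have "used \<subseteq> (\<Union>L\<in>A. seg L ` {..<m} - {seg L (u L)})"
  proof
    fix s assume s: "s \<in> used"
    then obtain L where "L \<in> A" "s \<in> seg L ` {..<m}" using used_subset unfolding segments_eq by blast
    then show "s \<in> (\<Union>L\<in>A. seg L ` {..<m} - {seg L (u L)})" using u[of L] s by auto
  qed
  then have "card used \<le> card (\<Union>L\<in>A. seg L ` {..<m} - {seg L (u L)})"
    using finA by (intro card_mono) auto
  also have "\<dots> \<le> (\<Sum>L\<in>A. card (seg L ` {..<m} - {seg L (u L)}))" by (rule card_UN_le[OF finA])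
  also have "\<dots> = (\<Sum>L\<in>A. m - 1)"
    by (rule sum.cong) (use u card_segments in \<open>auto simp: card_Diff_singleton\<close>)
  finally show ?thesis using card_used cardA by (simp add: m_def numeral_2_eq_2)
qed

lemma p3_gap:
  assumes "3 * p3 A < n * (n - 1)" shows "3 * p3 A + 3 \<le> n * (n - 1)"
proof -
  have "used \<noteq> segments A" using assms card_used card_all_segments by (auto simp: m_def)
  then obtain s where s: "s \<in> segments A" "s \<notin> used" using used_subset by blast
  obtain L k where L: "L \<in> A" and k: "s = seg L (Suc k)" by (rule segments_cases[OF s(1)])
  obtain M where M: "M \<in> A" "L \<noteq> M" "cl L (th L (Suc k), 0) \<in> M" by (rule vertex_line[OF L])
  obtain N where N: "N \<in> A" "L \<noteq> N" "cl L (th L (Suc (Suc k)), 0) \<in> N" by (rule vertex_line[OF L])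
  have MN: "M \<noteq> N" using vertices_distinct[OF L N(1,2), of "Suc k" "Suc (Suc k)"] M(3) N(3) m3 by auto
  obtain sM where sM: "sM \<in> segments A" "sM \<subseteq> M" "sM \<notin> used"
    using unused_neighbour[OF L s(2)[unfolded k] _ _ M] by auto
  obtain sN where sN: "sN \<in> segments A" "sN \<subseteq> N" "sN \<notin> used"
    using unused_neighbour[OF L s(2)[unfolded k] _ _ N] by auto
  have sL: "s \<subseteq> L" using seg_subset[OF L] k by simp
  have "s \<noteq> sM" using segment_one_line[OF s(1) L sL M(1)] sM(2) M(2) by metis
  moreover have "s \<noteq> sN" using segment_one_line[OF s(1) L sL N(1)] sN(2) N(2) by metis
  moreover have "sM \<noteq> sN" using segment_one_line[OF sM(1) M(1) sM(2) N(1)] sN(2) MN by metis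
  ultimately have "card {s, sM, sN} = 3" by simp
  moreover have "card {s, sM, sN} \<le> card (segments A - used)"
    using s sM sN finite_segments by (intro card_mono) auto
  ultimately have "3 \<le> card (segments A) - card used"
    using card_Diff_subset[OF finite_subset[OF used_subset finite_segments] used_subset] by simp
  then show ?thesis using card_used card_all_segments by (simp add: m_def)
qed

lemma upper_bound: "real (p3 A) \<le> triangle_bound n"
proof -
  define t where "t = n div 6"
  have nt: "n = 6 * t + n mod 6" by (simp add: t_def)
  have "n mod 6 < 6" by simp
  then consider "n mod 6 = 0" | "n mod 6 = 1" | "n mod 6 = 2" | "n mod 6 = 3" | "n mod 6 = 4" | "n mod 6 = 5"
    by linarith
  then show ?thesis
  proof cases
    case 2
    then have n: "n = 6 * t + 1" using nt by simp
    then have "1 \<le> t" using n4 by simp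
    then obtain r where r: "t = Suc r" by (cases t) auto
    have "3 * p3 A \<le> n * (n - 2)" using p3_le_odd n by simp
    \<comment> \<open>The remainder 2 modulo 3 cannot be covered by \<open>3 * p3 A\<close>, so two
      more segments are lost. With \<open>t = Suc r\<close> the formula avoids subtraction.\<close>
    also have "n * (n - 2) = 3 * (12 * r * r + 24 * r + 11) + 2" unfolding n r by (simp add: algebra_simps)
    finally have "p3 A \<le> 12 * r * r + 24 * r + 11" by simp
    then have "3 * p3 A + 2 \<le> n * (n - 2)" unfolding n r by (simp add: algebra_simps)
    then have "3 * real (p3 A) + 2 \<le> real n * (real n - 2)" using triple_bound_real[of "p3 A" 2 n 2] n4 by simp
    then show ?thesis using 2 by (simp add: triangle_bound_def)
  next
    case 3
    then have n: "n = 6 * t + 2" using nt by simp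
    have nn: "n * (n - 1) = 3 * (12 * t * t + 6 * t) + 2" unfolding n by (simp add: algebra_simps)
    have "3 * p3 A \<noteq> n * (n - 1)" unfolding nn by presburger
    then have "3 * p3 A + 3 \<le> n * (n - 1)" using p3_le p3_gap by simp
    then have "p3 A + 1 \<le> 12 * t * t + 6 * t" unfolding nn by simp
    then have "3 * p3 A + 5 \<le> n * (n - 1)" unfolding nn by simp
    then have "3 * real (p3 A) + 5 \<le> real n * (real n - 1)" using triple_bound_real[of "p3 A" 5 n 1] n4 by simp
    then show ?thesis using 3 by (simp add: triangle_bound_def)
  next
    case 4
    then have "odd n" using nt by presburger
    then have "3 * real (p3 A) \<le> real n * (real n - 2)" using triple_bound_real[of "p3 A" 0 n 2] n4 p3_le_odd by simp
    then show ?thesis using 4 by (simp add: triangle_bound_def)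
  next
    case 6
    then have "odd n" using nt by presburger
    then have "3 * real (p3 A) \<le> real n * (real n - 2)" using triple_bound_real[of "p3 A" 0 n 2] n4 p3_le_odd by simp
    then show ?thesis using 6 by (simp add: triangle_bound_def)
  next
    case 1
    have "3 * real (p3 A) \<le> real n * (real n - 1)" using triple_bound_real[of "p3 A" 0 n 1] n4 p3_le by simp
    then show ?thesis using 1 by (simp add: triangle_bound_def)
  next
    case 5
    have "3 * real (p3 A) \<le> real n * (real n - 1)" using triple_bound_real[of "p3 A" 0 n 1] n4 p3_le by simp
    then show ?thesis using 5 by (simp add: triangle_bound_def)
  qed
qed

end

section \<open>Recognizing triangles\<close>

context arrangement
begin

lemma line_connected: "L \<in> A \<Longrightarrow> connected L"
proof -
  assume L: "L \<in> A"
  have "L = (\<lambda>x. cl L (x, 0)) ` UNIV" using cl_ex[OF L] cl_in[OF L] by auto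
  moreover have "continuous_on UNIV (\<lambda>x. cl L (x, 0))"
    by (rule continuous_on_compose2[OF cl_cont[OF L, of UNIV]]) (auto intro!: continuous_intros)
  ultimately show ?thesis by (metis connected_continuous_image connected_UNIV)
qed

lemma seg_end_closure:
  assumes L: "L \<in> A" and v: "v = k \<or> v = Suc k"
  shows "cl L (th L v, 0) \<in> closure (seg L k)"
proof (rule closureI_meets)
  fix U assume U: "open U" "cl L (th L v, 0) \<in> U"
  obtain d where d: "d > 0" "\<And>y s. \<bar>y - th L v\<bar> < d \<Longrightarrow> \<bar>s - 0\<bar> < d \<Longrightarrow> cl L (y, s) \<in> U"
    using box_ex[OF L U] by blast
  have lt: "th L k < th L (Suc k)" using th_mono[OF L] by simp
  define e where "e = min d (th L (Suc k) - th L k) / 2"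
  have e: "0 < e" "e < d" "e < th L (Suc k) - th L k" unfolding e_def using d(1) lt by auto
  define y where "y = (if v = k then th L k + e else th L (Suc k) - e)"
  have "\<bar>y - th L v\<bar> < d" unfolding y_def using v e by auto
  then have "cl L (y, 0) \<in> U" using d by auto
  moreover have "cl L (y, 0) \<in> seg L k" unfolding seg_def y_def using e by (intro imageI) auto
  ultimately show "U \<inter> seg L k \<noteq> {}" by blast
qed

lemma segment_component:
  assumes L: "L \<in> A" and s: "s \<in> segments A" "s \<subseteq> L" shows "s \<in> components (L - vertices A)"
proof -
  obtain k where k: "s = seg L (Suc k)" by (rule segment_on_line[OF s(1) L s(2)])
  have "seg L (Suc k) \<in> segments A" by (rule seg_in_segments[OF L])
  then obtain L' where L': "L' \<in> A" "s \<in> components (L' - vertices A)" unfolding segments_def k by blast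
  then have "s \<subseteq> L'" using in_components_subset by blast
  then have "L = L'" using segment_one_line[OF s(1) L s(2) L'(1)] by simp
  then show ?thesis using L' by simp
qed

text \<open>\<open>R\<close> traps a polygon \<open>P\<close> beside the segment through
  \<open>p\<close>. Since each trace \<open>K L\<close> is connected, every line carries only one
  side, and hypothesis \<open>E\<close> prevents the first side from ending on a fourth line, so it
  ends on \<open>L2\<close> and \<open>L3\<close>. The list of lines in the conclusion serves to
  tell triangles of different triples apart.\<close>

lemma recognize_triangle:
  assumes L: "L1 \<in> A" "L2 \<in> A" "L3 \<in> A" "L1 \<noteq> L2" "L1 \<noteq> L3" "L2 \<noteq> L3"
    and R: "open R" "R \<inter> \<Union>A = {}" "closure R \<subseteq> R \<union> (L1 \<union> L2 \<union> L3)"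
    and K: "\<And>L. L \<in> {L1, L2, L3} \<Longrightarrow> connected (K L) \<and> K L \<subseteq> L - vertices A \<and>
        L \<inter> closure R \<subseteq> K L \<union> vertices A"
    and p: "p \<in> K L1" "p \<in> closure R"
    and E: "\<And>E S. E \<in> A - {L1, L2, L3} \<Longrightarrow> connected S \<Longrightarrow> K L1 \<subseteq> S \<Longrightarrow> S \<subseteq> L1 - vertices A \<Longrightarrow>
        closure S \<inter> E = {}"
  shows "\<exists>P. tri P \<and> (\<forall>L\<in>A. (\<exists>s\<in>sides A P. s \<subseteq> L) \<longleftrightarrow> L \<in> {L1, L2, L3})"
proof -
  have pL: "p \<in> L1 - vertices A" using K[of L1] p(1) by auto
  then obtain a where a: "a \<in> components (L1 - vertices A)" "p \<in> a"
    by (metis Union_components Union_iff)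
  then have aseg: "a \<in> segments A" "a \<subseteq> L1"
    unfolding segments_def using L(1) in_components_subset by blast+
  obtain k where k: "a = seg L1 (Suc k)" by (rule segment_on_line[OF aseg(1) L(1) aseg(2)])
  have Ka: "K L1 \<subseteq> a" using components_maximal[OF a(1)] K[of L1] p(1) a(2) by blast
  have ca: "connected a" using a(1) in_components_connected by blast
  have asub: "a \<subseteq> L1 - vertices A" using a(1) in_components_subset by blast
  have ends: "cl L1 (th L1 v, 0) \<notin> E" if "E \<in> A - {L1, L2, L3}" "v = Suc k \<or> v = Suc (Suc k)" for E v
    using E[OF that(1) ca Ka asub] seg_end_closure[OF L(1) that(2)] k by blast
  obtain x where x: "th L1 (Suc k) < x" "x < th L1 (Suc (Suc k))" "p = cl L1 (x, 0)"
    using a(2) unfolding k seg_def by auto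
  obtain d1 where d1: "d1 > 0" "\<And>y t. \<bar>y - x\<bar> < d1 \<Longrightarrow> 0 < t \<Longrightarrow> t < d1 \<Longrightarrow> cl L1 (y, 1 * t) \<in> pol L1 (Suc k) 1"
    using pol_near[OF L(1) _ x(1,2), of 1] by blast
  obtain d2 where d2: "d2 > 0" "\<And>y t. \<bar>y - x\<bar> < d2 \<Longrightarrow> 0 < t \<Longrightarrow> t < d2 \<Longrightarrow> cl L1 (y, (-1) * t) \<in> pol L1 (Suc k) (-1)"
    using pol_near[OF L(1) _ x(1,2), of "-1"] by blast
  define d where "d = min d1 d2"
  have d: "d > 0" "d \<le> d1" "d \<le> d2" unfolding d_def using d1 d2 by auto
  let ?B = "{x - d<..<x + d} \<times> {-d<..<d}"
  have "open (cl L1 ` ?B)" by (intro cl_open[OF L(1)] open_Times) auto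
  moreover have "p \<in> cl L1 ` ?B" unfolding x(3) using d by (intro imageI) auto
  ultimately have "cl L1 ` ?B \<inter> R \<noteq> {}" using in_closure_meets p(2) by blast
  then obtain y t where yt: "\<bar>y - x\<bar> < d" "\<bar>t\<bar> < d" "cl L1 (y, t) \<in> R" by force
  have "cl L1 (y, t) \<notin> L1" using yt(3) R(2) L(1) by blast
  then have "t \<noteq> 0" using cl_in[OF L(1)] by simp
  have "\<exists>e. (e = 1 \<or> e = -1) \<and> cl L1 (y, t) \<in> pol L1 (Suc k) e"
  proof (cases "t > 0")
    case True
    then show ?thesis using d1(2)[of y t] yt d by (intro exI[of _ 1]) auto
  next
    case False
    then show ?thesis using d2(2)[of y "-t"] yt d \<open>t \<noteq> 0\<close> by (intro exI[of _ "-1"]) auto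
  qed
  then obtain e where e: "e = 1 \<or> e = -1" "cl L1 (y, t) \<in> pol L1 (Suc k) e" by blast
  define P where "P = pol L1 (Suc k) e"
  have P: "P \<in> polygons A" unfolding P_def by (rule pol_polygon[OF L(1) e(1)])
  have Pdisj: "P \<inter> L = {}" if "L \<in> A" for L using polygon_disj[OF P that] .
  \<comment> \<open>The closure of \<open>R\<close> adds only points of the three lines, which the
    connected set \<open>P\<close> avoids.\<close>
  have "P \<subseteq> R \<or> P \<subseteq> - closure R"
  proof (rule connected_pick)
    show "connected P" using P in_components_connected unfolding polygons_def by blast
    show "P \<subseteq> R \<union> - closure R" using R(3) Pdisj[OF L(1)] Pdisj[OF L(2)] Pdisj[OF L(3)] by blast
    show "R \<inter> - closure R = {}" using closure_subset by blast
  qed (use R(1) in auto)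
  moreover have "\<not> P \<subseteq> - closure R" using e(2) yt(3) closure_subset unfolding P_def by blast
  ultimately have PR: "P \<subseteq> R" by blast
  have sideR: "s \<subseteq> closure R" if "s \<in> sides A P" for s
    using that closure_mono[OF PR] unfolding sides_def frontier_def by blast
  have sa: "seg L1 (Suc k) \<in> sides A P" unfolding P_def by (rule seg_side_pol[OF L(1) e(1)])
  obtain M where M: "M \<in> A" "L1 \<noteq> M" "cl L1 (th L1 (Suc k), 0) \<in> M" by (rule vertex_line[OF L(1)])
  obtain N where N: "N \<in> A" "L1 \<noteq> N" "cl L1 (th L1 (Suc (Suc k)), 0) \<in> N" by (rule vertex_line[OF L(1)])
  have MN: "M \<noteq> N" using vertices_distinct[OF L(1) N(1,2), of "Suc k" "Suc (Suc k)"] M(3) N(3) m3 by auto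
  have "M \<in> {L2, L3}" using ends[of M "Suc k"] M by auto
  moreover have "N \<in> {L2, L3}" using ends[of N "Suc (Suc k)"] N by auto
  ultimately have MNs: "{M, N} = {L2, L3}" and L23: "L2 = M \<or> L2 = N" "L3 = M \<or> L3 = N" using MN by auto
  obtain sM where sM: "sM \<in> sides A P" "sM \<subseteq> M" using end_line_side[OF L(1) P sa _ M] by auto
  obtain sN where sN: "sN \<in> sides A P" "sN \<subseteq> N" using end_line_side[OF L(1) P sa _ N] by auto
  \<comment> \<open>A side on \<open>L\<close> is contained in the trace \<open>K L\<close> and,
    being a component of the line without its vertices, also contains it.\<close>
  have uniq: "s = s'" if s: "s \<in> sides A P" "s' \<in> sides A P" "s \<subseteq> L" "s' \<subseteq> L" "L \<in> {L1, L2, L3}" for s s' L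
  proof -
    have LA: "L \<in> A" using s(5) L by auto
    have c: "s \<in> components (L - vertices A)" "s' \<in> components (L - vertices A)"
      using segment_component[OF LA] s sides_segments by auto
    have k: "connected (K L)" "K L \<subseteq> L - vertices A" "L \<inter> closure R \<subseteq> K L \<union> vertices A"
      using K[OF s(5)] by auto
    have inK: "t \<subseteq> K L" if "t \<in> components (L - vertices A)" "t \<subseteq> L" "t \<subseteq> closure R" for t
      using k(3) in_components_subset[OF that(1)] that(2,3) by auto
    have "s \<subseteq> K L" "s' \<subseteq> K L"
      using inK[OF c(1) s(3) sideR[OF s(1)]] inK[OF c(2) s(4) sideR[OF s(2)]] by auto
    moreover have "s \<inter> K L \<noteq> {}" using in_components_nonempty[OF c(1)] calculation(1) by auto
    then have "K L \<subseteq> s" by (rule components_maximal[OF c(1) k(1,2)])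
    ultimately have "s \<inter> s' \<noteq> {}" using in_components_nonempty[OF c(2)] by auto
    then show ?thesis using components_eq[OF c] by simp
  qed
  have on: "\<exists>L\<in>{L1, L2, L3}. s \<subseteq> L" if s: "s \<in> sides A P" for s
  proof -
    obtain E j where Ej: "E \<in> A" "s = seg E (Suc j)" by (rule segments_cases[OF sides_segments[OF s]])
    have "E \<in> {L1, L2, L3}"
    proof (rule ccontr)
      assume n: "E \<notin> {L1, L2, L3}"
      then have "s \<inter> L1 = {}" "s \<inter> L2 = {}" "s \<inter> L3 = {}"
        using seg_disj_line[OF Ej(1) L(1)] seg_disj_line[OF Ej(1) L(2)] seg_disj_line[OF Ej(1) L(3)] Ej(2) by auto
      moreover have "s \<inter> R = {}" using R(2) seg_subset[OF Ej(1)] Ej by blast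
      moreover have "s \<noteq> {}" using seg_nonempty[OF Ej(1)] Ej(2) by simp
      ultimately show False using sideR[OF s] R(3) by blast
    qed
    then show ?thesis using seg_subset[OF Ej(1)] Ej(2) by blast
  qed
  have sub: "sides A P \<subseteq> {seg L1 (Suc k), sM, sN}"
  proof
    fix s assume s: "s \<in> sides A P"
    obtain L where L': "L \<in> {L1, L2, L3}" "s \<subseteq> L" using on[OF s] by blast
    then have "L = L1 \<or> L = M \<or> L = N" using L23 by auto
    then show "s \<in> {seg L1 (Suc k), sM, sN}"
      using uniq[OF s sa L'(2) _ L'(1)] uniq[OF s sM(1) L'(2) _ L'(1)] uniq[OF s sN(1) L'(2) _ L'(1)]
        sM(2) sN(2) seg_subset[OF L(1)] by auto
  qed
  then have eqs: "sides A P = {seg L1 (Suc k), sM, sN}" using sa sM sN by auto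
  have sL1: "seg L1 (Suc k) \<subseteq> L1" by (rule seg_subset[OF L(1)])
  have "seg L1 (Suc k) \<noteq> sM" using segment_one_line[OF sides_segments[OF sa] L(1) sL1 M(1)] sM(2) M(2) by metis
  moreover have "seg L1 (Suc k) \<noteq> sN" using segment_one_line[OF sides_segments[OF sa] L(1) sL1 N(1)] sN(2) N(2) by metis
  moreover have "sM \<noteq> sN" using segment_one_line[OF sides_segments[OF sM(1)] M(1) sM(2) N(1)] sN(2) MN by metis
  ultimately have "card (sides A P) = 3" unfolding eqs by simp
  then have "tri P" using P by (simp add: tri_def)
  moreover have "(\<exists>s\<in>sides A P. s \<subseteq> L) \<longleftrightarrow> L \<in> {L1, L2, L3}" if LA: "L \<in> A" for L
  proof
    assume "\<exists>s\<in>sides A P. s \<subseteq> L"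
    then obtain s where s: "s \<in> sides A P" "s \<subseteq> L" by blast
    obtain L' where L': "L' \<in> {L1, L2, L3}" "s \<subseteq> L'" using on[OF s(1)] by blast
    then have "L' \<in> A" using L by auto
    then have "L = L'" using segment_one_line[OF sides_segments[OF s(1)] LA s(2) _ L'(2)] by simp
    then show "L \<in> {L1, L2, L3}" using L'(1) by simp
  next
    assume "L \<in> {L1, L2, L3}"
    then have "L = L1 \<or> L = M \<or> L = N" using L23 by auto
    then show "\<exists>s\<in>sides A P. s \<subseteq> L" using sa sL1 sM sN by auto
  qed
  ultimately show ?thesis by blast
qed

end

section \<open>Maps of the projective plane in homogeneous coordinates\<close>

definition vec3 :: "real \<Rightarrow> real \<Rightarrow> real \<Rightarrow> real^3" where
  "vec3 x y z = x *\<^sub>R axis 1 1 + y *\<^sub>R axis 2 1 + z *\<^sub>R axis 3 1"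

lemma vec3_nth [simp]: "vec3 x y z $ 1 = x" "vec3 x y z $ 2 = y" "vec3 x y z $ 3 = z"
  by (auto simp: vec3_def axis_def)

lemma vec3_eq_iff: "v = w \<longleftrightarrow> v$1 = w$1 \<and> v$2 = w$2 \<and> v$3 = (w::real^3)$3"
  by (simp add: vec_eq_iff forall_3)

lemma vec3_eq_0: "vec3 x y z = 0 \<longleftrightarrow> x = 0 \<and> y = 0 \<and> z = 0"
  by (simp add: vec3_eq_iff)

lemma continuous_on_vec3 [continuous_intros]:
  assumes "continuous_on S f" "continuous_on S g" "continuous_on S h"
  shows "continuous_on S (\<lambda>x. vec3 (f x) (g x) (h x))"
  unfolding vec3_def using assms by (intro continuous_intros)

text \<open>Homogeneous maps, linear or not, carry lines through the origin to such lines and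
  descend to the quotient. The bent shear in \<open>pseudo_line_wire\<close> is of this
  kind.\<close>

lemma homogeneous_homeomorphism:
  fixes T S :: "real^3 \<Rightarrow> real^3"
  assumes cT: "continuous_on UNIV T" and cS: "continuous_on UNIV S"
    and hT: "\<And>c v. T (c *\<^sub>R v) = c *\<^sub>R T v" and hS: "\<And>c v. S (c *\<^sub>R v) = c *\<^sub>R S v"
    and ST: "\<And>v. S (T v) = v" and TS: "\<And>v. T (S v) = v"
  shows "\<exists>f g. homeomorphism UNIV UNIV f g \<and> (\<forall>v. v \<noteq> 0 \<longrightarrow> f (proj_pt v) = proj_pt (T v))"
proof -
  have nz: "T v \<noteq> 0" "S v \<noteq> 0" if "v \<noteq> 0" for v
    using that ST TS hT[of 0 0] hS[of 0 0] by (metis scaleR_zero_left)+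
  define ind where "ind (Q :: real^3 \<Rightarrow> real^3) p = proj_pt (Q (SOME v. v \<noteq> 0 \<and> p = proj_pt v))" for Q p
  have ind: "ind Q (proj_pt v) = proj_pt (Q v)"
    if v: "v \<noteq> 0" and h: "\<And>c v. Q (c *\<^sub>R v) = c *\<^sub>R Q v" and z: "\<And>v. v \<noteq> 0 \<Longrightarrow> Q v \<noteq> 0" for Q v
  proof -
    define w where "w = (SOME w. w \<noteq> 0 \<and> proj_pt v = proj_pt w)"
    have "\<exists>w. w \<noteq> 0 \<and> proj_pt v = proj_pt w" using v by blast
    then have w: "w \<noteq> 0" "proj_pt v = proj_pt w" unfolding w_def by (metis (mono_tags, lifting) someI_ex)+
    then obtain c where "c \<noteq> 0" "w = c *\<^sub>R v" using proj_pt_eq_iff v by blast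
    then have "proj_pt (Q w) = proj_pt (Q v)" using h proj_pt_scale z v by metis
    then show ?thesis unfolding ind_def w_def by simp
  qed
  have cont: "continuous_on UNIV (ind Q)"
    if c: "continuous_on UNIV Q" and h: "\<And>c v. Q (c *\<^sub>R v) = c *\<^sub>R Q v" and z: "\<And>v. v \<noteq> 0 \<Longrightarrow> Q v \<noteq> 0" for Q
  proof -
    have "open (ind Q -` U)" if U: "open U" for U
    proof -
      have eq: "{v. v \<noteq> 0 \<and> proj_pt v \<in> ind Q -` U} = - {0} \<inter> Q -` {v. v \<noteq> 0 \<and> proj_pt v \<in> U}"
      proof (intro set_eqI)
        fix v
        show "v \<in> {v. v \<noteq> 0 \<and> proj_pt v \<in> ind Q -` U} \<longleftrightarrow>
            v \<in> - {0} \<inter> Q -` {v. v \<noteq> 0 \<and> proj_pt v \<in> U}"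
        proof (cases "v = 0")
          case False
          then show ?thesis using ind[OF False h z] z[OF False] by simp
        qed simp
      qed
      have "\<forall>B. open B \<longrightarrow> open (Q -` B)" using c by (simp add: continuous_on_open_vimage)
      then have op: "open (Q -` {v. v \<noteq> 0 \<and> proj_pt v \<in> U})" using U unfolding open_rp2_def by blast
      have "open (- {0 :: real^3})" by (intro open_Compl closed_singleton)
      then have "open (- {0} \<inter> Q -` {v. v \<noteq> 0 \<and> proj_pt v \<in> U})" using op by (rule open_Int)
      then show ?thesis unfolding open_rp2_def eq .
    qed
    then show ?thesis by (simp add: continuous_on_open_vimage)
  qed
  have inv: "ind S (ind T p) = p" "ind T (ind S p) = p" for p
  proof -
    obtain v where v: "v \<noteq> 0" "p = proj_pt v" using proj_pt_surj by blast
    show "ind S (ind T p) = p" "ind T (ind S p) = p"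
      unfolding v(2) using ind[OF v(1) hT nz(1)] ind[OF v(1) hS nz(2)] ind[OF nz(1)[OF v(1)] hS nz(2)] ind[OF nz(2)[OF v(1)] hT nz(1)] ST TS by auto
  qed
  have "homeomorphism UNIV UNIV (ind T) (ind S)"
    by (rule homeomorphismI) (use cont[OF cT hT nz(1)] cont[OF cS hS nz(2)] inv in auto)
  then show ?thesis using ind[OF _ hT nz(1)] by blast
qed

section \<open>Arrangements of wires\<close>

definition hom_rep :: "rp2 \<Rightarrow> real^3" where
  "hom_rep p = (SOME v. v \<noteq> 0 \<and> p = proj_pt v)"

lemma hom_rep: "hom_rep p \<noteq> 0" "proj_pt (hom_rep p) = p"
proof -
  have "\<exists>v. v \<noteq> 0 \<and> p = proj_pt v" by (metis proj_pt_surj)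
  from someI_ex[OF this] show "hom_rep p \<noteq> 0" "proj_pt (hom_rep p) = p" unfolding hom_rep_def by auto
qed

lemma hom_rep_proj: "v \<noteq> 0 \<Longrightarrow> \<exists>c. c \<noteq> 0 \<and> hom_rep (proj_pt v) = c *\<^sub>R v"
  using hom_rep[of "proj_pt v"] proj_pt_eq_iff[of v "hom_rep (proj_pt v)"] by simp

text \<open>Coordinates of the chart in which the third homogeneous coordinate is nonzero. Division
  by 0 gives 0 at infinity, so statements are restricted to \<open>aff_part\<close>.\<close>

definition aff_x :: "rp2 \<Rightarrow> real" where "aff_x p = hom_rep p $ 1 / hom_rep p $ 3"
definition aff_y :: "rp2 \<Rightarrow> real" where "aff_y p = hom_rep p $ 2 / hom_rep p $ 3"
definition aff_part :: "rp2 set" where "aff_part = {p. hom_rep p $ 3 \<noteq> 0}"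

lemma aff_proj:
  assumes "v \<noteq> 0"
  shows "aff_x (proj_pt v) = v$1 / v$3" "aff_y (proj_pt v) = v$2 / v$3" "proj_pt v \<in> aff_part \<longleftrightarrow> v$3 \<noteq> 0"
proof -
  obtain c where "c \<noteq> 0" "hom_rep (proj_pt v) = c *\<^sub>R v" using hom_rep_proj[OF assms] by auto
  then show "aff_x (proj_pt v) = v$1 / v$3" "aff_y (proj_pt v) = v$2 / v$3" "proj_pt v \<in> aff_part \<longleftrightarrow> v$3 \<noteq> 0"
    by (auto simp: aff_x_def aff_y_def aff_part_def)
qed

lemma aff_vec3: "p \<in> aff_part \<Longrightarrow> p = proj_pt (vec3 (aff_x p) (aff_y p) 1)"
proof -
  assume p: "p \<in> aff_part"
  define v where "v = hom_rep p"
  have v: "v \<noteq> 0" "p = proj_pt v" "v$3 \<noteq> 0" using hom_rep[of p] p unfolding v_def aff_part_def by auto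
  have "vec3 (v$1/v$3) (v$2/v$3) 1 = (1 / v$3) *\<^sub>R v" using v(3) by (simp add: vec3_eq_iff)
  then show ?thesis using v proj_pt_scale[of "1 / v$3" v] aff_proj[OF v(1)] by simp
qed

lemma aff_part_lift: "{v. v \<noteq> 0 \<and> proj_pt v \<in> aff_part} = {v. v$3 \<noteq> 0}"
proof (intro set_eqI)
  fix v :: "real^3"
  show "v \<in> {v. v \<noteq> 0 \<and> proj_pt v \<in> aff_part} \<longleftrightarrow> v \<in> {v. v$3 \<noteq> 0}"
    using aff_proj(3)[of v] by (cases "v = 0") auto
qed

lemma open_aff_part: "open aff_part"
proof -
  have "open {v :: real^3. v$3 \<noteq> 0}" by (intro open_Collect_neq continuous_intros)
  then show ?thesis unfolding open_rp2_def aff_part_lift .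
qed

text \<open>By the quotient topology, continuity may be tested on nonzero representatives.\<close>

lemma continuous_on_rp2:
  assumes "open S" "\<And>v. v \<noteq> 0 \<Longrightarrow> proj_pt v \<in> S \<Longrightarrow> \<phi> (proj_pt v) = \<Phi> v"
    "continuous_on {v. v \<noteq> 0 \<and> proj_pt v \<in> S} \<Phi>"
  shows "continuous_on S \<phi>"
proof -
  have "open (\<phi> -` B \<inter> S)" if B: "open B" for B
  proof -
    have "open {v. v \<noteq> 0 \<and> proj_pt v \<in> S}" using assms(1) by (simp add: open_rp2_def)
    then have "open (\<Phi> -` B \<inter> {v. v \<noteq> 0 \<and> proj_pt v \<in> S})"
      using assms(3) B by (simp add: continuous_on_open_vimage)
    moreover have "\<Phi> -` B \<inter> {v. v \<noteq> 0 \<and> proj_pt v \<in> S} = {v. v \<noteq> 0 \<and> proj_pt v \<in> \<phi> -` B \<inter> S}"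
      using assms(2) by auto
    ultimately show ?thesis by (simp add: open_rp2_def)
  qed
  then show ?thesis using assms(1) by (simp add: continuous_on_open_vimage)
qed

lemma continuous_on_aff: "continuous_on aff_part aff_x" "continuous_on aff_part aff_y"
proof -
  show "continuous_on aff_part aff_x"
    by (rule continuous_on_rp2[where \<Phi> = "\<lambda>v. v$1 / v$3", OF open_aff_part])
      (auto simp: aff_proj aff_part_lift intro!: continuous_intros)
  show "continuous_on aff_part aff_y"
    by (rule continuous_on_rp2[where \<Phi> = "\<lambda>v. v$2 / v$3", OF open_aff_part])
      (auto simp: aff_proj aff_part_lift intro!: continuous_intros)
qed

text \<open>A wire is the graph of \<open>b i x - i x\<close>, closed up at infinity. As
  \<open>b\<close> is bounded, the asymptotic slope is \<open>-i\<close>, so different wires have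
  different points at infinity and meet only at time \<open>xc i j\<close>. Exact linearity within
  distance \<open>1/2\<close> of a crossing provides the chart for transversality.\<close>

locale wires =
  fixes I :: "nat set" and b :: "nat \<Rightarrow> real \<Rightarrow> real" and xc :: "nat \<Rightarrow> nat \<Rightarrow> real"
  assumes finI: "finite I"
    and contb: "\<And>i. i \<in> I \<Longrightarrow> continuous_on UNIV (b i)"
    and bddb: "\<And>i. i \<in> I \<Longrightarrow> \<exists>B. \<forall>x. \<bar>b i x\<bar> \<le> B"
    and xc_sym: "\<And>i j. xc i j = xc j i"
    and lin: "\<And>i j x. i \<in> I \<Longrightarrow> j \<in> I \<Longrightarrow> i < j \<Longrightarrow> \<bar>x - xc i j\<bar> \<le> 1/2 \<Longrightarrow>
        (b i x - real i * x) - (b j x - real j * x) = 2 * (x - xc i j)"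
    and before: "\<And>i j x. i \<in> I \<Longrightarrow> j \<in> I \<Longrightarrow> i < j \<Longrightarrow> x < xc i j \<Longrightarrow> b i x - real i * x < b j x - real j * x"
    and after: "\<And>i j x. i \<in> I \<Longrightarrow> j \<in> I \<Longrightarrow> i < j \<Longrightarrow> xc i j < x \<Longrightarrow> b j x - real j * x < b i x - real i * x"
    and xc_neq: "\<And>i j k. i \<in> I \<Longrightarrow> j \<in> I \<Longrightarrow> k \<in> I \<Longrightarrow> i \<noteq> j \<Longrightarrow> i \<noteq> k \<Longrightarrow> j \<noteq> k \<Longrightarrow> xc i j \<noteq> xc i k"
begin

definition f :: "nat \<Rightarrow> real \<Rightarrow> real" where "f i x = b i x - real i * x"

text \<open>The homogenised equation of the wire. Where the third coordinate is 0 the last term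
  vanishes, and the only solution is the direction \<open>(1, -i, 0)\<close>.\<close>

definition F :: "nat \<Rightarrow> real^3 \<Rightarrow> real" where
  "F i v = v$2 + real i * v$1 - v$3 * b i (v$1 / v$3)"

definition sg :: "nat \<Rightarrow> nat \<Rightarrow> real" where "sg i j = (if i < j then 1 else -1)"

lemma f_diff_sgn:
  assumes "i \<in> I" "j \<in> I" "i \<noteq> j"
  shows "sg i j * (x - xc i j) > 0 \<Longrightarrow> f j x < f i x" "sg i j * (x - xc i j) < 0 \<Longrightarrow> f i x < f j x"
    "f i x = f j x \<longleftrightarrow> x = xc i j" "\<bar>x - xc i j\<bar> \<le> 1/2 \<Longrightarrow> f i x - f j x = 2 * sg i j * (x - xc i j)"
proof -
  show *: "sg i j * (x - xc i j) > 0 \<Longrightarrow> f j x < f i x" "sg i j * (x - xc i j) < 0 \<Longrightarrow> f i x < f j x" for x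
    using before[of i j x] after[of i j x] before[of j i x] after[of j i x] assms xc_sym[of i j]
    by (auto simp: f_def sg_def split: if_splits)
  show l: "\<bar>x - xc i j\<bar> \<le> 1/2 \<Longrightarrow> f i x - f j x = 2 * sg i j * (x - xc i j)" for x
    using lin[of i j x] lin[of j i x] assms xc_sym[of i j] by (auto simp: f_def sg_def)
  have "f i (xc i j) = f j (xc i j)" using l[of "xc i j"] by simp
  moreover have "sg i j * (x - xc i j) > 0 \<or> sg i j * (x - xc i j) < 0" if "x \<noteq> xc i j"
    using that by (auto simp: sg_def)
  ultimately show "f i x = f j x \<longleftrightarrow> x = xc i j" using *[of x] by force
qed

lemma F_scale: "F i (c *\<^sub>R v) = c * F i v"
  by (cases "c = 0") (auto simp: F_def algebra_simps)

lemma F_aff: "F i (vec3 x y 1) = y - f i x"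
  by (simp add: F_def f_def)

lemma F_inf: "F i (vec3 1 y 0) = y + real i"
  by (simp add: F_def)

lemma F_shift: "F i (v + t *\<^sub>R axis 2 1) = F i v + t"
  by (simp add: F_def axis_def)

text \<open>Towards infinity the factor \<open>v$3\<close> tends to 0 while \<open>b i\<close> stays
  bounded; \<open>bddb\<close> is there for this limit.\<close>

lemma continuous_bterm:
  assumes "i \<in> I" shows "continuous_on S (\<lambda>v :: real^3. v$3 * b i (v$1 / v$3))"
proof -
  have "isCont (\<lambda>v :: real^3. v$3 * b i (v$1 / v$3)) v" for v
  proof (cases "v$3 = 0")
    case False
    have "isCont (b i) (v$1 / v$3)" using contb[OF assms] by (simp add: continuous_on_eq_continuous_at)
    moreover have "isCont (\<lambda>v :: real^3. v$1 / v$3) v" using False by (intro continuous_intros) auto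
    ultimately have "isCont (\<lambda>v :: real^3. b i (v$1 / v$3)) v" by (metis isCont_o2)
    then show ?thesis by (intro continuous_intros)
  next
    case True
    obtain B where B: "\<And>x. \<bar>b i x\<bar> \<le> B" using bddb[OF assms] by auto
    have "((\<lambda>w :: real^3. w$3 * b i (w$1 / w$3)) \<longlongrightarrow> 0) (at v)"
    proof (rule Lim_null_comparison)
      show "\<forall>\<^sub>F w in at v. norm (w$3 * b i (w$1 / w$3)) \<le> \<bar>w$3\<bar> * B"
        by (rule always_eventually) (auto simp: abs_mult intro!: mult_left_mono B)
      have "isCont (\<lambda>w :: real^3. \<bar>w$3\<bar> * B) v" by (intro continuous_intros)
      then show "((\<lambda>w. \<bar>w$3\<bar> * B) \<longlongrightarrow> 0) (at v)" using True by (simp add: isCont_def)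
    qed
    then show ?thesis using True by (simp add: isCont_def)
  qed
  then show ?thesis by (simp add: continuous_at_imp_continuous_on)
qed

lemma F_cont: "i \<in> I \<Longrightarrow> continuous_on S (F i)"
  unfolding F_def by (intro continuous_intros continuous_bterm)

definition wire :: "nat \<Rightarrow> rp2 set" where "wire i = {p. F i (hom_rep p) = 0}"

lemma wire_iff: "v \<noteq> 0 \<Longrightarrow> proj_pt v \<in> wire i \<longleftrightarrow> F i v = 0"
proof -
  assume "v \<noteq> 0"
  then obtain c where "c \<noteq> 0" "hom_rep (proj_pt v) = c *\<^sub>R v" using hom_rep_proj by blast
  then show ?thesis by (simp add: wire_def F_scale)
qed

text \<open>The shear that replaces the second coordinate by \<open>F i\<close> straightens the wire
  to a projective line, and its inverse puts the bent term back.\<close>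

lemma pseudo_line_wire:
  assumes i: "i \<in> I" shows "pseudo_line (wire i)"
proof -
  define T where "T v = vec3 (v$1) (F i v) (v$3)" for v
  define S where "S v = vec3 (v$1) (v$2 - real i * v$1 + v$3 * b i (v$1 / v$3)) (v$3)" for v :: "real^3"
  have cT: "continuous_on UNIV T" unfolding T_def by (intro continuous_intros F_cont[OF i])
  have cS: "continuous_on UNIV S" unfolding S_def by (intro continuous_intros continuous_bterm[OF i])
  have hT: "T (c *\<^sub>R v) = c *\<^sub>R T v" for c v by (simp add: T_def F_scale vec3_eq_iff)
  have hS: "S (c *\<^sub>R v) = c *\<^sub>R S v" for c v
    by (cases "c = 0") (auto simp: S_def vec3_eq_iff algebra_simps)
  have ST: "S (T v) = v" "T (S v) = v" for v by (auto simp: S_def T_def F_def vec3_eq_iff)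
  obtain g h where gh: "homeomorphism UNIV UNIV g h" "\<And>v. v \<noteq> 0 \<Longrightarrow> g (proj_pt v) = proj_pt (T v)"
    using homogeneous_homeomorphism[OF cT cS hT hS ST] by blast
  define W where "W = {v :: real^3. v$2 = 0}"
  have W: "W = {x. axis 2 1 \<bullet> x = 0}"
    unfolding W_def by (simp add: inner_axis')
  have "subspace W" unfolding W by (rule subspace_hyperplane)
  moreover have "dim W = 2" unfolding W by (simp add: dim_hyperplane axis_eq_0_iff)
  moreover have "g ` wire i = {p. Rep_rp2 p \<subseteq> W}"
  proof -
    have span: "Rep_rp2 (proj_pt v) \<subseteq> W \<longleftrightarrow> v$2 = 0" if "v \<noteq> 0" for v
      unfolding Rep_proj_pt[OF that] span_singleton W_def
      by (auto simp: image_subset_iff)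
    have T0: "T v \<noteq> 0" if "v \<noteq> 0" for v using ST(1)[of v] hS[of 0 0] that by auto
    have S0: "S v \<noteq> 0" if "v \<noteq> 0" for v using ST(2)[of v] hT[of 0 0] that by auto
    show ?thesis
    proof (intro equalityI subsetI)
      fix p assume "p \<in> g ` wire i"
      then obtain q where q: "q \<in> wire i" "p = g q" by auto
      have "p = proj_pt (T (hom_rep q))" using gh(2)[OF hom_rep(1)[of q]] q hom_rep(2)[of q] by simp
      moreover have "T (hom_rep q) $ 2 = 0" using q(1) by (simp add: wire_def T_def)
      ultimately show "p \<in> {p. Rep_rp2 p \<subseteq> W}" using span[OF T0[OF hom_rep(1)[of q]]] by simp
    next
      fix p assume p: "p \<in> {p. Rep_rp2 p \<subseteq> W}"
      define w where "w = hom_rep p"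
      have w: "w \<noteq> 0" "p = proj_pt w" using hom_rep[of p] unfolding w_def by auto
      have "w$2 = 0" using p span[OF w(1)] w(2) by simp
      then have "F i (S w) = 0" using ST(2)[of w] unfolding T_def by (metis vec3_nth(2))
      then have "proj_pt (S w) \<in> wire i" using wire_iff[OF S0[OF w(1)]] by simp
      moreover have "g (proj_pt (S w)) = p" using gh(2)[OF S0[OF w(1)]] ST(2) w(2) by simp
      ultimately show "p \<in> g ` wire i" by (metis imageI)
    qed
  qed
  ultimately have "projective_line (g ` wire i)" unfolding projective_line_def by blast
  then show ?thesis unfolding pseudo_line_def using gh(1) by blast
qed

definition pt :: "nat \<Rightarrow> real \<Rightarrow> rp2" where "pt i x = proj_pt (vec3 x (f i x) 1)"
definition ptinf :: "nat \<Rightarrow> rp2" where "ptinf i = proj_pt (vec3 1 (- real i) 0)"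

lemma vec3_nz [simp]: "vec3 x y 1 \<noteq> 0" "vec3 1 y 0 \<noteq> 0"
  by (auto simp: vec3_eq_0)

lemma pt_in: "pt i x \<in> wire i" "ptinf i \<in> wire i"
  by (auto simp: pt_def ptinf_def wire_iff F_aff F_inf)

lemma pt_in_iff: "pt i x \<in> wire j \<longleftrightarrow> f i x = f j x"
  by (simp add: pt_def wire_iff F_aff)

lemma ptinf_in_iff: "ptinf i \<in> wire j \<longleftrightarrow> i = j"
  by (auto simp: ptinf_def wire_iff F_inf)

lemma wire_cases:
  assumes "p \<in> wire i"
  obtains x where "p = pt i x" | "p = ptinf i"
proof -
  define v where "v = hom_rep p"
  have v: "v \<noteq> 0" "p = proj_pt v" "F i v = 0" using hom_rep[of p] assms unfolding v_def wire_def by auto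
  show thesis
  proof (cases "v$3 = 0")
    case False
    then have "p \<in> aff_part" using aff_proj(3)[OF v(1)] v(2) by simp
    then have p: "p = proj_pt (vec3 (aff_x p) (aff_y p) 1)" by (rule aff_vec3)
    then have "F i (vec3 (aff_x p) (aff_y p) 1) = 0" using assms wire_iff[OF vec3_nz(1)] by metis
    then have "aff_y p = f i (aff_x p)" by (simp add: F_aff)
    then show ?thesis using that(1)[of "aff_x p"] p unfolding pt_def by simp
  next
    case True
    then have y: "v$2 = - real i * v$1" using v(3) by (simp add: F_def)
    then have "v$1 \<noteq> 0" using v(1) True by (auto simp: vec3_eq_iff)
    moreover have "v = v$1 *\<^sub>R vec3 1 (- real i) 0" using True y by (simp add: vec3_eq_iff)
    ultimately have "p = ptinf i" unfolding ptinf_def using proj_pt_scale[of "v$1" "vec3 1 (- real i) 0"] v(2) by simp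
    then show ?thesis using that(2) by simp
  qed
qed

lemma wire_inter:
  assumes "i \<in> I" "j \<in> I" "i \<noteq> j"
  shows "wire i \<inter> wire j = {pt i (xc i j)}"
proof (intro equalityI subsetI)
  fix p assume p: "p \<in> wire i \<inter> wire j"
  then have "p \<in> wire i" by simp
  then show "p \<in> {pt i (xc i j)}"
  proof (cases rule: wire_cases)
    case (1 x)
    then have "f i x = f j x" using p pt_in_iff by simp
    then show ?thesis using f_diff_sgn(3)[OF assms] 1 by simp
  next
    case 2
    then show ?thesis using p ptinf_in_iff assms(3) by simp
  qed
next
  fix p assume "p \<in> {pt i (xc i j)}"
  then show "p \<in> wire i \<inter> wire j" using pt_in(1)[of i "xc i j"] pt_in_iff f_diff_sgn(3)[OF assms] by simp
qed

lemma wire_inj: "inj_on wire I"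
  using pt_in(2) ptinf_in_iff by (metis inj_onI)

lemma transversal_wire:
  assumes i: "i \<in> I" "j \<in> I" "i \<noteq> j"
  shows "transversal_at (wire i) (wire j) (pt i (xc i j))"
proof -
  define vec2 :: "real \<Rightarrow> real \<Rightarrow> real^2" where "vec2 a c = a *\<^sub>R axis 1 1 + c *\<^sub>R axis 2 1" for a c
  have vec2: "vec2 a c $ 1 = a" "vec2 a c $ 2 = c" for a c by (auto simp: vec2_def axis_def)
  have eq2: "z = w \<longleftrightarrow> z$1 = w$1 \<and> z$2 = w$2" for z w :: "real^2" by (simp add: vec_eq_iff forall_2)
  define \<xi> where "\<xi> = xc i j"
  define s where "s = sg i j"
  have s: "s = 1 \<or> s = -1" by (simp add: s_def sg_def)
  then have ss: "s * s = 1" by auto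
  have d: "f i x - f j x = 2 * s * (x - \<xi>)" if "\<bar>x - \<xi>\<bar> \<le> 1/2" for x
    using f_diff_sgn(4)[OF i that[unfolded \<xi>_def]] by (simp add: \<xi>_def s_def)
  have cf: "continuous_on S (f k)" if "k \<in> I" for k S
    unfolding f_def using contb[OF that] by (intro continuous_intros continuous_on_subset[OF contb[OF that]]) auto
  \<comment> \<open>The chart coordinates are the heights over the two wires, with the height over
    \<open>i\<close> as the second one, so that wire \<open>i\<close> becomes the first axis. The
    factor 4 keeps the chart where the difference is linear: on the unit ball the time is within
    \<open>1/4\<close> of the crossing.\<close>
  define h where "h p = vec2 (4 * (aff_y p - f j (aff_x p))) (4 * (aff_y p - f i (aff_x p)))" for p
  define V where "V = aff_x -` {\<xi> - 1/2<..<\<xi> + 1/2} \<inter> aff_part"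
  define U where "U = {p \<in> V. h p \<in> ball 0 1}"
  have ch: "continuous_on aff_part h"
    unfolding h_def vec2_def
    by (intro continuous_intros continuous_on_aff continuous_on_compose2[OF cf[OF i(1), of UNIV]]
        continuous_on_compose2[OF cf[OF i(2), of UNIV]]) auto
  have oV: "open V" unfolding V_def
    using continuous_on_aff(1) open_aff_part by (simp add: continuous_on_open_vimage)
  have chV: "continuous_on V h" by (rule continuous_on_subset[OF ch]) (auto simp: V_def)
  have "open (h -` ball 0 1 \<inter> V)" using chV oV by (simp add: continuous_on_open_vimage)
  moreover have "h -` ball 0 1 \<inter> V = U" unfolding U_def by auto
  ultimately have oU: "open U" by simp
  define \<eta> where "\<eta> z = \<xi> + s * (z$1 - z$2) / 8" for z :: "real^2"
  define g where "g z = proj_pt (vec3 (\<eta> z) (z$2 / 4 + f i (\<eta> z)) 1)" for z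
  have c\<eta>: "continuous_on S \<eta>" for S unfolding \<eta>_def by (intro continuous_intros) simp
  have cg: "continuous_on S g" for S
    unfolding g_def
    by (intro continuous_on_proj_pt continuous_intros c\<eta> continuous_on_compose2[OF cf[OF i(1), of UNIV]]) auto
  have \<eta>b: "\<bar>\<eta> z - \<xi>\<bar> < 1/2" if "z \<in> ball 0 1" for z
  proof -
    have "\<bar>z$1\<bar> < 1" "\<bar>z$2\<bar> < 1" using that component_le_norm_cart[of z 1] component_le_norm_cart[of z 2] by auto
    then show ?thesis using s unfolding \<eta>_def by auto
  qed
  have gaff: "g z \<in> aff_part" "aff_x (g z) = \<eta> z" "aff_y (g z) = z$2 / 4 + f i (\<eta> z)" for z
    unfolding g_def using aff_proj[OF vec3_nz(1)] by auto
  have hg: "h (g z) = z" if "z \<in> ball 0 1" for z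
  proof -
    have "f i (\<eta> z) - f j (\<eta> z) = 2 * s * (s * (z$1 - z$2) / 8)"
      using d[of "\<eta> z"] \<eta>b[OF that] by (simp add: \<eta>_def)
    also have "\<dots> = (s * s) * (z$1 - z$2) / 4" by simp
    finally have "f i (\<eta> z) - f j (\<eta> z) = (z$1 - z$2) / 4" by (simp add: ss)
    then show ?thesis unfolding h_def gaff eq2 vec2 by (simp add: algebra_simps)
  qed
  have gh: "g (h p) = p" if "p \<in> U" for p
  proof -
    have p: "p \<in> aff_part" "\<xi> - 1/2 < aff_x p" "aff_x p < \<xi> + 1/2" using that unfolding U_def V_def by auto
    then have p2: "\<bar>aff_x p - \<xi>\<bar> \<le> 1/2" by linarith
    have "h p $ 1 - h p $ 2 = 4 * (f i (aff_x p) - f j (aff_x p))" unfolding h_def vec2 by (simp add: algebra_simps)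
    also have "\<dots> = 8 * s * (aff_x p - \<xi>)" using d[OF p2] by simp
    finally have "\<eta> (h p) = \<xi> + (s * s) * (aff_x p - \<xi>)" unfolding \<eta>_def by simp
    then have "\<eta> (h p) = aff_x p" by (simp add: ss)
    moreover have "h p $ 2 / 4 + f i (aff_x p) = aff_y p" unfolding h_def vec2 by (simp add: field_simps)
    ultimately show ?thesis unfolding g_def using aff_vec3[OF p(1)] by simp
  qed
  have gU: "g z \<in> U" if "z \<in> ball 0 1" for z
  proof -
    have "\<xi> - 1/2 < \<eta> z" "\<eta> z < \<xi> + 1/2" using \<eta>b[OF that] by linarith+
    then show ?thesis unfolding U_def V_def using gaff(1,2) hg[OF that] that by simp
  qed
  have hom: "homeomorphism U (ball 0 1) h g"
  proof (rule homeomorphismI)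
    show "continuous_on U h" by (rule continuous_on_subset[OF chV]) (auto simp: U_def)
  qed (use cg gU gh hg in \<open>auto simp: U_def\<close>)
  have ptU: "pt i \<xi> = g 0"
    unfolding g_def pt_def \<eta>_def by simp
  then have pU: "pt i \<xi> \<in> U" "h (pt i \<xi>) = 0" using gU[of 0] hg[of 0] by auto
  have inl: "g z \<in> wire k \<longleftrightarrow> z$2 / 4 + f i (\<eta> z) = f k (\<eta> z)" for z k
    unfolding g_def using wire_iff[OF vec3_nz(1)] by (simp add: F_aff)
  have img: "h ` (wire k \<inter> U) = {z \<in> ball 0 1. h (g z) $ (if k = i then 2 else 1) = 0}" if "k = i \<or> k = j" for k
  proof -
    have *: "g z \<in> wire k \<longleftrightarrow> h (g z) $ (if k = i then 2 else 1) = 0" for z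
      unfolding inl h_def gaff vec2 using that i(3) by (auto simp: vec2)
    show ?thesis
    proof (intro equalityI subsetI)
      fix z assume "z \<in> h ` (wire k \<inter> U)"
      then obtain p where p: "p \<in> wire k" "p \<in> U" "z = h p" by auto
      then have "z \<in> ball 0 1" "g z = p" using gh unfolding U_def by auto
      then show "z \<in> {z \<in> ball 0 1. h (g z) $ (if k = i then 2 else 1) = 0}" using *[of z] p(1) by simp
    next
      fix z assume "z \<in> {z \<in> ball 0 1. h (g z) $ (if k = i then 2 else 1) = 0}"
      then have z: "z \<in> ball 0 1" "g z \<in> wire k" using *[of z] by auto
      then show "z \<in> h ` (wire k \<inter> U)" using gU[OF z(1)] hg[OF z(1)] by (intro image_eqI[of _ _ "g z"]) auto
    qed
  qed
  have "h ` (wire i \<inter> U) = {x \<in> ball 0 1. x $ 2 = 0}" using img[of i] hg by auto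
  moreover have "h ` (wire j \<inter> U) = {x \<in> ball 0 1. x $ 1 = 0}" using img[of j] hg i(3) by auto
  ultimately show ?thesis unfolding transversal_at_def using oU pU hom \<xi>_def by blast
qed

lemma simple_arrangement_wire: "simple_arrangement (card I) (wire ` I)"
  unfolding simple_arrangement_def
proof (intro conjI ballI impI)
  show "finite (wire ` I)" "card (wire ` I) = card I" using finI wire_inj by (auto simp: card_image)
  show "pseudo_line L" if "L \<in> wire ` I" for L using that pseudo_line_wire by auto
  fix L M assume "L \<in> wire ` I" "M \<in> wire ` I" "L \<noteq> M"
  then obtain i j where ij: "i \<in> I" "j \<in> I" "i \<noteq> j" "L = wire i" "M = wire j" by auto
  have "pt i (xc i j) \<notin> wire k" if "k \<in> I" "wire k \<noteq> wire i" "wire k \<noteq> wire j" for k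
  proof -
    have k: "k \<noteq> i" "k \<noteq> j" using that by auto
    then have "xc i j \<noteq> xc i k" using xc_neq ij that(1) by metis
    then show ?thesis using pt_in_iff f_diff_sgn(3)[OF ij(1) that(1) k(1)[symmetric]] by simp
  qed
  then show "\<exists>p. L \<inter> M = {p} \<and> transversal_at L M p \<and> (\<forall>N\<in>wire ` I - {L, M}. p \<notin> N)"
    using wire_inter[OF ij(1-3)] transversal_wire[OF ij(1-3)] ij(4,5) by (intro exI[of _ "pt i (xc i j)"]) auto
qed

end

section \<open>Regions and arcs cut out by wires\<close>

lemma pos_scale_iff: "r > 0 \<Longrightarrow> 0 < r * (z::real) \<longleftrightarrow> 0 < z"
  by (simp add: zero_less_mult_iff)

lemma ex_small_inverse:
  fixes \<delta> K :: real
  assumes "\<delta> > 0" "K > 0" shows "\<exists>u. 0 < u \<and> u < \<delta> \<and> K \<le> 1 / u"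
proof (cases "\<delta> / 2 \<le> 1 / K")
  case True
  then have "K \<le> 1 / (\<delta> / 2)" using assms by (simp add: field_simps)
  then show ?thesis using assms by (intro exI[of _ "\<delta> / 2"]) auto
next
  case False
  then show ?thesis using assms by (intro exI[of _ "1 / K"]) auto
qed

lemma connected_insert_closure: "connected S \<Longrightarrow> x \<in> closure S \<Longrightarrow> connected (insert x S)"
  by (rule connected_intermediate_closure[of S]) (use closure_subset in auto)

context wires
begin

text \<open>The sign of a single \<open>F i\<close> depends on the representative, the sign of a
  product of two does not. Off the two wires, the plane is divided into \<open>pos i j 1\<close> and
  \<open>pos i j (-1)\<close>.\<close>

definition pos :: "nat \<Rightarrow> nat \<Rightarrow> real \<Rightarrow> rp2 set" where
  "pos i j s = {p. s * F i (hom_rep p) * F j (hom_rep p) > 0}"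

lemma pos_iff: "v \<noteq> 0 \<Longrightarrow> proj_pt v \<in> pos i j s \<longleftrightarrow> s * F i v * F j v > 0"
proof -
  assume "v \<noteq> 0"
  then obtain c where c: "c \<noteq> 0" "hom_rep (proj_pt v) = c *\<^sub>R v" using hom_rep_proj by blast
  have "s * (c * F i v) * (c * F j v) = c\<^sup>2 * (s * F i v * F j v)" by (simp add: power2_eq_square algebra_simps)
  moreover have "c\<^sup>2 > 0" using c(1) by simp
  ultimately have "0 < s * (c * F i v) * (c * F j v) \<longleftrightarrow> 0 < s * F i v * F j v" using pos_scale_iff by metis
  then show ?thesis unfolding pos_def mem_Collect_eq c(2) F_scale .
qed

lemma open_pos:
  assumes "i \<in> I" "j \<in> I" shows "open (pos i j s)"
proof -
  have "{v. v \<noteq> 0 \<and> proj_pt v \<in> pos i j s} = - {0} \<inter> {v. 0 < s * F i v * F j v}"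
    using pos_iff by auto
  moreover have "open {v. 0 < s * F i v * F j v}"
    by (intro open_Collect_less continuous_intros F_cont assms)
  moreover have "open (- {0 :: real^3})" by (intro open_Compl closed_singleton)
  ultimately show ?thesis unfolding open_rp2_def by (simp add: open_Int)
qed

lemma wire_hom: "p \<in> wire i \<longleftrightarrow> F i (hom_rep p) = 0"
  by (simp add: wire_def)

lemma pos_trichotomy:
  assumes "s \<noteq> 0" shows "p \<in> pos i j s \<or> p \<in> pos i j (- s) \<or> p \<in> wire i \<or> p \<in> wire j"
proof (cases "p \<in> wire i \<or> p \<in> wire j")
  case False
  then have "s * F i (hom_rep p) * F j (hom_rep p) \<noteq> 0" using assms by (simp add: wire_hom)
  then have "s * F i (hom_rep p) * F j (hom_rep p) > 0 \<or> (- s) * F i (hom_rep p) * F j (hom_rep p) > 0"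
    by (metis linorder_neqE_linordered_idom mult_minus_left neg_0_less_iff_less)
  then show ?thesis unfolding pos_def by blast
qed blast

lemma pos_disj: "pos i j s \<inter> pos i j (- s) = {}" "pos i j s \<inter> wire i = {}" "pos i j s \<inter> wire j = {}"
  by (auto simp: pos_def wire_hom)

lemma closure_pos: "i \<in> I \<Longrightarrow> j \<in> I \<Longrightarrow> S \<subseteq> pos i j s \<Longrightarrow> closure S \<inter> pos i j (- s) = {}"
proof -
  assume *: "i \<in> I" "j \<in> I" "S \<subseteq> pos i j s"
  then have "S \<inter> pos i j (- s) = {}" using pos_disj(1) by blast
  then show ?thesis using open_Int_closure_eq_empty[OF open_pos[OF *(1,2)], of "- s" S] by blast
qed

text \<open>Along wire \<open>i\<close> the sign of \<open>F j\<close> changes exactly at the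
  crossing, in the direction recorded by \<open>sg\<close>.\<close>

lemma F_pt_sgn:
  assumes "i \<in> I" "j \<in> I" "i \<noteq> j"
  shows "\<exists>r>0. F j (vec3 x (f i x) 1) = r * (sg i j * (x - xc i j))"
proof -
  have F: "F j (vec3 x (f i x) 1) = f i x - f j x" by (simp add: F_aff)
  consider "x = xc i j" | "sg i j * (x - xc i j) > 0" | "sg i j * (x - xc i j) < 0"
  proof -
    have "x \<noteq> xc i j \<Longrightarrow> sg i j * (x - xc i j) \<noteq> 0" by (simp add: sg_def)
    then show thesis using that by (meson linorder_neqE_linordered_idom)
  qed
  then show ?thesis
  proof cases
    case 1
    then have "f i x = f j x" using f_diff_sgn(3)[OF assms] by simp
    then show ?thesis using F 1 by (intro exI[of _ 1]) simp
  next
    case 2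
    define d where "d = sg i j * (x - xc i j)"
    have "f i x - f j x > 0" "d > 0" using f_diff_sgn(1)[OF assms 2] 2 by (auto simp: d_def)
    then have "(f i x - f j x) / d > 0" "F j (vec3 x (f i x) 1) = (f i x - f j x) / d * d" using F by auto
    then show ?thesis unfolding d_def by blast
  next
    case 3
    define d where "d = sg i j * (x - xc i j)"
    have "f i x - f j x < 0" "d < 0" using f_diff_sgn(2)[OF assms 3] 3 by (auto simp: d_def)
    then have "(f i x - f j x) / d > 0" "F j (vec3 x (f i x) 1) = (f i x - f j x) / d * d"
      using F by (auto simp: divide_neg_neg)
    then show ?thesis unfolding d_def by blast
  qed
qed

lemma sg_sq: "sg i j * sg i j = 1"
  by (simp add: sg_def)

lemma pos_pt:
  assumes i: "i \<in> I" "j \<in> I" "k \<in> I" "i \<noteq> j" "i \<noteq> k"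
  shows "pt i x \<in> pos j k (\<omega> * sg i j * sg i k) \<longleftrightarrow> \<omega> * (x - xc i j) * (x - xc i k) > 0"
proof -
  obtain r where r: "r > 0" "F j (vec3 x (f i x) 1) = r * (sg i j * (x - xc i j))" using F_pt_sgn[OF i(1,2,4)] by blast
  obtain t where t: "t > 0" "F k (vec3 x (f i x) 1) = t * (sg i k * (x - xc i k))" using F_pt_sgn[OF i(1,3,5)] by blast
  have "(\<omega> * sg i j * sg i k) * F j (vec3 x (f i x) 1) * F k (vec3 x (f i x) 1) =
      (r * t) * (sg i j * sg i j) * (sg i k * sg i k) * (\<omega> * (x - xc i j) * (x - xc i k))"
    unfolding r(2) t(2) by (simp add: algebra_simps)
  also have "\<dots> = (r * t) * (\<omega> * (x - xc i j) * (x - xc i k))" by (simp add: sg_sq)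
  finally have E: "(\<omega> * sg i j * sg i k) * F j (vec3 x (f i x) 1) * F k (vec3 x (f i x) 1) =
      (r * t) * (\<omega> * (x - xc i j) * (x - xc i k))" .
  show ?thesis unfolding pt_def pos_iff[OF vec3_nz(1)] E by (rule pos_scale_iff[OF mult_pos_pos[OF r(1) t(1)]])
qed

lemma pos_ptinf:
  assumes "i \<noteq> j" "i \<noteq> k"
  shows "ptinf i \<in> pos j k (\<omega> * sg i j * sg i k) \<longleftrightarrow> \<omega> > 0"
proof -
  have 1: "sg i j * (real j - real i) > 0" "sg i k * (real k - real i) > 0" using assms by (auto simp: sg_def)
  have "(\<omega> * sg i j * sg i k) * F j (vec3 1 (- real i) 0) * F k (vec3 1 (- real i) 0) =
      \<omega> * ((sg i j * (real j - real i)) * (sg i k * (real k - real i)))"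
    unfolding F_inf by (simp add: algebra_simps)
  also have "0 < \<dots> \<longleftrightarrow> 0 < \<omega>" using mult_pos_pos[OF 1] by (simp add: zero_less_mult_iff[of \<omega>])
  finally show ?thesis unfolding ptinf_def pos_iff[OF vec3_nz(2)] .
qed

lemma pt_cont: "i \<in> I \<Longrightarrow> continuous_on S (pt i)"
proof -
  assume i: "i \<in> I"
  have "continuous_on S (f i)" unfolding f_def
    by (intro continuous_intros continuous_on_subset[OF contb[OF i]]) auto
  then show ?thesis unfolding pt_def by (intro continuous_on_proj_pt continuous_intros) auto
qed

text \<open>Near its point at infinity the wire is continuously parametrised by
  \<open>u = 1 / x\<close>.\<close>

lemma ptinf_closure:
  assumes i: "i \<in> I" and a: "\<And>\<delta>. \<delta> > 0 \<Longrightarrow> \<exists>u. u \<noteq> 0 \<and> \<bar>u\<bar> < \<delta> \<and> 1 / u \<in> S"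
  shows "ptinf i \<in> closure (pt i ` S)"
proof (rule closureI_meets)
  fix U assume U: "open U" "ptinf i \<in> U"
  define q where "q u = proj_pt (vec3 1 (u * b i (1 / u) - real i) u)" for u
  have nz: "vec3 1 y u \<noteq> 0" for y u by (simp add: vec3_eq_0)
  have "continuous_on UNIV (\<lambda>u. vec3 1 0 u)" by (intro continuous_intros)
  then have "continuous_on UNIV (\<lambda>u. vec3 1 0 u $ 3 * b i (vec3 1 0 u $ 1 / vec3 1 0 u $ 3))"
    using continuous_on_compose2[OF continuous_bterm[OF i, of UNIV]] by blast
  then have "continuous_on UNIV (\<lambda>u. u * b i (1 / u))" by simp
  then have "continuous_on UNIV (\<lambda>u. vec3 1 (u * b i (1 / u) - real i) u)"
    by (intro continuous_on_vec3 continuous_on_diff continuous_on_const continuous_on_id)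
  then have "continuous_on UNIV q" unfolding q_def by (rule continuous_on_proj_pt) (rule nz)
  then have "open (q -` U)" using U(1) by (simp add: continuous_on_open_vimage)
  moreover have "0 \<in> q -` U" using U(2) by (simp add: q_def ptinf_def)
  ultimately obtain \<delta> where \<delta>: "\<delta> > 0" "\<And>u. dist u 0 < \<delta> \<Longrightarrow> u \<in> q -` U" using open_dist by metis
  obtain u where u: "u \<noteq> 0" "\<bar>u\<bar> < \<delta>" "1 / u \<in> S" using a[OF \<delta>(1)] by blast
  have "vec3 1 (u * b i (1 / u) - real i) u = u *\<^sub>R vec3 (1 / u) (f i (1 / u)) 1"
    using u(1) by (simp add: vec3_eq_iff f_def algebra_simps)
  then have "q u = pt i (1 / u)" unfolding q_def pt_def using proj_pt_scale[OF u(1) vec3_nz(1)] by simp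
  moreover have "q u \<in> U" using \<delta>(2)[of u] u(2) by simp
  ultimately show "U \<inter> pt i ` S \<noteq> {}" using u(3) by auto
qed

text \<open>The value \<open>\<omega> = -1\<close> selects the arc of times between the two
  crossings, \<open>\<omega> = 1\<close> the arc through the point at infinity. In either case the
  other crossings lie on the complementary arc.\<close>

definition adj :: "nat \<Rightarrow> nat \<Rightarrow> nat \<Rightarrow> real \<Rightarrow> bool" where
  "adj i j k \<omega> \<longleftrightarrow> (\<omega> = 1 \<or> \<omega> = -1) \<and>
     (\<forall>e\<in>I - {i, j, k}. \<omega> * (xc i e - xc i j) * (xc i e - xc i k) < 0)"

definition arc :: "nat \<Rightarrow> nat \<Rightarrow> nat \<Rightarrow> real \<Rightarrow> rp2 set" where
  "arc i j k \<omega> = wire i \<inter> pos j k (\<omega> * sg i j * sg i k)"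

text \<open>On wire \<open>i\<close> the complementary arc lies in the other one of the two regions
  given by \<open>j\<close> and \<open>k\<close>.\<close>

lemma arc_vertex:
  assumes i: "i \<in> I" "j \<in> I" "k \<in> I" "i \<noteq> j" "i \<noteq> k" "j \<noteq> k" and a: "adj i j k \<omega>"
    and e: "e \<in> I - {i, j, k}" and p: "p \<in> wire i" "p \<in> wire e"
  shows "p \<in> pos j k (- (\<omega> * sg i j * sg i k))"
proof -
  have "p = pt i (xc i e)" using wire_inter[of i e] i(1) e p by auto
  moreover have "(- \<omega>) * (xc i e - xc i j) * (xc i e - xc i k) > 0" using a e unfolding adj_def by auto
  ultimately show ?thesis using pos_pt[OF i(1-5), of "xc i e" "- \<omega>"] by simp
qed

text \<open>For \<open>\<omega> = -1\<close> the arc is the image of an interval. For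
  \<open>\<omega> = 1\<close> two rays are joined at \<open>ptinf i\<close>, which lies in the
  closure of both.\<close>

lemma arc_connected:
  assumes i: "i \<in> I" "j \<in> I" "k \<in> I" "i \<noteq> j" "i \<noteq> k" "j \<noteq> k" and a: "adj i j k \<omega>"
  shows "connected (arc i j k \<omega>)" "arc i j k \<omega> \<noteq> {}"
proof -
  define l where "l = min (xc i j) (xc i k)"
  define h where "h = max (xc i j) (xc i k)"
  have lh: "l < h" using xc_neq[OF i(1-5) i(6)] unfolding l_def h_def by auto
  have prod: "(x - xc i j) * (x - xc i k) = (x - l) * (x - h)" for x
    unfolding l_def h_def min_def max_def by auto
  have \<omega>: "\<omega> = 1 \<or> \<omega> = -1" using a by (simp add: adj_def)
  have pin: "pt i x \<in> arc i j k \<omega> \<longleftrightarrow> \<omega> * ((x - l) * (x - h)) > 0" for x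
    unfolding arc_def using pos_pt[OF i(1-5), of x \<omega>] pt_in(1) prod[of x] by (simp add: mult.assoc)
  have inf: "ptinf i \<in> arc i j k \<omega> \<longleftrightarrow> \<omega> > 0" unfolding arc_def using pos_ptinf[OF i(4,5)] pt_in(2) by simp
  have "connected (arc i j k \<omega>) \<and> arc i j k \<omega> \<noteq> {}"
  proof (cases "\<omega> = 1")
    case False
    then have w: "\<omega> = -1" using \<omega> by simp
    have "arc i j k \<omega> = pt i ` {l<..<h}"
    proof (intro equalityI subsetI)
      fix p assume p: "p \<in> arc i j k \<omega>"
      then have "p \<in> wire i" by (simp add: arc_def)
      then show "p \<in> pt i ` {l<..<h}"
      proof (cases rule: wire_cases)
        case (1 x)
        then have "(x - l) * (x - h) < 0" using p pin w by simp
        then have "l < x \<and> x < h" using lh by (auto simp: mult_less_0_iff)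
        then show ?thesis using 1 by simp
      next
        case 2 then show ?thesis using p inf w by simp
      qed
    next
      fix p assume "p \<in> pt i ` {l<..<h}"
      then obtain x where x: "l < x" "x < h" "p = pt i x" by auto
      then have "(x - l) * (x - h) < 0" by (simp add: mult_less_0_iff)
      then show "p \<in> arc i j k \<omega>" using pin w x(3) by simp
    qed
    moreover have "connected (pt i ` {l<..<h})" by (intro connected_continuous_image pt_cont[OF i(1)]) simp
    ultimately show ?thesis using lh by simp
  next
    case True
    let ?R = "pt i ` {h<..}" and ?L = "pt i ` {..<l}"
    have eq: "arc i j k \<omega> = insert (ptinf i) ?R \<union> insert (ptinf i) ?L"
    proof (intro equalityI subsetI)
      fix p assume p: "p \<in> arc i j k \<omega>"
      then have "p \<in> wire i" by (simp add: arc_def)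
      then show "p \<in> insert (ptinf i) ?R \<union> insert (ptinf i) ?L"
      proof (cases rule: wire_cases)
        case (1 x)
        then have "(x - l) * (x - h) > 0" using p pin True by simp
        then have "x < l \<or> h < x" using lh by (auto simp: zero_less_mult_iff)
        then show ?thesis using 1 by auto
      qed simp
    next
      fix p assume "p \<in> insert (ptinf i) ?R \<union> insert (ptinf i) ?L"
      then consider "p = ptinf i" | x where "p = pt i x" "x < l \<or> h < x" by auto
      then show "p \<in> arc i j k \<omega>"
      proof cases
        case 1 then show ?thesis using inf True by simp
      next
        case 2
        then have "(x - l) * (x - h) > 0" using lh by (auto simp: zero_less_mult_iff)
        then show ?thesis using pin True 2 by simp
      qed
    qed
    have "ptinf i \<in> closure ?R"
    proof (rule ptinf_closure[OF i(1)])
      fix \<delta> :: real assume "\<delta> > 0"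
      have "\<bar>h\<bar> + 1 > 0" by simp
      then obtain u where u: "0 < u" "u < \<delta>" "\<bar>h\<bar> + 1 \<le> 1 / u" using ex_small_inverse[OF \<open>\<delta> > 0\<close>] by blast
      then show "\<exists>u. u \<noteq> 0 \<and> \<bar>u\<bar> < \<delta> \<and> 1 / u \<in> {h<..}" by (intro exI[of _ "u"]) auto
    qed
    moreover have "connected ?R" by (intro connected_continuous_image pt_cont[OF i(1)]) simp
    ultimately have R: "connected (insert (ptinf i) ?R)" by (intro connected_insert_closure)
    have "ptinf i \<in> closure ?L"
    proof (rule ptinf_closure[OF i(1)])
      fix \<delta> :: real assume "\<delta> > 0"
      have "\<bar>l\<bar> + 1 > 0" by simp
      then obtain u where u: "0 < u" "u < \<delta>" "\<bar>l\<bar> + 1 \<le> 1 / u" using ex_small_inverse[OF \<open>\<delta> > 0\<close>] by blast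
      then show "\<exists>u. u \<noteq> 0 \<and> \<bar>u\<bar> < \<delta> \<and> 1 / u \<in> {..<l}" by (intro exI[of _ "- u"]) auto
    qed
    moreover have "connected ?L" by (intro connected_continuous_image pt_cont[OF i(1)]) simp
    ultimately have L: "connected (insert (ptinf i) ?L)" by (intro connected_insert_closure)
    have "connected (insert (ptinf i) ?R \<union> insert (ptinf i) ?L)" using R L by (rule connected_Un) auto
    then show ?thesis unfolding eq by simp
  qed
  then show "connected (arc i j k \<omega>)" "arc i j k \<omega> \<noteq> {}" by auto
qed

lemma vertices_wire:
  assumes i: "i \<in> I" shows "p \<in> wire i \<Longrightarrow> p \<in> vertices (wire ` I) \<longleftrightarrow> (\<exists>e\<in>I - {i}. p \<in> wire e)"
proof
  assume p: "p \<in> wire i" and "p \<in> vertices (wire ` I)"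
  then obtain L M where "L \<in> wire ` I" "M \<in> wire ` I" "L \<noteq> M" "p \<in> L" "p \<in> M" unfolding vertices_def by blast
  then obtain a c where "a \<in> I" "c \<in> I" "a \<noteq> c" "p \<in> wire a" "p \<in> wire c" by auto
  then show "\<exists>e\<in>I - {i}. p \<in> wire e" by (cases "a = i") auto
next
  assume p: "p \<in> wire i" and "\<exists>e\<in>I - {i}. p \<in> wire e"
  then obtain e where e: "e \<in> I" "e \<noteq> i" "p \<in> wire e" by auto
  then have "wire e \<noteq> wire i" using wire_inj i unfolding inj_on_def by auto
  then show "p \<in> vertices (wire ` I)" unfolding vertices_def using e i p by blast
qed

lemma arc_sub:
  assumes i: "i \<in> I" "j \<in> I" "k \<in> I" "i \<noteq> j" "i \<noteq> k" "j \<noteq> k" and a: "adj i j k \<omega>"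
  shows "arc i j k \<omega> \<subseteq> wire i - vertices (wire ` I)"
    "S \<inter> pos j k (- (\<omega> * sg i j * sg i k)) = {} \<Longrightarrow> wire i \<inter> S \<subseteq> arc i j k \<omega> \<union> vertices (wire ` I)"
proof -
  show "arc i j k \<omega> \<subseteq> wire i - vertices (wire ` I)"
  proof
    fix p assume p: "p \<in> arc i j k \<omega>"
    then have pi: "p \<in> wire i" "p \<in> pos j k (\<omega> * sg i j * sg i k)" by (auto simp: arc_def)
    have "p \<notin> wire e" if "e \<in> I - {i}" for e
    proof
      assume pe: "p \<in> wire e"
      then have "e \<noteq> j" "e \<noteq> k" using pi(2) pos_disj(2,3) by blast+
      then have "p \<in> pos j k (- (\<omega> * sg i j * sg i k))" using arc_vertex[OF i a _ pi(1) pe] that by simp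
      then show False using pi(2) pos_disj(1) by blast
    qed
    then show "p \<in> wire i - vertices (wire ` I)" using vertices_wire[OF i(1) pi(1)] pi(1) by blast
  qed
  assume S: "S \<inter> pos j k (- (\<omega> * sg i j * sg i k)) = {}"
  show "wire i \<inter> S \<subseteq> arc i j k \<omega> \<union> vertices (wire ` I)"
  proof
    fix p assume p: "p \<in> wire i \<inter> S"
    have "\<omega> * sg i j * sg i k \<noteq> 0" using a by (auto simp: adj_def sg_def)
    then have "p \<in> pos j k (\<omega> * sg i j * sg i k) \<or> p \<in> wire j \<or> p \<in> wire k"
      using pos_trichotomy[of "\<omega> * sg i j * sg i k" p j k] S p by blast
    then show "p \<in> arc i j k \<omega> \<union> vertices (wire ` I)"
      using p vertices_wire[OF i(1), of p] i by (auto simp: arc_def)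
  qed
qed

text \<open>Three wires divide the plane into four regions, distinguished by the signs of the
  pairwise products; \<open>R\<close> is the one bounded by the three given arcs. A fourth wire
  crosses the three on the complementary arcs and so does not touch the boundary of
  \<open>R\<close>. As it is connected and meets wire \<open>i\<close>, it misses
  \<open>R\<close>.\<close>

lemma wires_triangle:
  assumes n: "4 \<le> card I"
    and i: "i \<in> I" "j \<in> I" "k \<in> I" "i \<noteq> j" "i \<noteq> k" "j \<noteq> k"
    and a: "adj i j k u" "adj j i k v" "adj k i j w" and uvw: "u * v * w = -1"
  shows "\<exists>P. arrangement.tri (wire ` I) P \<and>
    (\<forall>L\<in>wire ` I. (\<exists>s\<in>sides (wire ` I) P. s \<subseteq> L) \<longleftrightarrow> L \<in> {wire i, wire j, wire k})"
proof -
  interpret arrangement "wire ` I" "card I"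
    by (rule arrangement.intro[OF simple_arrangement_wire n])
  define ki where "ki = u * sg i j * sg i k"
  define kj where "kj = v * sg j i * sg j k"
  define kk where "kk = w * sg k i * sg k j"
  have s1: "u = 1 \<or> u = -1" "v = 1 \<or> v = -1" "w = 1 \<or> w = -1" using a by (auto simp: adj_def)
  have kpm: "ki = 1 \<or> ki = -1" "kj = 1 \<or> kj = -1" "kk = 1 \<or> kk = -1"
    using s1 by (auto simp: ki_def kj_def kk_def sg_def)
  \<comment> \<open>The three pairwise products of values of \<open>F\<close> multiply to a square,
    so the three signs must multiply to 1. The six factors \<open>sg\<close> contribute -1 in total,
    which turns this condition into \<open>u * v * w = -1\<close>.\<close>
  have prodk: "kj = ki * kk"
    using uvw s1 i(4-6) unfolding ki_def kj_def kk_def sg_def by (auto split: if_splits)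
  define R where "R = pos i j kk \<inter> pos j k ki"
  have Rik: "R \<subseteq> pos i k kj"
  proof
    fix p assume "p \<in> R"
    then have "kk * F i (hom_rep p) * F j (hom_rep p) > 0" "ki * F j (hom_rep p) * F k (hom_rep p) > 0"
      by (auto simp: R_def pos_def)
    then have "(kk * F i (hom_rep p) * F j (hom_rep p)) * (ki * F j (hom_rep p) * F k (hom_rep p)) > 0" by simp
    then have "(kj * F i (hom_rep p) * F k (hom_rep p)) * (F j (hom_rep p))\<^sup>2 > 0"
      unfolding prodk by (simp add: power2_eq_square algebra_simps)
    then show "p \<in> pos i k kj" by (simp add: pos_def zero_less_mult_iff)
  qed
  have pos_sym: "pos a c s = pos c a s" for a c s by (auto simp: pos_def algebra_simps)
  have cl: "closure R \<inter> pos j k (- ki) = {}" "closure R \<inter> pos i k (- kj) = {}" "closure R \<inter> pos i j (- kk) = {}"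
    using closure_pos[OF i(2,3), of R ki] closure_pos[OF i(1,3) Rik] closure_pos[OF i(1,2), of R kk]
    by (auto simp: R_def)
  have oR: "open R" unfolding R_def using open_pos i by auto
  have lnA: "wire i \<in> wire ` I" "wire j \<in> wire ` I" "wire k \<in> wire ` I" using i by auto
  have lnd: "wire i \<noteq> wire j" "wire i \<noteq> wire k" "wire j \<noteq> wire k" using i wire_inj by (auto simp: inj_on_def)
  have clR: "closure R \<subseteq> R \<union> (wire i \<union> wire j \<union> wire k)"
  proof
    fix p assume p: "p \<in> closure R"
    have "p \<in> pos i j kk \<or> p \<in> wire i \<or> p \<in> wire j" using pos_trichotomy[of kk p i j] cl(3) p kpm by auto
    moreover have "p \<in> pos j k ki \<or> p \<in> wire j \<or> p \<in> wire k" using pos_trichotomy[of ki p j k] cl(1) p kpm by auto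
    ultimately show "p \<in> R \<union> (wire i \<union> wire j \<union> wire k)" by (auto simp: R_def)
  qed
  have other: "closure R \<inter> wire e \<inter> (wire i \<union> wire j \<union> wire k) = {}" if e: "e \<in> I - {i, j, k}" for e
  proof -
    have "p \<notin> closure R" if "p \<in> wire e" "p \<in> wire i" for p
      using arc_vertex[OF i a(1) e that(2,1)] cl(1) unfolding ki_def by blast
    moreover have "p \<notin> closure R" if "p \<in> wire e" "p \<in> wire j" for p
      using arc_vertex[OF i(2,1,3) i(4)[symmetric] i(6,5) a(2) _ that(2,1)] e cl(2) unfolding kj_def by blast
    moreover have "p \<notin> closure R" if "p \<in> wire e" "p \<in> wire k" for p
      using arc_vertex[OF i(3,1,2) i(5)[symmetric] i(6)[symmetric] i(4) a(3) _ that(2,1)] e cl(3) unfolding kk_def by blast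
    ultimately show ?thesis by blast
  qed
  have Rdisj: "R \<inter> \<Union>(wire ` I) = {}"
  proof -
    have "R \<inter> wire e = {}" if e: "e \<in> I" for e
    proof (cases "e \<in> {i, j, k}")
      case True
      then show ?thesis using pos_disj unfolding R_def by blast
    next
      case False
      then have e': "e \<in> I - {i, j, k}" using e by simp
      have "wire e \<subseteq> R \<or> wire e \<subseteq> - closure R"
      proof (rule connected_pick)
        show "connected (wire e)" using line_connected e by simp
        show "wire e \<subseteq> R \<union> - closure R" using clR other[OF e'] by blast
        show "R \<inter> - closure R = {}" using closure_subset by blast
      qed (use oR in auto)
      moreover have "\<not> wire e \<subseteq> R"
      proof
        assume "wire e \<subseteq> R"
        moreover have "pt i (xc i e) \<in> wire i \<inter> wire e" using wire_inter[of i e] i(1) e' by auto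
        ultimately show False using pos_disj(2) unfolding R_def by blast
      qed
      ultimately show ?thesis using closure_subset by blast
    qed
    then show ?thesis by blast
  qed
  define K where "K L = (if L = wire i then arc i j k u else if L = wire j then arc j i k v else arc k i j w)" for L
  have "arc i j k u \<noteq> {}" by (rule arc_connected(2)[OF i a(1)])
  then obtain p where p: "p \<in> arc i j k u" by blast
  have pcl: "p \<in> closure R"
  proof (rule closureI_meets)
    fix U assume U: "open U" "p \<in> U"
    define x where "x = hom_rep p"
    have x: "x \<noteq> 0" "proj_pt x = p" unfolding x_def by (rule hom_rep)+
    have "p \<in> wire i" "p \<in> pos j k ki" using p unfolding arc_def ki_def by blast+
    then have Fx: "F i x = 0" "ki * F j x * F k x > 0" unfolding wire_hom pos_def x_def by simp_all
    then have nz: "F j x \<noteq> 0" "F k x \<noteq> 0" by auto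
    have "open {v. v \<noteq> 0 \<and> proj_pt v \<in> U}" "x \<in> {v. v \<noteq> 0 \<and> proj_pt v \<in> U}"
      using U x by (auto simp: open_rp2_def)
    then obtain \<delta> where \<delta>: "\<delta> > 0" "\<And>y. dist y x < \<delta> \<Longrightarrow> y \<noteq> 0 \<and> proj_pt y \<in> U" using open_dist
      by (metis (mono_tags, lifting) mem_Collect_eq)
    define r where "r = min \<delta> (min \<bar>F j x\<bar> \<bar>F k x\<bar>) / 2"
    have r: "0 < r" "r < \<delta>" "r < \<bar>F j x\<bar>" "r < \<bar>F k x\<bar>" unfolding r_def using \<delta>(1) nz by auto
    \<comment> \<open>Moving the representative by \<open>t\<close> in its second coordinate adds
      \<open>t\<close> to every \<open>F\<close>. A small shift preserves the signs of
      \<open>F j\<close> and \<open>F k\<close> and gives \<open>F i\<close> the sign that leads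
      into \<open>R\<close>.\<close>
    define t where "t = (if kk * F j x > 0 then r else - r)"
    have t: "\<bar>t\<bar> = r" "t * (kk * F j x) > 0" unfolding t_def using r(1) kpm(3) nz(1) by (auto simp: zero_less_mult_iff)
    define y where "y = x + t *\<^sub>R axis 2 1"
    have "dist y x < \<delta>" unfolding y_def dist_norm using t r by simp
    then have y: "y \<noteq> 0" "proj_pt y \<in> U" using \<delta>(2) by auto
    have Fy: "F i y = t" "F j y = F j x + t" "F k y = F k x + t" unfolding y_def using Fx(1) by (auto simp: F_shift)
    have sj: "F j y * F j x > 0" "F k y * F k x > 0" unfolding Fy using t(1) r(3,4)
      by (auto simp: zero_less_mult_iff abs_if split: if_splits)
    have sgn2: "a' * b' > 0" if "a' * c' > 0" "c' * b' > 0" for a' b' c' :: real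
      using that by (auto simp: zero_less_mult_iff)
    have "(kk * F i y) * F j y > 0"
      using sgn2[of "kk * t" "F j x" "F j y"] t(2) sj(1) unfolding Fy(1) by (simp add: algebra_simps)
    moreover have "(ki * F j y) * F k y > 0"
    proof -
      have "(ki * F k x) * F j x > 0" "F j x * F j y > 0" using Fx(2) sj(1) by (auto simp: algebra_simps)
      then have "(ki * F k x) * F j y > 0" by (rule sgn2)
      then have "(ki * F j y) * F k x > 0" "F k x * F k y > 0" using sj(2) by (auto simp: algebra_simps)
      then show ?thesis by (rule sgn2)
    qed
    ultimately have "proj_pt y \<in> R" unfolding R_def using pos_iff[OF y(1)] by simp
    then show "U \<inter> R \<noteq> {}" using y(2) by blast
  qed
  show ?thesis
  proof (rule recognize_triangle[OF lnA lnd oR Rdisj clR, of K p])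
    show "p \<in> K (wire i)" using p by (simp add: K_def)
    show "p \<in> closure R" by (rule pcl)
    show "connected (K L) \<and> K L \<subseteq> L - vertices (wire ` I) \<and> L \<inter> closure R \<subseteq> K L \<union> vertices (wire ` I)"
      if "L \<in> {wire i, wire j, wire k}" for L
    proof -
      have "L = wire i \<or> L = wire j \<or> L = wire k" using that by simp
      then show ?thesis
      proof (elim disjE)
        assume L: "L = wire i"
        then have KL: "K L = arc i j k u" by (simp add: K_def)
        show ?thesis unfolding KL unfolding L using arc_connected(1)[OF i a(1)] arc_sub[OF i a(1)] cl(1)[unfolded ki_def] by blast
      next
        assume L: "L = wire j"
        then have KL: "K L = arc j i k v" using lnd by (simp add: K_def)
        note ii = i(2,1,3) i(4)[symmetric] i(6,5) a(2)
        show ?thesis unfolding KL unfolding L using arc_connected(1)[OF ii] arc_sub[OF ii] cl(2)[unfolded kj_def] by blast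
      next
        assume L: "L = wire k"
        then have KL: "K L = arc k i j w" using lnd by (simp add: K_def)
        note ii = i(3,1,2) i(5)[symmetric] i(6)[symmetric] i(4) a(3)
        show ?thesis unfolding KL unfolding L using arc_connected(1)[OF ii] arc_sub[OF ii] cl(3)[unfolded kk_def] by blast
      qed
    qed
    show "closure S \<inter> E = {}"
      if E: "E \<in> wire ` I - {wire i, wire j, wire k}" and S: "connected S" "K (wire i) \<subseteq> S" "S \<subseteq> wire i - vertices (wire ` I)" for E S
    proof -
      obtain e where e: "e \<in> I - {i, j, k}" "E = wire e" using E by auto
      have nv: "x \<notin> wire j" "x \<notin> wire k" if "x \<in> S" for x
      proof -
        have "x \<in> wire i" "x \<notin> vertices (wire ` I)" using S(3) that by auto
        then show "x \<notin> wire j" "x \<notin> wire k" using vertices_wire[OF i(1)] i by auto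
      qed
      have "S \<subseteq> pos j k ki \<or> S \<subseteq> pos j k (- ki)"
      proof (rule connected_pick[OF S(1)])
        show "S \<subseteq> pos j k ki \<union> pos j k (- ki)"
        proof
          fix x assume "x \<in> S"
          then show "x \<in> pos j k ki \<union> pos j k (- ki)" using pos_trichotomy[of ki x j k] nv[of x] kpm(1) by auto
        qed
      qed (use open_pos i pos_disj in auto)
      moreover have "p \<in> S" "p \<in> pos j k ki" using S(2) p by (auto simp: K_def arc_def ki_def)
      ultimately have "S \<subseteq> pos j k ki" using pos_disj(1)[of j k ki] by blast
      then have c1: "closure S \<inter> pos j k (- ki) = {}" by (rule closure_pos[OF i(2,3)])
      have "closed (wire i)" using pseudo_line_closed[OF pseudo_line_wire[OF i(1)]] .
      then have c2: "closure S \<subseteq> wire i" using S(3) by (meson Diff_subset closure_minimal order_trans)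
      show ?thesis
      proof (rule ccontr)
        assume "closure S \<inter> E \<noteq> {}"
        then obtain x where x: "x \<in> closure S" "x \<in> wire e" using e(2) by auto
        then have "x \<in> pos j k (- ki)" using arc_vertex[OF i a(1) e(1) _ x(2)] c2 unfolding ki_def by blast
        then show False using c1 x(1) by blast
      qed
    qed
  qed
qed

end

section \<open>Prescribed crossing times\<close>

definition btw :: "real \<Rightarrow> real \<Rightarrow> real \<Rightarrow> bool" where
  "btw a b c \<longleftrightarrow> a < b \<and> b < c \<or> c < b \<and> b < a"

text \<open>Among three straight lines sorted by slope, the crossing of the extreme ones lies
  between the other two. This condition on triples is all that is kept of the geometry.\<close>

definition crossing_times :: "nat set \<Rightarrow> (nat \<Rightarrow> nat \<Rightarrow> real) \<Rightarrow> bool" where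
  "crossing_times I X \<longleftrightarrow> (\<forall>i j. X i j = X j i) \<and>
     (\<forall>i\<in>I. \<forall>j\<in>I. \<forall>k\<in>I. i < j \<longrightarrow> j < k \<longrightarrow> btw (X i j) (X i k) (X j k))"

text \<open>Entry \<open>-1\<close> means that the side on this wire is the arc between the two crossings, entry \<open>1\<close> that
  it is the complementary arc through infinity; a triangle uses an even number of the latter.\<close>

definition adjacent :: "nat set \<Rightarrow> (nat \<Rightarrow> nat \<Rightarrow> real) \<Rightarrow> nat \<Rightarrow> nat \<Rightarrow> nat \<Rightarrow> real \<Rightarrow> bool" where
  "adjacent I X i j k u \<longleftrightarrow> (u = 1 \<or> u = -1) \<and>
     (\<forall>e\<in>I - {i, j, k}. u * (X i e - X i j) * (X i e - X i k) < 0)"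

definition triangle_triple :: "nat set \<Rightarrow> (nat \<Rightarrow> nat \<Rightarrow> real) \<Rightarrow> nat set \<Rightarrow> bool" where
  "triangle_triple I X t \<longleftrightarrow> (\<exists>i j k u v w. t = {i, j, k} \<and> i \<in> I \<and> j \<in> I \<and> k \<in> I \<and>
     i \<noteq> j \<and> i \<noteq> k \<and> j \<noteq> k \<and> adjacent I X i j k u \<and> adjacent I X j i k v \<and> adjacent I X k i j w \<and>
     u * v * w = -1)"

lemma triangle_triple_sub: "triangle_triple I X s \<Longrightarrow> s \<subseteq> I \<and> card s = 3"
  unfolding triangle_triple_def by auto

section \<open>Construction of wires from crossing times\<close>

definition ramp :: "real \<Rightarrow> real" where "ramp u = max 0 (min 1 u)"

lemma ramp_simps: "u \<le> 0 \<Longrightarrow> ramp u = 0" "1 \<le> u \<Longrightarrow> ramp u = 1" "0 \<le> u \<Longrightarrow> u \<le> 1 \<Longrightarrow> ramp u = u"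
  "0 \<le> ramp u" "ramp u \<le> 1" "u \<le> v \<Longrightarrow> ramp u \<le> ramp v"
  by (auto simp: ramp_def)

lemma ramp_half: "u < 1/2 \<Longrightarrow> ramp u < 1/2" "1/2 < u \<Longrightarrow> 1/2 < ramp u"
  by (auto simp: ramp_def)

lemma continuous_on_ramp: "continuous_on S f \<Longrightarrow> continuous_on S (\<lambda>x. ramp (f x))"
  unfolding ramp_def by (intro continuous_intros)

text \<open>The three crossings of a triple occupy unit time slots \<open>[X i j, X i j + 1]\<close>
  that do not overlap; crossings of disjoint pairs may be simultaneous.\<close>

locale gaps =
  fixes I :: "nat set" and X :: "nat \<Rightarrow> nat \<Rightarrow> real" and N :: real
  assumes finI: "finite I" and sym: "\<And>i j. X i j = X j i"
    and gap: "\<And>i j k. i \<in> I \<Longrightarrow> j \<in> I \<Longrightarrow> k \<in> I \<Longrightarrow> i < j \<Longrightarrow> j < k \<Longrightarrow>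
       X i j + 1 \<le> X i k \<and> X i k + 1 \<le> X j k \<or> X j k + 1 \<le> X i k \<and> X i k + 1 \<le> X i j"
    and bnd: "\<And>i j. i \<in> I \<Longrightarrow> j \<in> I \<Longrightarrow> \<bar>X i j\<bar> + 1 \<le> N" and N0: "0 \<le> N"
begin

text \<open>Equal to 1 while wire \<open>k\<close> is below wire \<open>i\<close> and to 0 while it
  is above, with a linear transition in their slot. Wires with smaller labels start below.\<close>

definition t :: "nat \<Rightarrow> nat \<Rightarrow> real \<Rightarrow> real" where
  "t i k x = (if k < i then 1 - ramp (x - X i k) else ramp (x - X i k))"

text \<open>When \<open>X\<close> counts the time slots of the crossings, the sum is the height of wire \<open>i\<close> at time \<open>x\<close>.\<close>

definition g :: "nat \<Rightarrow> real \<Rightarrow> real" where "g i x = (\<Sum>k\<in>I - {i}. t i k x)"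

definition clamp :: "real \<Rightarrow> real" where "clamp x = max (- N) (min x N)"

text \<open>On \<open>[-N, N]\<close>, where all crossings take place, the graph
  \<open>b i x - i x\<close> is just the height \<open>g i x\<close>. Outside, it continues as a
  straight line of slope \<open>-i\<close>, which keeps \<open>b\<close> bounded.\<close>

definition b :: "nat \<Rightarrow> real \<Rightarrow> real" where "b i x = g i x + real i * clamp x"

text \<open>By \<open>gap\<close>, a third wire outside the label range from \<open>i\<close> to
  \<open>j\<close> crosses both before their slot or both after it, and one in between crosses one
  before and the other after. Hence up to the end of the slot it counts at least as much for
  \<open>j\<close> as for \<open>i\<close>, from the beginning of the slot on at most as much, and
  within the slot equally.\<close>

lemma t_diff:
  assumes "i \<in> I" "j \<in> I" "k \<in> I" "i < j" "k \<noteq> i" "k \<noteq> j"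
  shows "x \<le> X i j + 1 \<Longrightarrow> t i k x \<le> t j k x" "X i j \<le> x \<Longrightarrow> t j k x \<le> t i k x"
proof -
  consider "k < i" | "i < k" "k < j" | "j < k" using assms by linarith
  then have "(x \<le> X i j + 1 \<longrightarrow> t i k x \<le> t j k x) \<and> (X i j \<le> x \<longrightarrow> t j k x \<le> t i k x)"
  proof cases
    case 1
    from gap[OF assms(3,1,2) 1 assms(4)] show ?thesis
    proof (elim disjE conjE)
      assume *: "X k i + 1 \<le> X k j" "X k j + 1 \<le> X i j"
      then have "ramp (x - X j k) \<le> ramp (x - X i k)" using sym[of k] by (intro ramp_simps(6)) auto
      moreover have "X i j \<le> x \<Longrightarrow> ramp (x - X j k) = 1 \<and> ramp (x - X i k) = 1"
        using * sym[of k i] sym[of k j] ramp_simps(2)[of "x - X j k"] ramp_simps(2)[of "x - X i k"] by linarith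
      ultimately show ?thesis using 1 assms(4) by (auto simp: t_def)
    next
      assume *: "X i j + 1 \<le> X k j" "X k j + 1 \<le> X k i"
      then have "ramp (x - X i k) \<le> ramp (x - X j k)" using sym[of k] by (intro ramp_simps(6)) auto
      moreover have "x \<le> X i j + 1 \<Longrightarrow> ramp (x - X j k) = 0 \<and> ramp (x - X i k) = 0"
        using * sym[of k i] sym[of k j] ramp_simps(1)[of "x - X j k"] ramp_simps(1)[of "x - X i k"] by linarith
      ultimately show ?thesis using 1 assms(4) by (auto simp: t_def)
    qed
  next
    case 2
    have r: "0 \<le> ramp (x - X i k)" "ramp (x - X i k) \<le> 1" "0 \<le> ramp (x - X j k)" "ramp (x - X j k) \<le> 1"
      by (auto simp: ramp_simps)
    from gap[OF assms(1,3,2) 2] show ?thesis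
    proof (elim disjE conjE)
      assume *: "X i k + 1 \<le> X i j" "X i j + 1 \<le> X k j"
      have "x \<le> X i j + 1 \<Longrightarrow> ramp (x - X j k) = 0" "X i j \<le> x \<Longrightarrow> ramp (x - X i k) = 1"
        using * sym[of k j] ramp_simps(1)[of "x - X j k"] ramp_simps(2)[of "x - X i k"] by linarith+
      then show ?thesis using 2 r by (auto simp: t_def)
    next
      assume *: "X k j + 1 \<le> X i j" "X i j + 1 \<le> X i k"
      have "x \<le> X i j + 1 \<Longrightarrow> ramp (x - X i k) = 0" "X i j \<le> x \<Longrightarrow> ramp (x - X j k) = 1"
        using * sym[of k j] ramp_simps(1)[of "x - X i k"] ramp_simps(2)[of "x - X j k"] by linarith+
      then show ?thesis using 2 r by (auto simp: t_def)
    qed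
  next
    case 3
    from gap[OF assms(1,2,3,4) 3] show ?thesis
    proof (elim disjE conjE)
      assume *: "X i j + 1 \<le> X i k" "X i k + 1 \<le> X j k"
      then have "ramp (x - X j k) \<le> ramp (x - X i k)" by (intro ramp_simps(6)) auto
      moreover have "x \<le> X i j + 1 \<Longrightarrow> ramp (x - X j k) = 0 \<and> ramp (x - X i k) = 0"
        using * ramp_simps(1)[of "x - X j k"] ramp_simps(1)[of "x - X i k"] by linarith
      ultimately show ?thesis using 3 assms(4) by (auto simp: t_def)
    next
      assume *: "X j k + 1 \<le> X i k" "X i k + 1 \<le> X i j"
      then have "ramp (x - X i k) \<le> ramp (x - X j k)" by (intro ramp_simps(6)) auto
      moreover have "X i j \<le> x \<Longrightarrow> ramp (x - X j k) = 1 \<and> ramp (x - X i k) = 1"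
        using * ramp_simps(2)[of "x - X j k"] ramp_simps(2)[of "x - X i k"] by linarith
      ultimately show ?thesis using 3 assms(4) by (auto simp: t_def)
    qed
  qed
  then show "x \<le> X i j + 1 \<Longrightarrow> t i k x \<le> t j k x" "X i j \<le> x \<Longrightarrow> t j k x \<le> t i k x" by auto
qed

text \<open>The contributions of \<open>i\<close> and \<open>j\<close> to each other give
  \<open>1 - 2 * ramp\<close>; those of third wires are compared one by one with
  \<open>t_diff\<close>.\<close>

lemma g_diff:
  assumes "i \<in> I" "j \<in> I" "i < j"
  shows "x \<le> X i j + 1 \<Longrightarrow> g j x - g i x \<ge> 1 - 2 * ramp (x - X i j)"
    "X i j \<le> x \<Longrightarrow> g j x - g i x \<le> 1 - 2 * ramp (x - X i j)"
proof -
  let ?J = "I - {i, j}"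
  have J: "I - {j} = insert i ?J" "I - {i} = insert j ?J" using assms by auto
  have n: "i \<notin> ?J" "j \<notin> ?J" "finite ?J" using finI by auto
  have "g j x = t j i x + (\<Sum>k\<in>?J. t j k x)" unfolding g_def J(1) by (rule sum.insert[OF n(3,1)])
  moreover have "g i x = t i j x + (\<Sum>k\<in>?J. t i k x)" unfolding g_def J(2) by (rule sum.insert[OF n(3,2)])
  moreover have "t j i x - t i j x = 1 - 2 * ramp (x - X i j)" using assms(3) sym[of j i] by (simp add: t_def)
  ultimately have "g j x - g i x = 1 - 2 * ramp (x - X i j) + ((\<Sum>k\<in>?J. t j k x) - (\<Sum>k\<in>?J. t i k x))" by simp
  moreover have "x \<le> X i j + 1 \<Longrightarrow> (\<Sum>k\<in>?J. t i k x) \<le> (\<Sum>k\<in>?J. t j k x)"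
    by (rule sum_mono) (use t_diff(1)[OF assms(1,2) _ assms(3)] in auto)
  moreover have "X i j \<le> x \<Longrightarrow> (\<Sum>k\<in>?J. t j k x) \<le> (\<Sum>k\<in>?J. t i k x)"
    by (rule sum_mono) (use t_diff(2)[OF assms(1,2) _ assms(3)] in auto)
  ultimately show "x \<le> X i j + 1 \<Longrightarrow> g j x - g i x \<ge> 1 - 2 * ramp (x - X i j)"
    "X i j \<le> x \<Longrightarrow> g j x - g i x \<le> 1 - 2 * ramp (x - X i j)" by auto
qed

lemma gap_neq:
  assumes "i \<in> I" "j \<in> I" "k \<in> I" "i \<noteq> j" "i \<noteq> k" "j \<noteq> k"
  shows "X i j \<noteq> X i k"
proof -
  consider "i < j" "j < k" | "i < k" "k < j" | "j < i" "i < k" | "j < k" "k < i" | "k < i" "i < j" | "k < j" "j < i"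
    using assms(4-6) by linarith
  then show ?thesis
  proof cases
    case 1 then show ?thesis using gap[OF assms(1,2,3) 1] by linarith
  next
    case 2 then show ?thesis using gap[OF assms(1,3,2) 2] by linarith
  next
    case 3 then show ?thesis using gap[OF assms(2,1,3) 3] sym[of j i] by linarith
  next
    case 4 then show ?thesis using gap[OF assms(2,3,1) 4] sym[of j i] sym[of k i] by linarith
  next
    case 5 then show ?thesis using gap[OF assms(3,1,2) 5] sym[of k i] by linarith
  next
    case 6 then show ?thesis using gap[OF assms(3,2,1) 6] sym[of j i] sym[of k i] by linarith
  qed
qed

text \<open>Wires cross in the middle of their slot, hence the \<open>1/2\<close>. Within the slot
  the height difference is linear with slope 2 in absolute value, as \<open>lin\<close>
  demands.\<close>

lemma wires: "wires I b (\<lambda>i j. X i j + 1/2)"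
proof
  show "finite I" by (rule finI)
  show "continuous_on UNIV (b i)" for i
  proof -
    have "continuous_on UNIV (\<lambda>x. t i k x)" for k unfolding t_def
      by (cases "k < i") (auto intro!: continuous_intros continuous_on_ramp)
    then show ?thesis unfolding b_def g_def clamp_def by (intro continuous_intros)
  qed
  show "\<exists>B. \<forall>x. \<bar>b i x\<bar> \<le> B" for i
  proof (intro exI allI)
    fix x
    have "0 \<le> t i k x" "t i k x \<le> 1" for k by (auto simp: t_def ramp_simps)
    then have "0 \<le> g i x" "g i x \<le> real (card (I - {i})) * 1"
      unfolding g_def using sum_bounded_above[of "I - {i}" "\<lambda>k. t i k x" 1] by (auto intro!: sum_nonneg)
    moreover have "\<bar>clamp x\<bar> \<le> N" unfolding clamp_def using N0 by auto
    then have "\<bar>real i * clamp x\<bar> \<le> real i * N" by (simp add: abs_mult mult_left_mono)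
    ultimately show "\<bar>b i x\<bar> \<le> real (card (I - {i})) + real i * N" unfolding b_def by linarith
  qed
  show "X i j + 1/2 = X j i + 1/2" for i j using sym by simp
  fix i j x assume ij: "i \<in> I" "j \<in> I" "i < j"
  have bn: "\<bar>X i j\<bar> + 1 \<le> N" using bnd ij by blast
  have D: "(b i x - real i * x) - (b j x - real j * x) = - (g j x - g i x) + (real j - real i) * (x - clamp x)"
    unfolding b_def by (simp add: algebra_simps)
  have ji: "real j - real i > 0" using ij(3) by simp
  {
    assume "\<bar>x - (X i j + 1/2)\<bar> \<le> 1/2"
    then have x: "X i j \<le> x" "x \<le> X i j + 1" by linarith+
    then have "g j x - g i x = 1 - 2 * ramp (x - X i j)" using g_diff[OF ij] by (simp add: order_antisym)
    moreover have "ramp (x - X i j) = x - X i j" using x by (intro ramp_simps(3)) auto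
    moreover have "clamp x = x" unfolding clamp_def using x bn by auto
    ultimately show "(b i x - real i * x) - (b j x - real j * x) = 2 * (x - (X i j + 1/2))" unfolding D by simp
  next
    assume x: "x < X i j + 1/2"
    then have "g j x - g i x > 0" using g_diff(1)[OF ij, of x] ramp_half(1)[of "x - X i j"] by linarith
    moreover have "x - clamp x \<le> 0" unfolding clamp_def using x bn by auto
    then have "(real j - real i) * (x - clamp x) \<le> 0" using ji by (simp add: mult_nonneg_nonpos)
    ultimately show "b i x - real i * x < b j x - real j * x" using D by linarith
  next
    assume x: "X i j + 1/2 < x"
    then have "g j x - g i x < 0" using g_diff(2)[OF ij, of x] ramp_half(2)[of "x - X i j"] by linarith
    moreover have "x - clamp x \<ge> 0" unfolding clamp_def using x bn by auto
    then have "(real j - real i) * (x - clamp x) \<ge> 0" using ji by simp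
    ultimately show "b j x - real j * x < b i x - real i * x" using D by linarith
  }
next
  fix i j k assume "i \<in> I" "j \<in> I" "k \<in> I" "i \<noteq> j" "i \<noteq> k" "j \<noteq> k"
  then show "X i j + 1/2 \<noteq> X i k + 1/2" using gap_neq by simp
qed

text \<open>Different triples yield different triangles, since the lines that carry the sides
  determine the triple.\<close>

lemma realize_gaps:
  assumes n: "4 \<le> card I" and Tr: "\<And>s. s \<in> Tr \<Longrightarrow> triangle_triple I X s"
  shows "\<exists>A. simple_arrangement (card I) A \<and> card Tr \<le> p3 A"
proof -
  interpret W: wires I b "\<lambda>i j. X i j + 1/2" by (rule wires)
  interpret arrangement "W.wire ` I" "card I" by (rule arrangement.intro[OF W.simple_arrangement_wire n])
  have adj: "W.adj i j k u" if "adjacent I X i j k u" for i j k u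
    using that unfolding W.adj_def adjacent_def by simp
  have "\<exists>P. tri P \<and> (\<forall>L\<in>W.wire ` I. (\<exists>s\<in>sides (W.wire ` I) P. s \<subseteq> L) \<longleftrightarrow> L \<in> W.wire ` s)" if s: "s \<in> Tr" for s
  proof -
    obtain i j k u v w where *: "s = {i, j, k}" "i \<in> I" "j \<in> I" "k \<in> I" "i \<noteq> j" "i \<noteq> k" "j \<noteq> k"
      "adjacent I X i j k u" "adjacent I X j i k v" "adjacent I X k i j w" "u * v * w = -1"
      using Tr[OF s] unfolding triangle_triple_def by auto
    have "W.wire ` s = {W.wire i, W.wire j, W.wire k}" using *(1) by simp
    then show ?thesis using W.wires_triangle[OF n *(2-7) adj[OF *(8)] adj[OF *(9)] adj[OF *(10)] *(11)] by simp
  qed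
  then obtain P where P: "\<And>s. s \<in> Tr \<Longrightarrow> tri (P s) \<and>
      (\<forall>L\<in>W.wire ` I. (\<exists>r\<in>sides (W.wire ` I) (P s). r \<subseteq> L) \<longleftrightarrow> L \<in> W.wire ` s)" by metis
  have sub: "s \<subseteq> I" if "s \<in> Tr" for s using triangle_triple_sub[OF Tr[OF that]] by simp
  have "inj_on P Tr"
  proof (rule inj_onI)
    fix s r assume sr: "s \<in> Tr" "r \<in> Tr" "P s = P r"
    then have "L \<in> W.wire ` s \<longleftrightarrow> L \<in> W.wire ` r" if "L \<in> W.wire ` I" for L using P[OF sr(1)] P[OF sr(2)] that by auto
    then have "W.wire ` s = W.wire ` r" using sub[OF sr(1)] sub[OF sr(2)] by blast
    then show "s = r" using inj_on_image_eq_iff[OF W.wire_inj sub[OF sr(1)] sub[OF sr(2)]] by simp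
  qed
  moreover have "P ` Tr \<subseteq> {P. tri P}" using P by auto
  ultimately have "card Tr \<le> card {P. tri P}" using finite_tri by (metis card_inj_on_le)
  then show ?thesis using W.simple_arrangement_wire p3_eq_card_tri by auto
qed

end

text \<open>Only the order of the times matters, so they may be divided by the smallest positive
  difference, after which distinct times are at least 1 apart.\<close>

theorem realize:
  assumes fin: "finite I" and n: "4 \<le> card I" and X: "crossing_times I X"
    and Tr: "\<And>s. s \<in> Tr \<Longrightarrow> triangle_triple I X s"
  shows "\<exists>A. simple_arrangement (card I) A \<and> card Tr \<le> p3 A"
proof -
  \<comment> \<open>The element 1 makes the set nonempty, so that the minimum exists.\<close>
  let ?D = "insert 1 {d. 0 < d \<and> (\<exists>i\<in>I. \<exists>j\<in>I. \<exists>k\<in>I. \<exists>l\<in>I. d = X i j - X k l)}"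
  have "{d. 0 < d \<and> (\<exists>i\<in>I. \<exists>j\<in>I. \<exists>k\<in>I. \<exists>l\<in>I. d = X i j - X k l)} \<subseteq>
      (\<lambda>(i, j, k, l). X i j - X k l) ` (I \<times> I \<times> I \<times> I)"
  proof
    fix d assume "d \<in> {d. 0 < d \<and> (\<exists>i\<in>I. \<exists>j\<in>I. \<exists>k\<in>I. \<exists>l\<in>I. d = X i j - X k l)}"
    then obtain i j k l where "i \<in> I" "j \<in> I" "k \<in> I" "l \<in> I" "d = X i j - X k l" by auto
    then show "d \<in> (\<lambda>(i, j, k, l). X i j - X k l) ` (I \<times> I \<times> I \<times> I)"
      by (intro image_eqI[of _ _ "(i, j, k, l)"]) auto
  qed
  then have finD: "finite ?D" using fin by (intro finite.insertI) (rule finite_subset, auto)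
  define \<epsilon> where "\<epsilon> = Min ?D"
  have e: "\<epsilon> \<in> ?D" unfolding \<epsilon>_def by (rule Min_in[OF finD]) simp
  have emin: "\<epsilon> \<le> d" if "d \<in> ?D" for d unfolding \<epsilon>_def by (rule Min_le[OF finD that])
  have e0: "0 < \<epsilon>" using e by auto
  define c where "c = 1 / \<epsilon>"
  have c: "c > 0" using e0 by (simp add: c_def)
  define Y where "Y i j = c * X i j" for i j
  have stp: "Y i j + 1 \<le> Y k l" if "i \<in> I" "j \<in> I" "k \<in> I" "l \<in> I" "X i j < X k l" for i j k l
  proof -
    have "\<epsilon> \<le> X k l - X i j" using that by (intro emin) auto
    then have "c * \<epsilon> \<le> c * (X k l - X i j)" using c by simp
    then show ?thesis using e0 by (simp add: Y_def c_def algebra_simps)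
  qed
  let ?B = "(\<lambda>(i, j). \<bar>Y i j\<bar>) ` (I \<times> I)"
  define N where "N = Max (insert 0 ?B) + 1"
  have finB: "finite (insert 0 ?B)" using fin by simp
  have bn: "\<bar>Y i j\<bar> + 1 \<le> N" if "i \<in> I" "j \<in> I" for i j
  proof -
    have "\<bar>Y i j\<bar> \<in> insert 0 ?B" using that by force
    then show ?thesis unfolding N_def using Max_ge[OF finB] by simp
  qed
  have N0: "0 \<le> N" unfolding N_def using Max_ge[OF finB, of 0] by simp
  have sym: "X i j = X j i" for i j using X unfolding crossing_times_def by blast
  interpret gaps I Y N
  proof
    show "Y i j = Y j i" for i j using sym[of i j] by (simp add: Y_def)
    fix i j k assume *: "i \<in> I" "j \<in> I" "k \<in> I" "i < j" "j < k"
    then have "btw (X i j) (X i k) (X j k)" using X unfolding crossing_times_def by blast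
    then show "Y i j + 1 \<le> Y i k \<and> Y i k + 1 \<le> Y j k \<or> Y j k + 1 \<le> Y i k \<and> Y i k + 1 \<le> Y i j"
      unfolding btw_def using stp * by meson
  qed (use fin bn N0 in auto)
  have adjY: "adjacent I Y i j k u" if "adjacent I X i j k u" for i j k u
  proof -
    have "u * (Y i e - Y i j) * (Y i e - Y i k) < 0" if "u * (X i e - X i j) * (X i e - X i k) < 0" for e
    proof -
      have "u * (Y i e - Y i j) * (Y i e - Y i k) = c\<^sup>2 * (u * (X i e - X i j) * (X i e - X i k))"
        unfolding Y_def by (simp add: power2_eq_square algebra_simps)
      moreover have "c\<^sup>2 * (u * (X i e - X i j) * (X i e - X i k)) < 0"
        by (rule mult_pos_neg) (use that c in auto)
      ultimately show ?thesis by (simp only:)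
    qed
    then show ?thesis using that unfolding adjacent_def by blast
  qed
  have "triangle_triple I Y s" if sT: "s \<in> Tr" for s
  proof -
    obtain i j k u v w where *: "s = {i, j, k}" "i \<in> I" "j \<in> I" "k \<in> I" "i \<noteq> j" "i \<noteq> k" "j \<noteq> k"
      "adjacent I X i j k u" "adjacent I X j i k v" "adjacent I X k i j w" "u * v * w = -1"
      using Tr[OF sT] unfolding triangle_triple_def by (elim exE conjE) (rule that)
    show ?thesis unfolding triangle_triple_def
      by (intro exI[of _ i] exI[of _ j] exI[of _ k] exI[of _ u] exI[of _ v] exI[of _ w] conjI)
        (fact * adjY[OF *(8)] adjY[OF *(9)] adjY[OF *(10)])+
  qed
  then show ?thesis by (rule realize_gaps[OF n])
qed

section \<open>Realizable triangle counts and deletion of a line\<close>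

definition realizable :: "nat \<Rightarrow> nat \<Rightarrow> bool" where
  "realizable n t \<longleftrightarrow> (\<exists>I X Tr. finite I \<and> card I = n \<and> crossing_times I X \<and>
     (\<forall>s\<in>Tr. triangle_triple I X s) \<and> t \<le> card Tr)"

lemma realizable_arrangement:
  assumes "realizable n t" "4 \<le> n" shows "\<exists>A. simple_arrangement n A \<and> t \<le> p3 A"
proof -
  from assms(1) obtain I X Tr where I: "finite I" "card I = n" "crossing_times I X"
      "\<forall>s\<in>Tr. triangle_triple I X s" "t \<le> card Tr" unfolding realizable_def by blast
  then obtain A where "simple_arrangement (card I) A" "card Tr \<le> p3 A"
    using realize[OF I(1) _ I(3), of Tr] assms(2) by blast
  then show ?thesis using I(2,5) by (intro exI[of _ A]) simp
qed

text \<open>Deleting wires outside the triple only removes crossings from the complementary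
  arcs.\<close>

lemma triangle_triple_subset:
  assumes "triangle_triple I X s" "J \<subseteq> I" "s \<subseteq> J" shows "triangle_triple J X s"
proof -
  have "adjacent J X i j k u" if "adjacent I X i j k u" for i j k u
    using that assms(2) unfolding adjacent_def by blast
  moreover obtain i j k u v w where "s = {i, j, k}" "i \<noteq> j" "i \<noteq> k" "j \<noteq> k"
      "adjacent I X i j k u" "adjacent I X j i k v" "adjacent I X k i j w" "u * v * w = -1"
    using assms(1) unfolding triangle_triple_def by auto
  moreover have "i \<in> J" "j \<in> J" "k \<in> J" using assms(3) calculation(2) by auto
  ultimately show ?thesis unfolding triangle_triple_def
    by (intro exI[of _ i] exI[of _ j] exI[of _ k] exI[of _ u] exI[of _ v] exI[of _ w]) auto
qed

text \<open>By double counting, some line lies on at most \<open>d\<close> of the triangles.\<close>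

lemma realizable_delete:
  assumes "realizable n t" "1 \<le> n" "3 * t \<le> n * d + c" "c < n"
  shows "realizable (n - 1) (t - d)"
proof -
  obtain I X Tr0 where I: "finite I" "card I = n" "crossing_times I X" "\<And>s. s \<in> Tr0 \<Longrightarrow> triangle_triple I X s" "t \<le> card Tr0"
    using assms(1) unfolding realizable_def by blast
  have "Tr0 \<subseteq> Pow I" using triangle_triple_sub[OF I(4)] by auto
  then have "finite Tr0" using I(1) finite_subset by blast
  then obtain Tr where Tr: "Tr \<subseteq> Tr0" "card Tr = t" "finite Tr" using I(5) obtain_subset_with_card_n by metis
  have sub: "s \<subseteq> I \<and> card s = 3" if "s \<in> Tr" for s
    using triangle_triple_sub[OF I(4)] Tr(1) that by auto
  have "(\<Sum>a\<in>I. card {s \<in> Tr. a \<in> s}) = (\<Sum>s\<in>Tr. card {a \<in> I. a \<in> s})"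
    using I(1) Tr(3) by (intro sum_multicount_gen) auto
  also have "\<dots> = (\<Sum>s\<in>Tr. 3)"
  proof (rule sum.cong[OF refl])
    fix s assume "s \<in> Tr"
    then have "{a \<in> I. a \<in> s} = s" "card s = 3" using sub by auto
    then show "card {a \<in> I. a \<in> s} = 3" by simp
  qed
  finally have tot: "(\<Sum>a\<in>I. card {s \<in> Tr. a \<in> s}) = 3 * t" using Tr(2) by simp
  have "\<exists>a\<in>I. card {s \<in> Tr. a \<in> s} \<le> d"
  proof (rule ccontr)
    assume "\<not> (\<exists>a\<in>I. card {s \<in> Tr. a \<in> s} \<le> d)"
    then have "(\<Sum>a\<in>I. d + 1) \<le> (\<Sum>a\<in>I. card {s \<in> Tr. a \<in> s})" by (intro sum_mono) auto
    then have "n * d + n \<le> 3 * t" using tot I(2) by simp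
    then show False using assms(3,4) by linarith
  qed
  then obtain a where a: "a \<in> I" "card {s \<in> Tr. a \<in> s} \<le> d" by blast
  define Tr' where "Tr' = {s \<in> Tr. a \<notin> s}"
  have "Tr = Tr' \<union> {s \<in> Tr. a \<in> s}" unfolding Tr'_def by auto
  then have "t \<le> card Tr' + card {s \<in> Tr. a \<in> s}" using Tr(2) card_Un_le by metis
  then have "t - d \<le> card Tr'" using a(2) by linarith
  moreover have "crossing_times (I - {a}) X" using I(3) unfolding crossing_times_def by (meson DiffD1)
  moreover have "triangle_triple (I - {a}) X s" if "s \<in> Tr'" for s
  proof -
    have s: "s \<in> Tr" "a \<notin> s" using that by (auto simp: Tr'_def)
    then have "s \<subseteq> I - {a}" using sub by blast
    moreover have "triangle_triple I X s" using I(4) Tr(1) s(1) by blast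
    ultimately show ?thesis by (meson Diff_subset triangle_triple_subset)
  qed
  moreover have "finite (I - {a})" "card (I - {a}) = n - 1" using I a by auto
  ultimately show ?thesis unfolding realizable_def
    by (intro exI[of _ "I - {a}"] exI[of _ X] exI[of _ Tr']) simp
qed

section \<open>Doubling\<close>

definition consec :: "nat \<Rightarrow> (nat \<Rightarrow> nat \<Rightarrow> real) \<Rightarrow> nat \<Rightarrow> nat \<Rightarrow> nat \<Rightarrow> bool" where
  "consec M X i j k \<longleftrightarrow> (\<forall>e\<in>{1..M} - {i, j, k}. \<not> btw (X i j) (X i e) (X i k))"

text \<open>All three sides avoid infinity here, so these are the triangles off the line at
  infinity; the ones along it are governed by \<open>alternating\<close>.\<close>

definition tri3 :: "nat \<Rightarrow> (nat \<Rightarrow> nat \<Rightarrow> real) \<Rightarrow> nat \<Rightarrow> nat \<Rightarrow> nat \<Rightarrow> bool" where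
  "tri3 M X i j k \<longleftrightarrow> i \<in> {1..M} \<and> j \<in> {1..M} \<and> k \<in> {1..M} \<and> i \<noteq> j \<and> i \<noteq> k \<and> j \<noteq> k \<and>
     consec M X i j k \<and> consec M X j i k \<and> consec M X k i j"

definition tris :: "nat \<Rightarrow> (nat \<Rightarrow> nat \<Rightarrow> real) \<Rightarrow> nat set set" where
  "tris M X = {t. \<exists>i j k. t = {i, j, k} \<and> tri3 M X i j k}"

text \<open>Every segment of the line at infinity is a side of a triangle, alternately on its two sides.\<close>

definition alternating :: "nat \<Rightarrow> (nat \<Rightarrow> nat \<Rightarrow> real) \<Rightarrow> bool" where
  "alternating M X \<longleftrightarrow>
     (\<forall>i\<in>{1..<M}. \<forall>e\<in>{1..M} - {i, i + 1}.
        if even i then X i (i + 1) < X i e \<and> X i (i + 1) < X (i + 1) e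
        else X i e < X i (i + 1) \<and> X (i + 1) e < X i (i + 1)) \<and>
     (\<forall>e\<in>{1<..<M}. X 1 M < X 1 e \<and> X M e < X 1 M)"

lemma alternatingD:
  assumes "alternating M X" "1 \<le> i" "i < M" "e \<in> {1..M} - {i, i + 1}"
  shows "even i \<Longrightarrow> X i (i + 1) < X i e" "even i \<Longrightarrow> X i (i + 1) < X (i + 1) e"
    "odd i \<Longrightarrow> X i e < X i (i + 1)" "odd i \<Longrightarrow> X (i + 1) e < X i (i + 1)"
proof -
  have "\<forall>e\<in>{1..M} - {i, i + 1}. if even i then X i (i + 1) < X i e \<and> X i (i + 1) < X (i + 1) e
        else X i e < X i (i + 1) \<and> X (i + 1) e < X i (i + 1)"
    by (rule bspec[OF conjunct1[OF assms(1)[unfolded alternating_def]]]) (use assms in simp)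
  from bspec[OF this assms(4)]
  show "even i \<Longrightarrow> X i (i + 1) < X i e" "even i \<Longrightarrow> X i (i + 1) < X (i + 1) e"
    "odd i \<Longrightarrow> X i e < X i (i + 1)" "odd i \<Longrightarrow> X (i + 1) e < X i (i + 1)" by (auto split: if_splits)
qed

definition scheme :: "nat \<Rightarrow> nat \<Rightarrow> bool" where
  "scheme M d \<longleftrightarrow> odd M \<and> 3 \<le> M \<and> (\<exists>X. crossing_times {1..M} X \<and> alternating M X \<and>
     M * (M + 1) \<le> 3 * (card (tris M X) + M) + d)"

text \<open>A monotone compression of all old crossing times into \<open>(-1, 1)\<close>, which
  leaves room for the crossings of old wires with new ones before and after.\<close>

definition squash :: "real \<Rightarrow> real" where "squash x = x / (1 + \<bar>x\<bar>)"

lemma squash_less [simp]: "squash x < squash y \<longleftrightarrow> x < y"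
proof -
  have mono: "squash a < squash b" if "a < b" for a b
  proof -
    have p: "0 < 1 + \<bar>a\<bar>" "0 < 1 + \<bar>b\<bar>" by auto
    have "a * (1 + \<bar>b\<bar>) < b * (1 + \<bar>a\<bar>)"
    proof (cases "a * b > 0")
      case True
      then have "a * \<bar>b\<bar> = b * \<bar>a\<bar>" by (auto simp: zero_less_mult_iff abs_if)
      then show ?thesis using that by (simp add: algebra_simps)
    next
      case False
      then have "a \<le> 0" "0 \<le> b" using that by (auto simp: zero_less_mult_iff not_less)
      then have "a * \<bar>b\<bar> \<le> 0" "0 \<le> b * \<bar>a\<bar>" by (auto simp: mult_nonpos_nonneg mult_nonneg_nonpos)
      then show ?thesis using that by (simp add: algebra_simps)
    qed
    then show ?thesis unfolding squash_def using p by (simp add: divide_less_eq less_divide_eq mult.commute)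
  qed
  show ?thesis using mono[of x y] mono[of y x] by (metis linorder_neqE_linordered_idom less_asym less_irrefl)
qed

lemma squash_bounds: "-1 < squash x" "squash x < 1"
  unfolding squash_def by (auto simp: divide_less_eq less_divide_eq abs_if)

locale doubling =
  fixes M :: nat and X :: "nat \<Rightarrow> nat \<Rightarrow> real"
  assumes oddM: "odd M" and M3: "3 \<le> M" and ct: "crossing_times {1..M} X" and alt: "alternating M X"
begin

text \<open>Old wires get odd labels, new wires even labels. The new wires imitate the sides of a regular
  \<open>M\<close>-gon and the old wires lines through its centre: wires \<open>a\<close> and \<open>b\<close> meet at time
  \<open>(a - M)\<^sup>3 + (b - M)\<^sup>3\<close>, and an old wire meets \<open>a\<close> where the mirror image of \<open>a\<close> would.\<close>

definition q :: "nat \<Rightarrow> nat \<Rightarrow> int" where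
  "q a e = (if even e then int e - int M else if a < e then int e - int a - int M else int e - int a + int M)"

definition XE :: "nat \<Rightarrow> nat \<Rightarrow> int" where
  "XE a e = (int a - int M) ^ 3 + q a e ^ 3"

definition Y :: "nat \<Rightarrow> nat \<Rightarrow> real" where
  "Y a b = (if even a then real_of_int (XE a b) else if even b then real_of_int (XE b a)
     else squash (X ((a + 1) div 2) ((b + 1) div 2)))"

lemma Xsym: "X i j = X j i"
  using ct by (auto simp: crossing_times_def)

lemma cube_less [simp]: "(x::int) ^ 3 < y ^ 3 \<longleftrightarrow> x < y"
proof -
  have m: "a ^ 3 < b ^ 3" if "a < b" for a b :: int
  proof -
    have "4 * (b ^ 3 - a ^ 3) = (b - a) * ((b - a)\<^sup>2 + 3 * (a + b)\<^sup>2)"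
      by (simp add: power3_eq_cube power2_eq_square algebra_simps)
    moreover have "0 < (b - a) * ((b - a)\<^sup>2 + 3 * (a + b)\<^sup>2)"
      by (rule mult_pos_pos) (use that in \<open>auto simp: add_pos_nonneg\<close>)
    ultimately have "0 < 4 * (b ^ 3 - a ^ 3)" by (simp only:)
    then show ?thesis by simp
  qed
  show ?thesis using m[of x y] m[of y x] by (metis linorder_neqE_linordered_idom less_asym less_irrefl)
qed

lemma cube_sum_pos: "(x::int) + y \<ge> 1 \<Longrightarrow> x ^ 3 + y ^ 3 \<ge> 1"
proof -
  assume "x + y \<ge> 1"
  then have "(1 - y) ^ 3 \<le> x ^ 3" using cube_less[of x "1 - y"] by linarith
  moreover have "(1 - y) ^ 3 + y ^ 3 = 1 + 3 * (y * (y - 1))" by (simp add: power3_eq_cube algebra_simps)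
  moreover have "y * (y - 1) \<ge> 0" by (cases "y \<ge> 1") (auto simp: mult_nonpos_nonpos)
  ultimately show ?thesis by linarith
qed

lemma cube_sum_neg: "(x::int) + y \<le> -1 \<Longrightarrow> x ^ 3 + y ^ 3 \<le> -1"
  using cube_sum_pos[of "-x" "-y"] by (simp add: power3_eq_cube)

lemma Ysym: "Y a b = Y b a"
  unfolding Y_def XE_def q_def using Xsym by auto

lemma Y_even: "even a \<Longrightarrow> Y a b = real_of_int (XE a b)"
  by (simp add: Y_def)

lemma Y_odd: "odd a \<Longrightarrow> even b \<Longrightarrow> Y a b = real_of_int (XE b a)"
  by (simp add: Y_def)

lemma Y_old: "odd a \<Longrightarrow> odd b \<Longrightarrow> Y a b = squash (X ((a + 1) div 2) ((b + 1) div 2))"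
  by (simp add: Y_def)

lemma Y_even_less: "even a \<Longrightarrow> Y a b < Y a c \<longleftrightarrow> q a b < q a c"
  by (simp add: Y_even XE_def of_int_power[symmetric] del: of_int_power)

lemma label: "a \<in> {1..2*M-1} \<Longrightarrow> 1 \<le> a \<and> a < 2 * M"
  using M3 by auto

text \<open>On an old wire the crossings come in three blocks: new wires with smaller label at times
  up to -1, the old wires within \<open>(-1, 1)\<close>, and new wires with larger label from time 1
  on.\<close>

lemma old_left: "odd a \<Longrightarrow> even c \<Longrightarrow> c < a \<Longrightarrow> a < 2 * M \<Longrightarrow> Y a c \<le> -1"
proof -
  assume *: "odd a" "even c" "c < a" "a < 2 * M"
  have "XE c a \<le> -1" unfolding XE_def using * by (intro cube_sum_neg) (auto simp: q_def)
  then show ?thesis using * by (simp add: Y_odd)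
qed

lemma old_right: "odd a \<Longrightarrow> even c \<Longrightarrow> a < c \<Longrightarrow> Y a c \<ge> 1"
proof -
  assume *: "odd a" "even c" "a < c"
  then have "1 \<le> a" by (cases a) auto
  then have "XE c a \<ge> 1" unfolding XE_def using * by (intro cube_sum_pos) (auto simp: q_def)
  then show ?thesis using * by (simp add: Y_odd)
qed

lemma old_mid: "odd a \<Longrightarrow> odd c \<Longrightarrow> -1 < Y a c \<and> Y a c < 1"
  by (simp add: Y_old squash_bounds)

text \<open>Compares two crossings on an old wire, for which the cubed terms have the same sum
  \<open>S\<close>. Linear terms would put all these crossings at one time; with cubes their order
  can be read off from the signs of the factors.\<close>

lemma cube_diff:
  fixes x y S :: int
  shows "(x ^ 3 + (S - x) ^ 3) - (y ^ 3 + (S - y) ^ 3) = 3 * S * ((y - x) * (S - x - y))"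
  by (simp add: power3_eq_cube algebra_simps)

lemma left_diff:
  assumes "odd a" "even c" "even e" "c < a" "e < a"
  shows "Y a c - Y a e = real_of_int (3 * (int a - 2 * int M) * ((int e - int c) * (int a - int c - int e)))"
proof -
  have "XE c a - XE e a = 3 * (int a - 2 * int M) * ((int e - int c) * (int a - int c - int e))"
    using cube_diff[of "int c - int M" "int a - 2 * int M" "int e - int M"] assms
    by (simp add: XE_def q_def algebra_simps)
  then show ?thesis using assms by (simp add: Y_odd flip: of_int_diff)
qed

lemma right_diff:
  assumes "odd a" "even c" "even e" "a < c" "a < e"
  shows "Y a c - Y a e = real_of_int (3 * int a * ((int e - int c) * (int a + 2 * int M - int c - int e)))"
proof -
  have "XE c a - XE e a = 3 * int a * ((int e - int c) * (int a + 2 * int M - int c - int e))"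
    using cube_diff[of "int c - int M" "int a" "int e - int M"] assms
    by (simp add: XE_def q_def algebra_simps)
  then show ?thesis using assms by (simp add: Y_odd flip: of_int_diff)
qed

lemma old_index:
  assumes "odd a" "1 \<le> a" "a < 2 * M"
  shows "(a + 1) div 2 \<in> {1..M}" "a = 2 * ((a + 1) div 2) - 1"
  using assms by (auto elim!: oddE)

text \<open>There are eight parity patterns. In the delicate ones a single old wire has the smallest
  or the largest label, and the order depends on the sign of \<open>a + 2 * M - b - c\<close> or of
  \<open>c - a - b\<close>, which is nonzero by parity.\<close>

lemma crossing_times_Y: "crossing_times {1..2*M-1} Y"
  unfolding crossing_times_def
proof (intro conjI allI ballI impI)
  show "Y a b = Y b a" for a b by (rule Ysym)
  fix a b c assume "a \<in> {1..2*M-1}" "b \<in> {1..2*M-1}" "c \<in> {1..2*M-1}" and abc: "a < b" "b < c"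
  then have r: "1 \<le> a" "c < 2 * M" using label by auto
  consider "even a" "even b" "even c" | "odd a" "odd b" "odd c"
    | "odd a" "even b" "even c" | "even a" "odd b" "even c" | "even a" "even b" "odd c"
    | "even a" "odd b" "odd c" | "odd a" "even b" "odd c" | "odd a" "odd b" "even c" by blast
  then show "btw (Y a b) (Y a c) (Y b c)"
  proof cases
    case 1
    then have "Y a b < Y a c" "Y c a < Y c b" using abc by (simp_all add: Y_even_less q_def)
    then show ?thesis using Ysym[of c] by (simp add: btw_def)
  next
    case 2
    let ?h = "\<lambda>x. (x + 1) div 2"
    have "?h a < ?h b" "?h b < ?h c" using 2 abc by (auto elim!: oddE)
    moreover have "?h a \<in> {1..M}" "?h b \<in> {1..M}" "?h c \<in> {1..M}" using old_index(1) 2 abc r by auto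
    ultimately have "btw (X (?h a) (?h b)) (X (?h a) (?h c)) (X (?h b) (?h c))"
      using ct unfolding crossing_times_def by blast
    then show ?thesis using 2 by (simp add: btw_def Y_old)
  next
    case 3
    have s: "Y b c < Y b a \<longleftrightarrow> b + c < a + 2 * M" "Y c b < Y c a \<longleftrightarrow> b + c < a + 2 * M"
       "Y b a < Y b c \<longleftrightarrow> a + 2 * M < b + c" "Y c a < Y c b \<longleftrightarrow> a + 2 * M < b + c"
      using 3 abc by (auto simp: Y_even_less q_def)
    have d: "Y a b - Y a c = real_of_int (3 * int a * ((int c - int b) * (int a + 2 * int M - int b - int c)))"
      using right_diff[of a b c] 3 abc by simp
    have "a + 2 * M \<noteq> b + c" using 3 by (metis even_add even_mult_iff dvd_refl)
    then consider "b + c < a + 2 * M" | "a + 2 * M < b + c" by linarith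
    then show ?thesis
    proof cases
      case 1
      then have "3 * int a * ((int c - int b) * (int a + 2 * int M - int b - int c)) > 0" using abc r by (intro mult_pos_pos) auto
      then have "Y a c < Y a b" using d by linarith
      then show ?thesis using s 1 Ysym[of b c] Ysym[of a c] Ysym[of a b] by (simp add: btw_def)
    next
      case 2
      then have "(int c - int b) * (int a + 2 * int M - int b - int c) < 0" using abc by (intro mult_pos_neg) auto
      then have "3 * int a * ((int c - int b) * (int a + 2 * int M - int b - int c)) < 0"
        using r by (intro mult_pos_neg[of "3 * int a"]) auto
      then have "Y a b < Y a c" using d by linarith
      then show ?thesis using s 2 Ysym[of b c] Ysym[of a c] Ysym[of a b] by (simp add: btw_def)
    qed
  next
    case 4
    then have "Y a b < Y a c" "Y c a < Y c b" using abc r by (auto simp: Y_even_less q_def)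
    then show ?thesis using Ysym[of c] by (simp add: btw_def)
  next
    case 5
    have s: "Y a b < Y a c \<longleftrightarrow> a + b < c" "Y b a < Y b c \<longleftrightarrow> a + b < c"
       "Y a c < Y a b \<longleftrightarrow> c < a + b" "Y b c < Y b a \<longleftrightarrow> c < a + b"
      using 5 abc by (auto simp: Y_even_less q_def)
    have d: "Y c a - Y c b = real_of_int (3 * (int c - 2 * int M) * ((int b - int a) * (int c - int a - int b)))"
      using left_diff[of c a b] 5 abc by simp
    have "c \<noteq> a + b" using 5 by auto
    then consider "a + b < c" | "c < a + b" by linarith
    then show ?thesis
    proof cases
      case 1
      then have "(int b - int a) * (int c - int a - int b) > 0" using abc by (intro mult_pos_pos) auto
      then have "3 * (int c - 2 * int M) * ((int b - int a) * (int c - int a - int b)) < 0" using r by (intro mult_neg_pos[of "3 * (int c - 2 * int M)"]) auto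
      then have "Y c a < Y c b" using d by linarith
      then show ?thesis using s 1 Ysym[of c] by (simp add: btw_def)
    next
      case 2
      then have "(int b - int a) * (int c - int a - int b) < 0" using abc by (intro mult_pos_neg) auto
      then have "3 * (int c - 2 * int M) * ((int b - int a) * (int c - int a - int b)) > 0" using r by (intro mult_neg_neg[of "3 * (int c - 2 * int M)"]) auto
      then have "Y c b < Y c a" using d by linarith
      then show ?thesis using s 2 Ysym[of c] Ysym[of a b] by (simp add: btw_def)
    qed
  next
    case 6
    then have "Y a b < Y a c" using abc by (simp add: Y_even_less q_def)
    moreover have "Y a c < Y b c" using old_left[of c a] old_mid[of b c] 6 abc r Ysym[of a c] by simp
    ultimately show ?thesis by (simp add: btw_def)
  next
    case 7
    then show ?thesis using old_right[of a b] old_left[of c b] old_mid[of a c] abc r Ysym[of b c] by (simp add: btw_def)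
  next
    case 8
    then have "Y c a < Y c b" using abc by (simp add: Y_even_less q_def)
    moreover have "Y a b < Y a c" using old_right[of a c] old_mid[of a b] 8 abc r by simp
    ultimately show ?thesis using Ysym[of c] by (simp add: btw_def)
  qed
qed

text \<open>No integer lies strictly between -1 and 0, or between 0 and 1. Such products appear when
  factored time differences are tested for a crossing in between.\<close>

lemma consec_prod_nonneg: "(x::int) * (x + 1) \<ge> 0" "(x::int) * (x - 1) \<ge> 0"
  by (cases "x \<ge> 0"; auto simp: mult_nonpos_nonpos zero_le_mult_iff)+

text \<open>Allows the doubling to be iterated. Neighbouring labels now belong to an old and a new
  wire, and their crossing is the first or the last one on both. The end labels \<open>1\<close> and
  \<open>2 * M - 1\<close> are old and inherit the condition.\<close>

lemma alternating_Y: "alternating (2 * M - 1) Y"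
  unfolding alternating_def
proof (intro conjI ballI)
  fix i e assume i: "i \<in> {1..<2*M-1}" and e: "e \<in> {1..2*M-1} - {i, i+1}"
  then have r: "1 \<le> i" "i + 1 < 2 * M" "1 \<le> e" "e < 2 * M" "e \<noteq> i" "e \<noteq> i + 1" by auto
  show "if even i then Y i (i + 1) < Y i e \<and> Y i (i + 1) < Y (i + 1) e
        else Y i e < Y i (i + 1) \<and> Y (i + 1) e < Y i (i + 1)"
  proof (cases "even i")
    case True
    have "Y i (i + 1) < Y i e"
      using True r by (cases "even e") (auto simp: Y_even_less q_def elim!: evenE oddE)
    moreover have "Y (i + 1) i < Y (i + 1) e"
    proof -
      have l: "Y (i + 1) i \<le> -1" using old_left[of "i + 1" i] True r by simp
      consider "odd e" | "even e" "i + 1 < e" | "even e" "e < i" using r by (cases "even e") (auto, linarith)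
      then show ?thesis
      proof cases
        case 1 then show ?thesis using l old_mid[of "i + 1" e] True by simp
      next
        case 2 then show ?thesis using l old_right[of "i + 1" e] True by simp
      next
        case 3
        have "Y (i + 1) e - Y (i + 1) i = real_of_int (3 * (int (i + 1) - 2 * int M) * ((int i - int e) * (int (i + 1) - int e - int i)))"
          using left_diff[of "i + 1" e i] True 3 by simp
        moreover have "2 \<le> e" using 3 r by (cases "e = 1") auto
        then have "(int i - int e) * (int (i + 1) - int e - int i) < 0" using 3 by (intro mult_pos_neg) auto
        then have "3 * (int (i + 1) - 2 * int M) * ((int i - int e) * (int (i + 1) - int e - int i)) > 0"
          using r by (intro mult_neg_neg) auto
        ultimately show ?thesis by linarith
      qed
    qed
    ultimately show ?thesis using True Ysym[of i "i + 1"] by simp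
  next
    case False
    have "Y (i + 1) e < Y (i + 1) i"
      using False r by (cases "even e") (auto simp: Y_even_less q_def elim!: evenE oddE)
    moreover have "Y i e < Y i (i + 1)"
    proof -
      have l: "Y i (i + 1) \<ge> 1" using old_right[of i "i + 1"] False by simp
      consider "odd e" | "even e" "e < i" | "even e" "i + 1 < e" using r by (cases "even e") (auto, linarith)
      then show ?thesis
      proof cases
        case 1 then show ?thesis using l old_mid[of i e] False by simp
      next
        case 2 then show ?thesis using l old_left[of i e] False r by simp
      next
        case 3
        have "Y i (i + 1) - Y i e = real_of_int (3 * int i * ((int e - int (i + 1)) * (int i + 2 * int M - int (i + 1) - int e)))"
          using right_diff[of i "i + 1" e] False 3 by simp
        moreover have "e + 1 < 2 * M" using 3 r by (cases "e + 1 = 2 * M") (auto, presburger)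
        then have "3 * int i * ((int e - int (i + 1)) * (int i + 2 * int M - int (i + 1) - int e)) > 0"
          using 3 r by (intro mult_pos_pos) auto
        ultimately show ?thesis by linarith
      qed
    qed
    ultimately show ?thesis using False Ysym[of i "i + 1"] by simp
  qed
next
  fix e assume "e \<in> {1<..<2*M-1}"
  then have r: "1 < e" "e < 2 * M - 1" by auto
  have oM: "odd (2 * M - 1)" "(2 * M - 1 + 1) div 2 = M" using M3 by auto
  show "Y 1 (2*M-1) < Y 1 e" "Y (2*M-1) e < Y 1 (2*M-1)"
  proof -
    have "Y 1 (2*M-1) < Y 1 e \<and> Y (2*M-1) e < Y 1 (2*M-1)"
    proof (cases "even e")
      case True
      then show ?thesis using old_right[of 1 e] old_left[of "2*M-1" e] old_mid[of 1 "2*M-1"] oM r by auto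
    next
      case False
      let ?e = "(e + 1) div 2"
      have "?e \<in> {1<..<M}" using False r by (auto elim!: oddE)
      then have "X 1 M < X 1 ?e" "X M ?e < X 1 M" using alt unfolding alternating_def by blast+
      then show ?thesis using False oM by (simp add: Y_old)
    qed
    then show "Y 1 (2*M-1) < Y 1 e" "Y (2*M-1) e < Y 1 (2*M-1)" by auto
  qed
qed

lemma not_btw_prod: "(b - a) * (b - c) \<ge> 0 \<Longrightarrow> \<not> btw a b c"
  unfolding btw_def by (auto simp: zero_le_mult_iff)

lemma Y_even_consec:
  assumes "even a" "q a b = x" "q a c = x + 1 \<or> q a c = x - 1"
  shows "\<not> btw (Y a b) (Y a e) (Y a c)"
  using assms unfolding btw_def Y_even_less[OF assms(1)] by auto

section \<open>Three families of triangles after doubling\<close>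

definition Ta :: "nat set set" where "Ta = (\<lambda>t. (\<lambda>i. 2 * i - 1) ` t) ` tris M X"

text \<open>Old triangles survive because new wires meet an old one only outside the window
  \<open>(-1, 1)\<close> that holds all old crossings.\<close>

lemma Ta_sub: "Ta \<subseteq> tris (2 * M - 1) Y"
proof
  fix s assume "s \<in> Ta"
  then obtain i j k where s: "s = {2 * i - 1, 2 * j - 1, 2 * k - 1}" and t: "tri3 M X i j k"
    unfolding Ta_def tris_def by auto
  have c: "consec (2*M-1) Y (2 * i - 1) (2 * j - 1) (2 * k - 1)"
    if i: "i \<in> {1..M}" "j \<in> {1..M}" "k \<in> {1..M}" and co: "consec M X i j k" for i j k
    unfolding consec_def
  proof
    fix e assume e: "e \<in> {1..2*M-1} - {2 * i - 1, 2 * j - 1, 2 * k - 1}"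
    then have e': "1 \<le> e" "e < 2 * M" using label by auto
    have o: "odd (2 * i - 1)" "odd (2 * j - 1)" "odd (2 * k - 1)" using i by auto
    have h: "(2 * i - 1 + 1) div 2 = i" "(2 * j - 1 + 1) div 2 = j" "(2 * k - 1 + 1) div 2 = k" using i by auto
    show "\<not> btw (Y (2*i-1) (2*j-1)) (Y (2*i-1) e) (Y (2*i-1) (2*k-1))"
    proof (cases "even e")
      case True
      then have "Y (2*i-1) e \<le> -1 \<or> 1 \<le> Y (2*i-1) e"
      proof (cases "2 * i - 1 < e")
        case True
        then show ?thesis using old_right[OF o(1) \<open>even e\<close>] by simp
      next
        case False
        then have "e < 2 * i - 1" using o(1) \<open>even e\<close> by (cases "e = 2 * i - 1") auto
        moreover have "2 * i - 1 < 2 * M" using i by auto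
        ultimately show ?thesis using old_left[OF o(1) \<open>even e\<close>] by simp
      qed
      then show ?thesis using old_mid[OF o(1,2)] old_mid[OF o(1,3)] unfolding btw_def by auto
    next
      case False
      let ?e = "(e + 1) div 2"
      have "?e \<in> {1..M} - {i, j, k}" using old_index[OF False e'] e by auto
      then have "\<not> btw (X i j) (X i ?e) (X i k)" using co unfolding consec_def by blast
      then show ?thesis using False o h unfolding btw_def by (simp add: Y_old)
    qed
  qed
  have "tri3 (2*M-1) Y (2 * i - 1) (2 * j - 1) (2 * k - 1)"
    using t c[of i j k] c[of j i k] c[of k i j] unfolding tri3_def by auto
  then show "s \<in> tris (2 * M - 1) Y" unfolding tris_def using s by blast
qed

text \<open>The new wire that cuts off the old triangle at infinity between the old wires
  \<open>i\<close> and \<open>i + 1\<close>, at the end prescribed by \<open>alternating\<close>.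
  For odd \<open>i\<close> the odd number \<open>M\<close> is added to obtain an even label.\<close>

definition lb :: "nat \<Rightarrow> nat" where "lb i = (if even i then i else i + M)"

definition Tb :: "nat set set" where "Tb = (\<lambda>i. {2 * i - 1, 2 * i + 1, lb i}) ` {1..<M}"

text \<open>The two old wires cross at the beginning or at the end of the old window. The next wire
  that either of them meets beyond this crossing is \<open>lb i\<close>, since the factored time
  differences contain products of consecutive integers.\<close>

lemma Tb_sub: "Tb \<subseteq> tris (2 * M - 1) Y"
proof
  fix s assume "s \<in> Tb"
  then obtain i where i: "1 \<le> i" "i < M" and s: "s = {2 * i - 1, 2 * i + 1, lb i}" unfolding Tb_def by auto
  have ev: "even (lb i)" using oddM by (simp add: lb_def)
  have lbr: "1 \<le> lb i" "lb i < 2 * M - 1"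
  proof -
    have "odd i \<Longrightarrow> i + 1 < M" using i oddM by (metis Suc_eq_plus1 Suc_lessI even_Suc)
    then show "1 \<le> lb i" "lb i < 2 * M - 1" using i by (auto simp: lb_def)
  qed
  have o: "odd (2 * i - 1)" "odd (2 * i + 1)" using i by auto
  have h: "(2 * i - 1 + 1) div 2 = i" "(2 * i + 1 + 1) div 2 = i + 1" using i by auto
  have qs: "q (lb i) (2 * i - 1) = int (lb i) - int M - 1" "q (lb i) (2 * i + 1) = int (lb i) - int M + 1"
  proof -
    have "odd i \<Longrightarrow> 2 * i + 1 < i + M" using i oddM by (metis Suc_eq_plus1 Suc_lessI even_Suc add.commute add_Suc_right mult_2 nat_add_left_cancel_less)
    then show "q (lb i) (2 * i - 1) = int (lb i) - int M - 1" "q (lb i) (2 * i + 1) = int (lb i) - int M + 1"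
      using i by (auto simp: q_def lb_def of_nat_diff)
  qed
  have c1: "consec (2*M-1) Y (lb i) (2 * i - 1) (2 * i + 1)"
    unfolding consec_def
  proof
    fix e assume e: "e \<in> {1..2*M-1} - {lb i, 2 * i - 1, 2 * i + 1}"
    \<comment> \<open>The only integer strictly between the two values is \<open>lb i - M\<close>.
      Among even labels it belongs to \<open>lb i\<close> itself, and for odd labels parity excludes
      it.\<close>
    have "q (lb i) e \<noteq> int (lb i) - int M"
    proof (cases "even e")
      case True then show ?thesis using e by (auto simp: q_def)
    next
      case False
      have "int e \<noteq> 2 * int (lb i)" "int e \<noteq> 2 * int (lb i) - 2 * int M" "int e - int (lb i) - int M \<noteq> int (lb i) - int M"
        "int e - int (lb i) + int M \<noteq> int (lb i) - int M" using False by presburger+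
      then show ?thesis using False by (auto simp: q_def)
    qed
    then show "\<not> btw (Y (lb i) (2 * i - 1)) (Y (lb i) e) (Y (lb i) (2 * i + 1))"
      unfolding btw_def Y_even_less[OF ev] qs by auto
  qed
  have c2: "consec (2*M-1) Y a a' (lb i)" if aa: "a = 2 * i - 1 \<and> a' = 2 * i + 1 \<or> a = 2 * i + 1 \<and> a' = 2 * i - 1" for a a'
    unfolding consec_def
  proof
    fix e assume e: "e \<in> {1..2*M-1} - {a, a', lb i}"
    then have e': "1 \<le> e" "e < 2 * M" using label by auto
    have oa: "odd a" "odd a'" "a < 2 * M" using aa o i by auto
    have mid: "-1 < Y a a'" "Y a a' < 1" using old_mid[OF oa(1,2)] by auto
    show "\<not> btw (Y a a') (Y a e) (Y a (lb i))"
    proof (cases "even i")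
      case True
      have la: "lb i < a" using True i aa by (auto simp: lb_def elim!: evenE)
      have L: "Y a (lb i) \<le> -1" using old_left[OF oa(1) ev la oa(3)] .
      show ?thesis
      proof (cases "even e")
        case ee: True
        show ?thesis
        proof (cases "a < e")
          case True
          then show ?thesis using old_right[OF oa(1) ee True] mid L unfolding btw_def by auto
        next
          case False
          then have "e < a" using oa(1) ee by (metis linorder_neqE_nat)
          then have "Y a (lb i) - Y a e = real_of_int (3 * (int a - 2 * int M) * ((int e - int (lb i)) * (int a - int (lb i) - int e)))"
            using left_diff[OF oa(1) ev ee la] by simp
          moreover have "(int e - int (lb i)) * (int a - int (lb i) - int e) \<le> 0"
          proof -
            have "int a - int (lb i) - int e = - (int e - int i + 1) \<or> int a - int (lb i) - int e = - (int e - int i - 1)"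
              using aa \<open>even i\<close> i by (auto simp: lb_def of_nat_diff)
            then have "int a - int (lb i) - int e = - (int e - int (lb i) + 1) \<or> int a - int (lb i) - int e = - (int e - int (lb i) - 1)"
              using \<open>even i\<close> by (simp add: lb_def)
            then show ?thesis using consec_prod_nonneg[of "int e - int (lb i)"] by (elim disjE) (simp_all only: mult_minus_right neg_le_0_iff_le)
          qed
          then have "3 * (int a - 2 * int M) * ((int e - int (lb i)) * (int a - int (lb i) - int e)) \<ge> 0"
            using oa(3) by (intro mult_nonpos_nonpos) auto
          ultimately have "Y a e \<le> Y a (lb i)" by linarith
          then show ?thesis using L mid unfolding btw_def by auto
        qed
      next
        case False
        let ?e = "(e + 1) div 2"
        have "?e \<in> {1..M} - {i, i + 1}" using old_index[OF False e'] e aa h by auto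
        then have "X i (i + 1) < X i ?e" "X i (i + 1) < X (i + 1) ?e"
          using alternatingD[OF alt i] True by blast+
        then have "Y a a' < Y a e" using aa False o h Xsym[of "i + 1" i] by (auto simp: Y_old)
        then show ?thesis using L mid unfolding btw_def by auto
      qed
    next
      case oi: False
      have "i + 1 < M" using i oddM oi by (metis Suc_eq_plus1 Suc_lessI even_Suc)
      then have la: "a < lb i" using oi i aa by (auto simp: lb_def)
      have L: "Y a (lb i) \<ge> 1" using old_right[OF oa(1) ev la] .
      show ?thesis
      proof (cases "even e")
        case ee: True
        show ?thesis
        proof (cases "e < a")
          case True
          then show ?thesis using old_left[OF oa(1) ee True oa(3)] mid L unfolding btw_def by auto
        next
          case False
          then have "a < e" using oa(1) ee by (metis linorder_neqE_nat)
          then have "Y a (lb i) - Y a e = real_of_int (3 * int a * ((int e - int (lb i)) * (int a + 2 * int M - int (lb i) - int e)))"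
            using right_diff[OF oa(1) ev ee la] by simp
          moreover have "(int e - int (lb i)) * (int a + 2 * int M - int (lb i) - int e) \<le> 0"
          proof -
            have "int a + 2 * int M - int (lb i) - int e = - (int e - int (lb i) + 1) \<or> int a + 2 * int M - int (lb i) - int e = - (int e - int (lb i) - 1)"
              using aa oi i by (auto simp: lb_def of_nat_diff)
            then show ?thesis using consec_prod_nonneg[of "int e - int (lb i)"]
              by (elim disjE) (simp_all only: mult_minus_right neg_le_0_iff_le)
          qed
          then have "3 * int a * ((int e - int (lb i)) * (int a + 2 * int M - int (lb i) - int e)) \<le> 0"
            by (intro mult_nonneg_nonpos[of "3 * int a"]) auto
          ultimately have "Y a e \<ge> Y a (lb i)" by linarith
          then show ?thesis using L mid unfolding btw_def by auto
        qed
      next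
        case False
        let ?e = "(e + 1) div 2"
        have "?e \<in> {1..M} - {i, i + 1}" using old_index[OF False e'] e aa h by auto
        then have "X i ?e < X i (i + 1)" "X (i + 1) ?e < X i (i + 1)"
          using alternatingD[OF alt i] oi by blast+
        then have "Y a e < Y a a'" using aa False o h Xsym[of "i + 1" i] by (auto simp: Y_old)
        then show ?thesis using L mid unfolding btw_def by auto
      qed
    qed
  qed
  have "lb i \<noteq> 2 * i - 1" "lb i \<noteq> 2 * i + 1" using ev o by metis+
  then have "tri3 (2*M-1) Y (2 * i - 1) (2 * i + 1) (lb i)"
    unfolding tri3_def using c1 c2[of "2 * i - 1" "2 * i + 1"] c2[of "2 * i + 1" "2 * i - 1"] i lbr by auto
  then show "s \<in> tris (2 * M - 1) Y" unfolding tris_def using s by blast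
qed

text \<open>The old wires next to the crossing of the new wires \<open>a\<close> and
  \<open>b\<close>. A mirror axis through that crossing would have the label \<open>a + b\<close>
  modulo \<open>2 * M\<close>, which is even and so not old; \<open>s\<close> selects the
  neighbouring odd label on either side.\<close>

definition oc :: "nat \<times> nat \<times> bool \<Rightarrow> nat" where
  "oc = (\<lambda>(a, b, s). let u = (if s then a + b + 1 else a + b - 1) in if u < 2 * M then u else u - 2 * M)"

definition Dc :: "(nat \<times> nat \<times> bool) set" where
  "Dc = {(a, b, s). even a \<and> even b \<and> 2 \<le> a \<and> a < b \<and> b < 2 * M}"

definition Tc :: "nat set set" where
  "Tc = (\<lambda>z. {fst z, fst (snd z), oc z}) ` Dc"

lemma oc_cases:
  assumes "(a, b, s) \<in> Dc"
  defines "\<sigma> \<equiv> (if s then 1 else -1 :: int)"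
  shows "odd (oc (a, b, s))" "1 \<le> oc (a, b, s)" "oc (a, b, s) < 2 * M"
    "(b < oc (a, b, s) \<and> int (oc (a, b, s)) = int a + int b + \<sigma>) \<or>
     (oc (a, b, s) < a \<and> int (oc (a, b, s)) = int a + int b + \<sigma> - 2 * int M)"
proof -
  have r: "even a" "even b" "2 \<le> a" "a < b" "b < 2 * M" using assms(1) by (auto simp: Dc_def)
  then have b2: "b + 1 < 2 * M" by (metis Suc_eq_plus1 Suc_lessI dvd_triv_left even_Suc)
  define u where "u = (if s then a + b + 1 else a + b - 1)"
  have u: "odd u" "int u = int a + int b + \<sigma>" "b < u" using r by (auto simp: u_def \<sigma>_def)
  have oc: "oc (a, b, s) = (if u < 2 * M then u else u - 2 * M)" by (simp add: oc_def u_def Let_def)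
  have "\<not> u < 2 * M \<Longrightarrow> 2 * M < u" using u(1) by (metis dvd_triv_left linorder_neqE_nat)
  moreover have "u < 2 * M + a" using b2 r by (auto simp: u_def)
  moreover have "\<not> u < 2 * M \<Longrightarrow> odd (u - 2 * M)" using u(1) by simp
  ultimately show "odd (oc (a, b, s))" "1 \<le> oc (a, b, s)" "oc (a, b, s) < 2 * M"
    "(b < oc (a, b, s) \<and> int (oc (a, b, s)) = int a + int b + \<sigma>) \<or>
     (oc (a, b, s) < a \<and> int (oc (a, b, s)) = int a + int b + \<sigma> - 2 * int M)"
    unfolding oc using u r by (auto simp: of_nat_diff)
qed

lemma Tc_sub: "Tc \<subseteq> tris (2 * M - 1) Y"
proof
  fix t assume "t \<in> Tc"
  then obtain a b s where D: "(a, b, s) \<in> Dc" and t: "t = {a, b, oc (a, b, s)}" unfolding Tc_def by auto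
  define o' where "o' = oc (a, b, s)"
  define \<sigma> where "\<sigma> = (if s then 1 else -1 :: int)"
  have r: "even a" "even b" "2 \<le> a" "a < b" "b < 2 * M" using D by (auto simp: Dc_def)
  have o': "odd o'" "1 \<le> o'" "o' < 2 * M" "(b < o' \<and> int o' = int a + int b + \<sigma>) \<or> (o' < a \<and> int o' = int a + int b + \<sigma> - 2 * int M)"
    using oc_cases[OF D] unfolding o'_def \<sigma>_def by auto
  have \<sigma>: "\<sigma> = 1 \<or> \<sigma> = -1" by (simp add: \<sigma>_def)
  have qa: "q a o' = int b - int M + \<sigma>" "q a b = int b - int M" and qb: "q b o' = int a - int M + \<sigma>" "q b a = int a - int M"
    using o' r by (auto simp: q_def)
  have c1: "consec (2*M-1) Y a b o'"
    unfolding consec_def using Y_even_consec[OF r(1) qa(2), of o'] qa(1) \<sigma> by auto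
  have c2: "consec (2*M-1) Y b a o'"
    unfolding consec_def using Y_even_consec[OF r(2) qb(2), of o'] qb(1) \<sigma> by auto
  have pn: "(x::int) * (x + \<sigma>) \<ge> 0" for x using \<sigma> consec_prod_nonneg[of x] by auto
  have c3: "consec (2*M-1) Y o' a b"
    unfolding consec_def
  proof
    fix e assume e: "e \<in> {1..2*M-1} - {o', a, b}"
    then have e': "1 \<le> e" "e < 2 * M" using label by auto
    \<comment> \<open>Regrouping the factors yields two products of consecutive integers, one formed
      with \<open>a\<close> and one with \<open>b\<close>.\<close>
    have key: "((int a - int e) * (int b + \<sigma> - int e)) * ((int b - int e) * (int a + \<sigma> - int e)) \<ge> 0"
    proof -
      have "((int a - int e) * (int b + \<sigma> - int e)) * ((int b - int e) * (int a + \<sigma> - int e)) =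
          ((int a - int e) * (int a - int e + \<sigma>)) * ((int b - int e) * (int b - int e + \<sigma>))" by (simp add: algebra_simps)
      then show ?thesis using mult_nonneg_nonneg[OF pn pn] by (simp only:)
    qed
    have key': "(K * (((int a - int e) * (int b + \<sigma> - int e)))) * (K * ((int b - int e) * (int a + \<sigma> - int e))) \<ge> 0" for K :: int
    proof -
      have "(K * (((int a - int e) * (int b + \<sigma> - int e)))) * (K * ((int b - int e) * (int a + \<sigma> - int e))) =
         (K * K) * (((int a - int e) * (int b + \<sigma> - int e)) * ((int b - int e) * (int a + \<sigma> - int e)))" by (simp only: mult_ac)
      then show ?thesis using mult_nonneg_nonneg[OF zero_le_square[of K] key] by (simp only:)
    qed
    show "\<not> btw (Y o' a) (Y o' e) (Y o' b)"
      using o'(4)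
    proof (elim disjE conjE)
      assume l: "b < o'" "int o' = int a + int b + \<sigma>"
      have La: "Y o' a \<le> -1" "Y o' b \<le> -1" using old_left[OF o'(1) _ _ o'(3)] r l by auto
      show ?thesis
      proof (cases "odd e \<or> o' < e")
        case True
        then have "Y o' e > -1" using old_mid[OF o'(1), of e] old_right[OF o'(1), of e] by (cases "odd e") auto
        then show ?thesis using La unfolding btw_def by auto
      next
        case False
        then have ee: "even e" "e < o'" using e by auto
        have "Y o' e - Y o' a = real_of_int (3 * (int o' - 2 * int M) * ((int a - int e) * (int b + \<sigma> - int e)))"
          using left_diff[OF o'(1) ee(1) r(1) ee(2)] l r by (simp add: algebra_simps)
        moreover have "Y o' e - Y o' b = real_of_int (3 * (int o' - 2 * int M) * ((int b - int e) * (int a + \<sigma> - int e)))"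
          using left_diff[OF o'(1) ee(1) r(2) ee(2)] l r by (simp add: algebra_simps)
        ultimately have "(Y o' e - Y o' a) * (Y o' e - Y o' b) \<ge> 0"
          using key'[of "3 * (int o' - 2 * int M)"] by (simp only: of_int_mult[symmetric] of_int_0_le_iff)
        then show ?thesis by (rule not_btw_prod)
      qed
    next
      assume l: "o' < a" "int o' = int a + int b + \<sigma> - 2 * int M"
      have La: "Y o' a \<ge> 1" "Y o' b \<ge> 1" using old_right[OF o'(1)] r l by auto
      show ?thesis
      proof (cases "odd e \<or> e < o'")
        case True
        then have "Y o' e < 1" using old_mid[OF o'(1), of e] old_left[OF o'(1) _ _ o'(3), of e] by (cases "odd e") auto
        then show ?thesis using La unfolding btw_def by auto
      next
        case False
        then have ee: "even e" "o' < e" using e by auto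
        have "Y o' e - Y o' a = real_of_int (3 * int o' * ((int a - int e) * (int b + \<sigma> - int e)))"
        proof -
          have "int o' + 2 * int M - int e - int a = int b + \<sigma> - int e" using l by simp
          then show ?thesis using right_diff[OF o'(1) ee(1) r(1) ee(2) l(1)] by (simp only:)
        qed
        moreover have "Y o' e - Y o' b = real_of_int (3 * int o' * ((int b - int e) * (int a + \<sigma> - int e)))"
        proof -
          have "int o' + 2 * int M - int e - int b = int a + \<sigma> - int e" "o' < b" using l r by auto
          then show ?thesis using right_diff[OF o'(1) ee(1) r(2) ee(2)] by (simp only:)
        qed
        ultimately have "(Y o' e - Y o' a) * (Y o' e - Y o' b) \<ge> 0"
          using key'[of "3 * int o'"] by (simp only: of_int_mult[symmetric] of_int_0_le_iff)
        then show ?thesis by (rule not_btw_prod)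
      qed
    qed
  qed
  have "a \<noteq> o'" "b \<noteq> o'" using o'(1) r by auto
  moreover have "o' \<in> {1..2*M-1}" "a \<in> {1..2*M-1}" "b \<in> {1..2*M-1}" using o' r by auto
  ultimately have "tri3 (2*M-1) Y a b o'" unfolding tri3_def using c1 c2 c3 r by auto
  then show "t \<in> tris (2 * M - 1) Y" unfolding tris_def using t o'_def by blast
qed

section \<open>Counting the triangles after doubling\<close>

lemma card_Ta: "card Ta = card (tris M X)"
proof -
  have "inj_on (\<lambda>i::nat. 2 * i - 1) {1..M}" by (auto simp: inj_on_def)
  then have "inj_on (image (\<lambda>i::nat. 2 * i - 1)) (Pow {1..M})" by (rule inj_on_image_Pow)
  moreover have "tris M X \<subseteq> Pow {1..M}" unfolding tris_def tri3_def by auto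
  ultimately show ?thesis unfolding Ta_def by (intro card_image) (rule inj_on_subset)
qed

text \<open>The number of even labels in a triangle, which is 0, 1 or 2, separates the three
  families.\<close>

lemma even_Ta: "t \<in> Ta \<Longrightarrow> {x \<in> t. even x} = {}"
proof -
  assume "t \<in> Ta"
  then obtain i j k where "t = {2 * i - 1, 2 * j - 1, 2 * k - 1}" "1 \<le> i" "1 \<le> j" "1 \<le> k"
    unfolding Ta_def tris_def tri3_def by auto
  then show ?thesis by auto
qed

lemma parity_Tb:
  assumes "1 \<le> i"
  shows "{x \<in> {2 * i - 1, 2 * i + 1, lb i}. even x} = {lb i}"
    "{x \<in> {2 * i - 1, 2 * i + 1, lb i}. odd x} = {2 * i - 1, 2 * i + 1}"
  using assms oddM by (auto simp: lb_def)

lemma card_Tb: "card Tb = M - 1"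
proof -
  have "inj_on (\<lambda>i. {2 * i - 1, 2 * i + 1, lb i}) {1..<M}"
  proof (rule inj_onI)
    fix i j assume ij: "i \<in> {1..<M}" "j \<in> {1..<M}" "{2 * i - 1, 2 * i + 1, lb i} = {2 * j - 1, 2 * j + 1, lb j}"
    then have "{2 * i - 1, 2 * i + 1} = {2 * j - 1, 2 * j + 1}" using parity_Tb(2)[of i] parity_Tb(2)[of j] by simp
    then show "i = j" unfolding doubleton_eq_iff using ij by auto
  qed
  then show ?thesis unfolding Tb_def by (simp add: card_image)
qed

lemma parity_Tc:
  assumes "(a, b, s) \<in> Dc"
  shows "{x \<in> {a, b, oc (a, b, s)}. even x} = {a, b}" "{x \<in> {a, b, oc (a, b, s)}. odd x} = {oc (a, b, s)}"
  using assms oc_cases(1)[OF assms] by (auto simp: Dc_def)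

lemma finite_Dc: "finite Dc"
  by (rule finite_subset[of _ "{..2 * M} \<times> {..2 * M} \<times> UNIV"]) (auto simp: Dc_def)

text \<open>Ordered pairs of distinct indices are counted; their order encodes the flag
  \<open>s\<close>.\<close>

lemma card_Dc: "(M - 1) * (M - 2) \<le> card Dc"
proof -
  let ?Q = "{1..<M} \<times> {1..<M} - (\<lambda>i. (i, i)) ` {1..<M}"
  have "(M - 1) * (M - 2) = (M - 1) * (M - 1) - (M - 1)" by (cases M) (auto simp: algebra_simps)
  also have "\<dots> = card ?Q" by (subst card_Diff_subset) (auto simp: card_image inj_on_def)
  also have "\<dots> \<le> card Dc"
  proof (rule card_inj_on_le[OF _ _ finite_Dc])
    let ?h = "\<lambda>(i, j). if i < j then (2 * i, 2 * j, True) else (2 * j, 2 * i, False)"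
    show "inj_on ?h ?Q"
    proof (rule inj_onI)
      fix y z assume *: "y \<in> ?Q" "z \<in> ?Q" "?h y = ?h z"
      obtain i j i' j' where "y = (i, j)" "z = (i', j')" by (metis surj_pair)
      then show "y = z" using * by (cases "i < j"; cases "i' < j'") auto
    qed
    show "?h ` ?Q \<subseteq> Dc"
    proof
      fix z assume "z \<in> ?h ` ?Q"
      then obtain i j where z: "z = ?h (i, j)" and "i \<in> {1..<M}" "j \<in> {1..<M}" "i \<noteq> j" by blast
      then show "z \<in> Dc" unfolding z by (cases "i < j") (auto simp: Dc_def)
    qed
  qed
  finally show ?thesis .
qed

lemma card_Tc: "(M - 1) * (M - 2) \<le> card Tc"
proof -
  have "inj_on (\<lambda>z. {fst z, fst (snd z), oc z}) Dc"
  proof (rule inj_onI)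
    fix y z assume yz: "y \<in> Dc" "z \<in> Dc" "{fst y, fst (snd y), oc y} = {fst z, fst (snd z), oc z}"
    obtain a b s a' b' s' where y: "y = (a, b, s)" and z: "z = (a', b', s')" by (metis prod_cases3)
    have D: "(a, b, s) \<in> Dc" "(a', b', s') \<in> Dc" using yz y z by auto
    have eq: "{a, b, oc (a, b, s)} = {a', b', oc (a', b', s')}" using yz(3) y z by simp
    have "{a, b} = {a', b'}" using parity_Tc(1)[OF D(1)] parity_Tc(1)[OF D(2)] eq by simp
    then have ab: "a = a'" "b = b'" using D unfolding Dc_def doubleton_eq_iff by auto
    have oo: "oc (a, b, s) = oc (a', b', s')" using parity_Tc(2)[OF D(1)] parity_Tc(2)[OF D(2)] eq by simp
    have "s = s'" using oc_cases(4)[OF D(1)] oc_cases(4)[OF D(2)] ab oo M3 by (cases s; cases s') auto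
    then show "y = z" using ab y z by simp
  qed
  then show ?thesis unfolding Tc_def using card_Dc by (simp add: card_image)
qed

lemma card_tris_Y: "card (tris M X) + (M - 1) + (M - 1) * (M - 2) \<le> card (tris (2 * M - 1) Y)"
proof -
  have "tris (2 * M - 1) Y \<subseteq> Pow {1..2 * M - 1}" unfolding tris_def tri3_def by auto
  then have fin: "finite (tris (2 * M - 1) Y)" by (rule finite_subset) simp
  have f: "finite Ta" "finite Tb" "finite Tc" using fin Ta_sub Tb_sub Tc_sub finite_subset by blast+
  have eb: "card {x \<in> t. even x} = 1" if "t \<in> Tb" for t
    using that parity_Tb(1) unfolding Tb_def by force
  have ec: "card {x \<in> t. even x} = 2" if tc: "t \<in> Tc" for t
  proof -
    obtain a b s where D: "(a, b, s) \<in> Dc" and t: "t = {a, b, oc (a, b, s)}" using tc unfolding Tc_def by auto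
    show ?thesis unfolding t parity_Tc(1)[OF D] using D by (simp add: Dc_def)
  qed
  have "Ta \<inter> Tb = {}" using even_Ta eb by fastforce
  moreover have "(Ta \<union> Tb) \<inter> Tc = {}" using even_Ta eb ec by fastforce
  ultimately have "card (Ta \<union> Tb \<union> Tc) = card Ta + card Tb + card Tc" using f by (simp add: card_Un_disjoint)
  moreover have "card (Ta \<union> Tb \<union> Tc) \<le> card (tris (2 * M - 1) Y)"
    using Ta_sub Tb_sub Tc_sub by (intro card_mono[OF fin]) auto
  ultimately show ?thesis using card_Ta card_Tb card_Tc by linarith
qed

end

text \<open>Doubling adds at least \<open>(M - 1)^2\<close> triangles off infinity and
  \<open>M - 1\<close> at infinity, together \<open>M * (M - 1)\<close>. The number of segments
  grows by exactly three times as much, so \<open>d\<close> stays the same.\<close>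

lemma scheme_double:
  assumes "scheme M d" shows "scheme (2 * M - 1) d"
proof -
  obtain X where M: "odd M" "3 \<le> M" and X: "crossing_times {1..M} X" "alternating M X"
    and c: "M * (M + 1) \<le> 3 * (card (tris M X) + M) + d" using assms unfolding scheme_def by blast
  interpret doubling M X by (unfold_locales) (fact M X)+
  obtain m where m: "M = m + 2" using M(2) by (metis add.commute le_Suc_ex numeral_3_eq_3 numeral_2_eq_2 Suc_leD)
  have "(2 * M - 1) * (2 * M - 1 + 1) \<le> 3 * (card (tris (2 * M - 1) Y) + (2 * M - 1)) + d"
    using card_tris_Y c unfolding m by (simp add: algebra_simps)
  moreover have "odd (2 * M - 1)" "3 \<le> 2 * M - 1" using M by auto
  ultimately show ?thesis unfolding scheme_def using crossing_times_Y alternating_Y by blast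
qed

section \<open>Adding the line at infinity\<close>

lemma crossing_times_neq:
  assumes X: "crossing_times I X" and I: "i \<in> I" "j \<in> I" "k \<in> I" and "i \<noteq> j" "i \<noteq> k" "j \<noteq> k"
  shows "X i j \<noteq> X i k"
proof -
  have sym: "X a b = X b a" for a b using X unfolding crossing_times_def by blast
  have b: "btw (X a b) (X a c) (X b c)" if "a \<in> I" "b \<in> I" "c \<in> I" "a < b" "b < c" for a b c
    using X that unfolding crossing_times_def by blast
  consider "i < j" "j < k" | "i < k" "k < j" | "j < i" "i < k" | "j < k" "k < i" | "k < i" "i < j" | "k < j" "j < i"
    using assms(5-7) by linarith
  then show ?thesis
  proof cases
    case 1 then show ?thesis using b[OF I(1,2,3) 1] by (auto simp: btw_def)
  next
    case 2 then show ?thesis using b[OF I(1,3,2) 2] by (auto simp: btw_def)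
  next
    case 3 then show ?thesis using b[OF I(2,1,3) 3] sym[of j i] by (auto simp: btw_def)
  next
    case 4 then show ?thesis using b[OF I(2,3,1) 4] sym[of j i] sym[of k i] by (auto simp: btw_def)
  next
    case 5 then show ?thesis using b[OF I(3,1,2) 5] sym[of k i] by (auto simp: btw_def)
  next
    case 6 then show ?thesis using b[OF I(3,2,1) 6] sym[of j i] sym[of k i] by (auto simp: btw_def)
  qed
qed

lemma adjacent_inner:
  assumes "\<And>e. e \<in> I \<Longrightarrow> e \<noteq> i \<Longrightarrow> e \<noteq> j \<Longrightarrow> e \<noteq> k \<Longrightarrow> 0 < (X i e - X i j) * (X i e - X i k)"
  shows "adjacent I X i j k (-1)"
  unfolding adjacent_def
proof (intro conjI ballI)
  fix e assume "e \<in> I - {i, j, k}"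
  then have "0 < (X i e - X i j) * (X i e - X i k)" by (intro assms) auto
  then show "-1 * (X i e - X i j) * (X i e - X i k) < 0"
    by (simp only: mult_minus1 mult_minus_left neg_less_0_iff_less)
qed simp

lemma adjacent_outer:
  assumes "\<And>e. e \<in> I \<Longrightarrow> e \<noteq> i \<Longrightarrow> e \<noteq> j \<Longrightarrow> e \<noteq> k \<Longrightarrow> (X i e - X i j) * (X i e - X i k) < 0"
  shows "adjacent I X i j k 1"
  unfolding adjacent_def using assms by auto

lemma triangle_tripleI:
  assumes "i \<in> I" "j \<in> I" "k \<in> I" "i \<noteq> j" "i \<noteq> k" "j \<noteq> k"
    "adjacent I X i j k u" "adjacent I X j i k v" "adjacent I X k i j w" "u * v * w = -1"
  shows "triangle_triple I X {i, j, k}"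
  unfolding triangle_triple_def
  by (intro exI[of _ i] exI[of _ j] exI[of _ k] exI[of _ u] exI[of _ v] exI[of _ w] conjI refl) (fact assms)+

text \<open>The additional wire \<open>0\<close> crosses all others before they cross each other, so it plays the role
  of the line at infinity.\<close>

theorem scheme_realizable:
  assumes "scheme M d"
  shows "\<exists>t. realizable (M + 1) t \<and> (M + 1) * M \<le> 3 * t + d"
proof -
  obtain X where M: "odd M" "3 \<le> M" and X: "crossing_times {1..M} X" and alt: "alternating M X"
    and c: "M * (M + 1) \<le> 3 * (card (tris M X) + M) + d" using assms unfolding scheme_def by blast
  have sym: "X a b = X b a" for a b using X unfolding crossing_times_def by blast
  \<comment> \<open>Large enough to put every crossing with wire 0 before all others. The time
    \<open>j - B\<close> increases with \<open>j\<close>, as betweenness for triples that contain 0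
    requires.\<close>
  define B where "B = real M + 1 + (\<Sum>p\<in>{1..M}\<times>{1..M}. \<bar>X (fst p) (snd p)\<bar>)"
  define Z where "Z i j = (if i = 0 then real j - B else if j = 0 then real i - B else X i j)" for i j
  have Z0: "Z 0 j = real j - B" "Z j 0 = real j - B" for j by (auto simp: Z_def)
  have ZX: "Z i j = X i j" if "1 \<le> i" "1 \<le> j" for i j using that by (auto simp: Z_def)
  have low: "real l - B < X i j" if "i \<in> {1..M}" "j \<in> {1..M}" "l \<le> M" for i j l
  proof -
    have "\<bar>X (fst (i, j)) (snd (i, j))\<bar> \<le> (\<Sum>p\<in>{1..M}\<times>{1..M}. \<bar>X (fst p) (snd p)\<bar>)"
      by (rule member_le_sum) (use that in auto)
    then show ?thesis unfolding B_def using that(3) by simp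
  qed
  let ?I = "{0..M}"
  have ct: "crossing_times ?I Z" unfolding crossing_times_def
  proof (intro conjI allI ballI impI)
    show "Z i j = Z j i" for i j using sym[of i j] by (simp add: Z_def)
    fix i j k assume *: "i \<in> ?I" "j \<in> ?I" "k \<in> ?I" "i < j" "j < k"
    show "btw (Z i j) (Z i k) (Z j k)"
    proof (cases "i = 0")
      case True
      then show ?thesis using * low[of j k k] by (simp add: btw_def Z0 ZX)
    next
      case False
      then have "btw (X i j) (X i k) (X j k)" using X * unfolding crossing_times_def by simp
      then show ?thesis using False * by (simp add: ZX)
    qed
  qed
  have first: "Z i 0 < X i e" if "i \<in> {1..M}" "e \<in> {1..M}" for i e
    using low[OF that, of i] that by (simp add: Z0)
  have t1: "triangle_triple ?I Z s" if s: "s \<in> tris M X" for s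
  proof -
    obtain i j k where s: "s = {i, j, k}" and t: "tri3 M X i j k" using s unfolding tris_def by auto
    have adj: "adjacent ?I Z i j k (-1)"
      if i: "i \<in> {1..M}" "j \<in> {1..M}" "k \<in> {1..M}" "i \<noteq> j" "i \<noteq> k" and co: "consec M X i j k" for i j k
    proof (rule adjacent_inner)
      fix e assume e: "e \<in> ?I" "e \<noteq> i" "e \<noteq> j" "e \<noteq> k"
      show "0 < (Z i e - Z i j) * (Z i e - Z i k)"
      proof (cases "e = 0")
        case True
        then show ?thesis using first[OF i(1,2)] first[OF i(1,3)] i by (intro mult_neg_neg) (auto simp: ZX)
      next
        case False
        then have e1: "e \<in> {1..M}" using e by auto
        have n: "X i e \<noteq> X i j" "X i e \<noteq> X i k"
          using crossing_times_neq[OF X i(1) e1 i(2)] crossing_times_neq[OF X i(1) e1 i(3)] i e by auto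
        moreover have "\<not> btw (X i j) (X i e) (X i k)" using co e1 e unfolding consec_def by blast
        ultimately have "X i e < X i j \<and> X i e < X i k \<or> X i j < X i e \<and> X i k < X i e" unfolding btw_def by linarith
        then have "0 < (X i e - X i j) * (X i e - X i k)" by (auto simp: zero_less_mult_iff)
        then show ?thesis using i e1 by (simp add: ZX)
      qed
    qed
    show ?thesis unfolding s
      by (rule triangle_tripleI[where u = "-1" and v = "-1" and w = "-1"])
        (use t adj[of i j k] adj[of j i k] adj[of k i j] in \<open>auto simp: tri3_def\<close>)
  qed
  have t2: "triangle_triple ?I Z {0, i, i + 1}" if i: "1 \<le> i" "i < M" for i
  proof -
    have a0: "adjacent ?I Z 0 i (i + 1) (-1)"
    proof (rule adjacent_inner)
      fix e assume "e \<in> ?I" "e \<noteq> 0" "e \<noteq> i" "e \<noteq> i + 1"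
      then have "e < i \<or> i + 1 < e" by linarith
      then have "real e < real i \<or> real i + 1 < real e" by linarith
      then show "0 < (Z 0 e - Z 0 i) * (Z 0 e - Z 0 (i + 1))" by (auto simp: Z0 zero_less_mult_iff)
    qed
    have alt': "(even i \<longrightarrow> Z i (i + 1) < Z i e \<and> Z (i + 1) i < Z (i + 1) e) \<and>
        (odd i \<longrightarrow> Z i e < Z i (i + 1) \<and> Z (i + 1) e < Z (i + 1) i)"
      if "e \<in> ?I" "e \<noteq> 0" "e \<noteq> i" "e \<noteq> i + 1" for e
    proof -
      have "e \<in> {1..M} - {i, i + 1}" using that by auto
      note alternatingD[OF alt i this]
      then show ?thesis using i that sym[of "i + 1" i] by (simp add: ZX)
    qed
    have f: "Z i 0 < Z i e" "Z (i + 1) 0 < Z (i + 1) e" if "e \<in> ?I" "e \<noteq> 0" for e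
      using first[of i e] first[of "i + 1" e] i that by (auto simp: ZX)
    show ?thesis
    proof (cases "even i")
      case True
      have "adjacent ?I Z i 0 (i + 1) (-1)" "adjacent ?I Z (i + 1) 0 i (-1)"
        using f alt' True by (auto intro!: adjacent_inner mult_pos_pos)
      then show ?thesis using i by (intro triangle_tripleI[OF _ _ _ _ _ _ a0]) auto
    next
      case False
      \<comment> \<open>For odd \<open>i\<close> the crossing of \<open>i\<close> and
        \<open>i + 1\<close> comes last on both wires while wire 0 is met first, so both sides run
        through infinity and the product of the signs is -1 again.\<close>
      have "adjacent ?I Z i 0 (i + 1) 1" "adjacent ?I Z (i + 1) 0 i 1"
        using f alt' False by (auto intro!: adjacent_outer mult_pos_neg)
      then show ?thesis using i by (intro triangle_tripleI[OF _ _ _ _ _ _ a0]) auto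
    qed
  qed
  have t3: "triangle_triple ?I Z {0, 1, M}"
  proof -
    have a: "X 1 M < X 1 e" "X M e < X M 1" if "1 < e" "e < M" for e
      using alt that sym[of M 1] unfolding alternating_def by auto
    \<comment> \<open>Wire 0 meets wire 1 first and wire \<open>M\<close> last, so this side runs
      through infinity. So does the one on \<open>M\<close>, where the crossing with 1 is the
      last.\<close>
    have "adjacent ?I Z 0 1 M 1"
      by (rule adjacent_outer) (auto simp: Z0 intro!: mult_pos_neg)
    moreover have "adjacent ?I Z 1 0 M (-1)"
    proof (rule adjacent_inner)
      fix e assume "e \<in> ?I" "e \<noteq> 1" "e \<noteq> 0" "e \<noteq> M"
      then have "1 < e" "e < M" by auto
      then show "0 < (Z 1 e - Z 1 0) * (Z 1 e - Z 1 M)"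
        using a first[of 1 e] M by (intro mult_pos_pos) (auto simp: ZX)
    qed
    moreover have "adjacent ?I Z M 0 1 1"
    proof (rule adjacent_outer)
      fix e assume "e \<in> ?I" "e \<noteq> M" "e \<noteq> 0" "e \<noteq> 1"
      then have "1 < e" "e < M" by auto
      then show "(Z M e - Z M 0) * (Z M e - Z M 1) < 0"
        using a first[of M e] M by (intro mult_pos_neg) (auto simp: ZX)
    qed
    ultimately show ?thesis using M(2) by (rule_tac triangle_tripleI) auto
  qed
  let ?T2 = "(\<lambda>i. {0, i, i + 1}) ` {1..<M}"
  have T1: "tris M X \<subseteq> Pow {1..M}" unfolding tris_def tri3_def by auto
  then have fin: "finite (tris M X)" by (rule finite_subset) simp
  have "inj_on (\<lambda>i::nat. {0, i, i + 1}) {1..<M}"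
  proof (rule inj_onI)
    fix i j :: nat assume ij: "i \<in> {1..<M}" "j \<in> {1..<M}" "{0, i, i + 1} = {0, j, j + 1}"
    then have "i \<in> {0, j, j + 1}" "j \<in> {0, i, i + 1}" by blast+
    then show "i = j" using ij(1,2) by auto
  qed
  then have "card ?T2 = M - 1" by (simp add: card_image)
  moreover have "{0, 1, M} \<notin> ?T2"
  proof
    assume "{0, 1, M} \<in> ?T2"
    then obtain i where i': "{0, 1, M} = {0, i, i + 1}" "i \<in> {1..<M}" by (rule imageE)
    then have i: "1 \<le> i" by simp
    from i' have "1 \<in> {0, i, i + 1}" "M \<in> {0, i, i + 1}" by blast+
    then have "i = 1" "M = i \<or> M = i + 1" using i M(2) by auto
    then show False using M(2) by auto
  qed
  ultimately have "card (insert {0, 1, M} ?T2) = M" using M by simp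
  moreover have "tris M X \<inter> insert {0, 1, M} ?T2 = {}"
  proof -
    have "0 \<notin> s" if "s \<in> tris M X" for s using T1 that by fastforce
    moreover have "0 \<in> s" if "s \<in> insert {0, 1, M} ?T2" for s using that by blast
    ultimately show ?thesis by blast
  qed
  ultimately have cd: "card (tris M X \<union> insert {0, 1, M} ?T2) = card (tris M X) + M"
    using fin by (simp add: card_Un_disjoint del: Un_insert_right)
  have "realizable (M + 1) (card (tris M X) + M)"
    unfolding realizable_def
  proof (intro exI[of _ ?I] exI[of _ Z] exI[of _ "tris M X \<union> insert {0, 1, M} ?T2"] conjI ballI)
    fix s assume "s \<in> tris M X \<union> insert {0, 1, M} ?T2"
    then consider "s \<in> tris M X" | "s = {0, 1, M}" | i where "1 \<le> i" "i < M" "s = {0, i, i + 1}" by auto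
    then show "triangle_triple ?I Z s" by cases (use t1 t2 t3 in auto)
  qed (use ct cd in auto)
  then show ?thesis using c by (intro exI[of _ "card (tris M X) + M"]) (simp add: algebra_simps)
qed

text \<open>Three wires and the line at infinity form four lines whose four triangles use all twelve
  segments. The times \<open>-i * j\<close> let the pair 2, 3 cross first and the pair 1, 2 last, as
  \<open>alternating\<close> requires.\<close>

lemma scheme_3: "scheme 3 0"
proof -
  define X where "X i j = - real (i * j)" for i j :: nat
  have "crossing_times {1..3} X"
    unfolding crossing_times_def btw_def X_def by (auto simp: mult.commute simp flip: of_nat_mult)
  moreover have s: "{1..3} = {1, 2, 3::nat}" by auto
  have "{1..<3} = {1, 2::nat}" "{1<..<3} = {2::nat}" by auto
  then have "alternating 3 X" unfolding alternating_def s X_def by auto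
  moreover have "{1, 2, 3} \<in> tris 3 X"
    unfolding tris_def tri3_def consec_def s by force
  then have "1 \<le> card (tris 3 X)"
  proof -
    have "tris 3 X \<subseteq> Pow {1..3}" unfolding tris_def tri3_def by auto
    then have "finite (tris 3 X)" by (rule finite_subset) simp
    then show ?thesis using \<open>{1, 2, 3} \<in> tris 3 X\<close> by (simp add: Suc_le_eq card_gt_0_iff) blast
  qed
  ultimately show ?thesis unfolding scheme_def by (intro conjI exI[of _ X]) auto
qed

section \<open>An arrangement of 49 wires\<close>

text \<open>Crossing times and triangles of an arrangement of 50 pseudo-lines, one of them at infinity, with
  815 triangles, found with a SAT solver. Labels are shifted by one: entry \<open>e\<close> of row \<open>i\<close> is the time at which
  wires \<open>i + 1\<close> and \<open>e + 1\<close> cross, and entry \<open>i\<close> of \<open>triangles\<close> lists the other two wires of the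
  triangles with smallest wire \<open>i + 1\<close>.\<close>

definition time_rows :: "int list list" where
  "time_rows = [
    [0, 169, 71, 167, 163, 165, 133, 166, 159, 161, 73, 155, 129, 135, 79, 157, 83, 160, 151, 158, 85, 131, 72, 134,
    95, 127, 81, 149, 125, 153, 132, 162, 128, 150, 84, 154, 78, 126, 82, 152, 94, 156, 130, 164, 124, 168, 80, 148,
    70],
    [169, 0, 1, 113, 85, 111, 83, 115, 91, 101, 69, 95, 87, 89, 71, 97, 79, 109, 93, 105, 81, 92, 70, 96, 84, 90, 77,
    99, 86, 103, 94, 112, 98, 102, 82, 107, 76, 100, 80, 108, 88, 110, 106, 114, 104, 117, 78, 116, 68],
    [71, 1, 0, 191, 187, 189, 181, 188, 183, 185, 89, 179, 173, 177, 87, 180, 167, 182, 175, 178, 129, 171, 73, 169,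
    131, 165, 88, 172, 161, 176, 166, 184, 163, 168, 99, 170, 85, 130, 86, 164, 98, 174, 162, 186, 128, 190, 84, 160,
    69],
    [167, 113, 191, 0, 1, 55, 7, 119, 13, 29, 6, 17, 15, 19, 12, 25, 14, 53, 27, 49, 18, 31, 16, 33, 26, 32, 24, 41,
    28, 45, 39, 57, 43, 47, 30, 51, 38, 46, 40, 54, 44, 56, 52, 115, 50, 169, 48, 118, 42],
    [163, 85, 187, 1, 0, 193, 69, 189, 123, 131, 7, 125, 91, 93, 67, 127, 71, 133, 121, 129, 73, 111, 68, 119, 77, 92,
    70, 122, 87, 126, 117, 135, 118, 124, 75, 130, 72, 110, 76, 128, 90, 132, 120, 165, 116, 192, 74, 134, 66],
    [165, 111, 189, 55, 193, 0, 1, 167, 5, 25, 4, 13, 11, 15, 10, 17, 12, 31, 23, 41, 16, 27, 14, 29, 24, 30, 22, 33,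
    26, 37, 32, 113, 35, 39, 28, 43, 34, 42, 36, 47, 40, 57, 45, 121, 46, 191, 44, 120, 38],
    [133, 83, 181, 7, 69, 1, 0, 195, 187, 189, 5, 159, 125, 151, 13, 161, 75, 183, 155, 160, 77, 127, 65, 135, 85,
    123, 71, 153, 93, 157, 129, 186, 126, 152, 79, 156, 74, 124, 78, 154, 92, 158, 128, 188, 122, 194, 76, 150, 64],
    [166, 115, 188, 119, 189, 167, 195, 0, 1, 3, 2, 5, 4, 7, 6, 9, 8, 13, 11, 23, 12, 15, 10, 17, 14, 19, 16, 21, 18,
    25, 22, 35, 24, 27, 20, 29, 26, 31, 28, 33, 30, 37, 34, 39, 36, 193, 38, 117, 32],
    [159, 91, 183, 13, 123, 5, 187, 1, 0, 197, 3, 147, 19, 69, 11, 149, 15, 161, 117, 151, 29, 93, 18, 115, 61, 71,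
    28, 119, 67, 145, 109, 185, 116, 125, 59, 148, 60, 108, 68, 146, 70, 150, 118, 189, 114, 196, 66, 144, 58],
    [161, 101, 185, 29, 131, 25, 189, 3, 197, 0, 1, 9, 5, 11, 8, 13, 10, 137, 15, 109, 14, 35, 12, 41, 21, 34, 20, 45,
    27, 107, 43, 163, 47, 103, 31, 111, 40, 53, 42, 110, 46, 133, 108, 187, 106, 195, 52, 136, 44],
    [73, 69, 89, 6, 7, 4, 5, 2, 3, 1, 0, 211, 181, 209, 83, 207, 175, 210, 183, 205, 171, 179, 71, 177, 167, 173, 85,
    178, 169, 182, 172, 208, 170, 174, 131, 176, 79, 165, 84, 168, 99, 180, 166, 206, 130, 204, 82, 164, 67],
    [155, 95, 179, 17, 125, 13, 159, 5, 147, 9, 211, 0, 1, 27, 7, 181, 11, 203, 57, 161, 19, 61, 15, 97, 37, 59, 26,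
    111, 55, 127, 63, 201, 105, 113, 36, 149, 56, 104, 58, 143, 62, 157, 112, 202, 110, 200, 60, 142, 54],
    [129, 87, 173, 15, 91, 11, 125, 4, 19, 5, 181, 1, 0, 213, 9, 211, 13, 212, 207, 209, 61, 163, 17, 161, 69, 93, 29,
    165, 71, 183, 155, 210, 127, 162, 63, 164, 62, 121, 70, 160, 89, 175, 131, 208, 120, 206, 68, 154, 60],
    [135, 89, 177, 19, 93, 15, 151, 7, 69, 11, 209, 27, 213, 0, 1, 203, 9, 211, 159, 179, 17, 119, 13, 123, 57, 91,
    25, 157, 59, 161, 121, 205, 120, 153, 37, 158, 58, 111, 65, 156, 71, 160, 122, 204, 118, 202, 64, 149, 56],
    [79, 71, 87, 12, 67, 10, 13, 6, 11, 8, 83, 7, 9, 1, 0, 235, 233, 234, 231, 232, 221, 229, 69, 227, 171, 223, 89,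
    225, 173, 226, 219, 230, 172, 220, 167, 222, 77, 169, 85, 170, 133, 224, 168, 228, 132, 218, 81, 166, 65],
    [157, 97, 180, 25, 127, 17, 161, 9, 149, 13, 207, 181, 211, 203, 235, 0, 1, 213, 53, 159, 15, 57, 11, 61, 27, 55,
    23, 103, 35, 111, 59, 209, 99, 109, 34, 141, 54, 102, 56, 129, 60, 151, 110, 205, 108, 201, 58, 140, 52],
    [83, 79, 167, 14, 71, 12, 75, 8, 15, 10, 175, 11, 13, 9, 233, 1, 0, 235, 219, 221, 97, 217, 19, 215, 127, 161, 63,
    213, 129, 216, 163, 220, 159, 169, 85, 177, 73, 128, 81, 162, 96, 214, 160, 218, 126, 212, 77, 158, 62],
    [160, 109, 182, 53, 133, 31, 183, 13, 161, 137, 210, 203, 212, 211, 234, 213, 235, 0, 1, 45, 5, 19, 4, 21, 15, 23,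
    18, 37, 20, 41, 33, 187, 39, 43, 22, 47, 36, 44, 38, 55, 42, 111, 49, 199, 48, 198, 46, 135, 40],
    [151, 93, 175, 27, 121, 23, 155, 11, 117, 15, 183, 57, 207, 159, 231, 53, 219, 1, 0, 233, 13, 65, 5, 107, 25, 63,
    21, 123, 29, 177, 95, 221, 113, 147, 32, 157, 55, 106, 59, 153, 64, 161, 119, 209, 112, 205, 62, 146, 51],
    [158, 105, 178, 49, 129, 41, 160, 23, 151, 109, 205, 161, 209, 179, 232, 159, 221, 45, 233, 0, 1, 3, 2, 5, 4, 7,
    6, 9, 8, 29, 11, 211, 25, 31, 10, 131, 28, 43, 30, 111, 37, 139, 107, 207, 51, 203, 47, 138, 36],
    [85, 81, 129, 18, 73, 16, 77, 12, 29, 14, 171, 19, 61, 17, 221, 15, 97, 5, 13, 1, 0, 233, 3, 231, 163, 227, 27,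
    229, 165, 228, 173, 232, 167, 217, 83, 223, 63, 131, 79, 166, 95, 226, 164, 230, 127, 216, 75, 162, 59],
    [131, 92, 171, 31, 111, 27, 127, 15, 93, 35, 179, 61, 163, 119, 229, 57, 217, 19, 65, 3, 233, 0, 1, 153, 5, 33,
    17, 173, 21, 209, 133, 231, 121, 159, 29, 165, 41, 109, 49, 158, 63, 181, 129, 219, 117, 208, 59, 152, 48],
    [72, 70, 73, 16, 68, 14, 65, 10, 18, 12, 71, 15, 17, 13, 69, 11, 19, 4, 5, 2, 3, 1, 0, 259, 255, 257, 253, 256,
    251, 254, 252, 258, 249, 250, 247, 248, 175, 245, 173, 227, 177, 246, 176, 244, 174, 226, 85, 172, 63],
    [134, 96, 169, 33, 119, 29, 135, 17, 115, 41, 177, 97, 161, 123, 227, 61, 215, 21, 107, 5, 231, 153, 259, 0, 1,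
    31, 7, 179, 19, 217, 47, 233, 117, 163, 23, 171, 39, 105, 43, 159, 57, 211, 121, 229, 113, 210, 56, 151, 46],
    [95, 84, 131, 26, 77, 24, 85, 14, 61, 21, 167, 37, 69, 57, 171, 27, 127, 15, 25, 4, 163, 5, 255, 1, 0, 261, 19,
    257, 221, 235, 233, 260, 173, 231, 35, 232, 59, 129, 71, 169, 93, 230, 165, 234, 125, 220, 67, 161, 55],
    [127, 90, 165, 32, 92, 30, 123, 19, 71, 34, 173, 59, 93, 91, 223, 55, 161, 23, 63, 7, 227, 33, 257, 31, 261, 0, 1,
    233, 9, 229, 167, 259, 129, 175, 21, 215, 51, 125, 57, 163, 65, 225, 157, 232, 121, 214, 61, 156, 50],
    [81, 77, 88, 24, 70, 22, 71, 16, 28, 20, 85, 26, 29, 25, 89, 23, 63, 18, 21, 6, 27, 17, 253, 7, 19, 1, 0, 263,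
    233, 255, 237, 262, 223, 235, 171, 234, 75, 173, 83, 172, 169, 232, 170, 236, 133, 222, 79, 168, 61],
    [149, 99, 172, 41, 122, 33, 153, 21, 119, 45, 178, 111, 165, 157, 225, 103, 213, 37, 123, 9, 229, 173, 256, 179,
    257, 233, 263, 0, 1, 227, 23, 261, 55, 151, 11, 159, 35, 101, 39, 155, 47, 215, 113, 231, 109, 211, 54, 147, 43],
    [125, 86, 161, 28, 87, 26, 93, 18, 67, 27, 169, 55, 71, 59, 173, 35, 129, 20, 29, 8, 165, 21, 251, 19, 221, 9,
    233, 1, 0, 265, 253, 264, 171, 239, 33, 235, 57, 127, 69, 167, 91, 231, 163, 238, 123, 219, 65, 159, 53],
    [153, 103, 176, 45, 126, 37, 157, 25, 145, 107, 182, 127, 183, 161, 226, 111, 216, 41, 177, 29, 228, 209, 254,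
    217, 235, 229, 255, 227, 265, 0, 1, 263, 5, 51, 4, 155, 27, 47, 31, 147, 43, 159, 109, 233, 105, 207, 50, 143, 39],
    [132, 94, 166, 39, 117, 32, 129, 22, 109, 43, 172, 63, 155, 121, 219, 59, 163, 33, 95, 11, 173, 133, 252, 47, 233,
    167, 237, 23, 253, 1, 0, 265, 119, 221, 5, 229, 37, 107, 41, 161, 61, 228, 123, 235, 115, 217, 57, 153, 45],
    [162, 112, 184, 57, 135, 113, 186, 35, 185, 163, 208, 201, 210, 205, 230, 209, 220, 187, 221, 211, 232, 231, 258,
    233, 260, 259, 262, 261, 264, 263, 265, 0, 1, 3, 2, 5, 4, 7, 6, 9, 8, 41, 11, 203, 37, 199, 40, 121, 10],
    [128, 98, 163, 43, 118, 35, 126, 24, 116, 47, 170, 105, 127, 120, 172, 99, 159, 39, 113, 25, 167, 121, 249, 117,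
    173, 129, 223, 55, 171, 5, 119, 1, 0, 251, 3, 241, 29, 103, 37, 165, 45, 233, 161, 240, 111, 221, 53, 157, 41],
    [150, 102, 168, 47, 124, 39, 152, 27, 125, 103, 174, 113, 162, 153, 220, 109, 169, 43, 147, 31, 217, 159, 250,
    163, 231, 175, 235, 151, 239, 51, 221, 3, 251, 0, 1, 233, 5, 45, 29, 157, 41, 229, 111, 237, 107, 215, 49, 145,
    37],
    [84, 82, 99, 30, 75, 28, 79, 20, 59, 31, 131, 36, 63, 37, 167, 34, 85, 22, 32, 10, 83, 29, 247, 23, 35, 21, 171,
    11, 33, 4, 5, 2, 3, 1, 0, 249, 61, 225, 77, 173, 97, 243, 169, 242, 129, 224, 69, 165, 57],
    [154, 107, 170, 51, 130, 43, 156, 29, 148, 111, 176, 149, 164, 158, 222, 141, 177, 47, 157, 131, 223, 165, 248,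
    171, 232, 215, 234, 159, 235, 155, 229, 5, 241, 233, 249, 0, 1, 35, 7, 109, 31, 227, 53, 239, 49, 213, 45, 139,
    34],
    [78, 76, 85, 38, 72, 34, 74, 26, 60, 40, 79, 56, 62, 58, 77, 54, 73, 36, 55, 28, 63, 41, 175, 39, 59, 51, 75, 35,
    57, 27, 37, 4, 29, 5, 61, 1, 0, 249, 87, 247, 229, 248, 177, 246, 171, 228, 83, 170, 49],
    [126, 100, 130, 46, 110, 42, 124, 31, 108, 53, 165, 104, 121, 111, 169, 102, 128, 44, 106, 43, 131, 109, 245, 105,
    129, 125, 173, 101, 127, 47, 107, 7, 103, 45, 225, 35, 249, 0, 1, 171, 9, 247, 167, 243, 119, 223, 51, 163, 33],
    [82, 80, 86, 40, 76, 36, 78, 28, 68, 42, 84, 58, 70, 65, 85, 56, 81, 38, 59, 30, 79, 49, 173, 43, 71, 57, 83, 39,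
    69, 31, 41, 6, 37, 29, 77, 7, 87, 1, 0, 251, 249, 250, 231, 248, 175, 230, 63, 171, 47],
    [152, 108, 164, 54, 128, 47, 154, 33, 146, 110, 168, 143, 160, 156, 170, 129, 162, 55, 153, 111, 166, 158, 227,
    159, 169, 163, 172, 155, 167, 147, 161, 9, 165, 157, 173, 109, 247, 171, 251, 0, 1, 249, 35, 245, 43, 225, 42,
    141, 11],
    [94, 88, 98, 44, 90, 40, 92, 30, 70, 46, 99, 62, 89, 71, 133, 60, 96, 42, 64, 37, 95, 63, 177, 57, 93, 65, 169,
    47, 91, 43, 61, 8, 45, 41, 97, 31, 229, 9, 249, 1, 0, 251, 171, 247, 131, 227, 55, 167, 35],
    [156, 110, 174, 56, 132, 57, 158, 37, 150, 133, 180, 157, 175, 160, 224, 151, 214, 111, 161, 139, 226, 181, 246,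
    211, 230, 225, 232, 215, 231, 159, 228, 41, 233, 229, 243, 227, 248, 247, 250, 249, 251, 0, 1, 241, 7, 209, 39,
    137, 6],
    [130, 106, 162, 52, 120, 45, 128, 34, 118, 108, 166, 112, 131, 122, 168, 110, 160, 49, 119, 107, 164, 129, 176,
    121, 165, 157, 170, 113, 163, 109, 123, 11, 161, 111, 169, 53, 177, 167, 231, 35, 171, 1, 0, 249, 47, 229, 43,
    155, 7],
    [164, 114, 186, 115, 165, 121, 188, 39, 189, 187, 206, 202, 208, 204, 228, 205, 218, 199, 209, 207, 230, 219, 244,
    229, 234, 232, 236, 231, 238, 233, 235, 203, 240, 237, 242, 239, 246, 243, 248, 245, 247, 241, 249, 0, 1, 197, 5,
    119, 4],
    [124, 104, 128, 50, 116, 46, 122, 36, 114, 106, 130, 110, 120, 118, 132, 108, 126, 48, 112, 51, 127, 117, 174,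
    113, 125, 121, 133, 109, 123, 105, 115, 37, 111, 107, 129, 49, 171, 119, 175, 43, 131, 7, 47, 1, 0, 231, 41, 169,
    5],
    [168, 117, 190, 169, 192, 191, 194, 193, 196, 195, 204, 200, 206, 202, 218, 201, 212, 198, 205, 203, 216, 208,
    226, 210, 220, 214, 222, 211, 219, 207, 217, 199, 221, 215, 224, 213, 228, 223, 230, 225, 227, 209, 229, 197, 231,
    0, 1, 3, 2],
    [80, 78, 84, 48, 74, 44, 76, 38, 66, 52, 82, 60, 68, 64, 81, 58, 77, 46, 62, 47, 75, 59, 85, 56, 67, 61, 79, 54,
    65, 50, 57, 40, 53, 49, 69, 45, 83, 51, 63, 42, 55, 39, 43, 5, 41, 1, 0, 173, 3],
    [148, 116, 160, 118, 134, 120, 150, 117, 144, 136, 164, 142, 154, 149, 166, 140, 158, 135, 146, 138, 162, 152,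
    172, 151, 161, 156, 168, 147, 159, 143, 153, 121, 157, 145, 165, 139, 170, 163, 171, 141, 167, 137, 155, 119, 169,
    3, 173, 0, 1],
    [70, 68, 69, 42, 66, 38, 64, 32, 58, 44, 67, 54, 60, 56, 65, 52, 62, 40, 51, 36, 59, 48, 63, 46, 55, 50, 61, 43,
    53, 39, 45, 10, 41, 37, 57, 34, 49, 33, 47, 11, 35, 6, 7, 4, 5, 2, 3, 1, 0]]"

definition triangles :: "(nat \<times> nat) list list" where
  "triangles = [
    [(1, 45), (2, 22), (2, 48), (3, 7), (3, 45), (4, 31), (4, 43), (5, 7), (5, 43), (6, 23), (6, 30), (8, 17), (8,
    19), (9, 17), (9, 31), (10, 22), (10, 36), (11, 35), (11, 41), (12, 32), (12, 42), (13, 23), (13, 47), (14, 36),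
    (14, 46), (15, 19), (15, 41), (16, 34), (16, 38), (18, 33), (18, 39), (20, 34), (20, 40), (21, 30), (21, 42), (24,
    40), (24, 44), (25, 32), (25, 37), (26, 38), (26, 46), (27, 33), (27, 47), (28, 37), (28, 44), (29, 35), (29, 39)],
    [(2, 48), (3, 31), (3, 43), (4, 24), (4, 28), (5, 31), (5, 41), (6, 24), (6, 34), (7, 43), (7, 47), (8, 21), (8,
    25), (9, 33), (9, 37), (10, 22), (10, 48), (11, 23), (11, 30), (12, 28), (12, 40), (13, 25), (13, 40), (14, 22),
    (14, 36), (15, 23), (15, 32), (16, 38), (16, 46), (17, 39), (17, 41), (18, 21), (18, 30), (19, 42), (19, 44), (20,
    34), (20, 38), (26, 36), (26, 46), (27, 32), (27, 37), (29, 33), (29, 44), (35, 39), (35, 42), (45, 47)],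
    [(3, 45), (4, 7), (4, 43), (5, 7), (5, 45), (6, 15), (6, 17), (8, 17), (8, 31), (9, 31), (9, 43), (10, 26), (10,
    40), (11, 15), (11, 19), (12, 27), (12, 41), (13, 19), (13, 29), (14, 26), (14, 38), (16, 30), (16, 33), (18, 29),
    (18, 41), (20, 37), (20, 44), (21, 27), (21, 35), (22, 46), (23, 33), (23, 35), (24, 37), (24, 47), (25, 30), (25,
    39), (28, 42), (28, 47), (32, 39), (32, 42), (34, 40), (34, 44), (36, 38), (36, 46)],
    [(4, 10), (5, 39), (5, 41), (6, 10), (6, 14), (7, 47), (8, 14), (8, 16), (9, 28), (9, 34), (11, 20), (11, 22),
    (12, 16), (12, 22), (13, 20), (13, 26), (15, 24), (15, 26), (17, 39), (17, 42), (18, 24), (18, 28), (19, 44), (19,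
    46), (21, 25), (21, 34), (23, 25), (23, 36), (27, 38), (27, 48), (29, 37), (29, 40), (30, 36), (30, 38), (31, 41),
    (32, 40), (32, 48), (33, 37), (33, 46), (35, 42), (35, 44), (43, 47)],
    [(5, 45), (6, 22), (6, 26), (7, 45), (8, 27), (8, 33), (9, 35), (9, 41), (10, 48), (11, 29), (11, 33), (12, 25),
    (12, 40), (13, 25), (13, 37), (14, 22), (14, 48), (15, 29), (15, 39), (16, 26), (16, 36), (17, 41), (17, 47), (18,
    27), (18, 42), (19, 35), (19, 39), (20, 36), (20, 46), (21, 37), (21, 44), (23, 32), (23, 42), (24, 38), (28, 40),
    (30, 32), (30, 44), (31, 47), (34, 38), (34, 46)],
    [(6, 10), (8, 10), (8, 14), (9, 24), (9, 28), (11, 16), (11, 22), (12, 14), (12, 16), (13, 20), (13, 22), (15,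
    20), (15, 26), (17, 25), (17, 30), (18, 24), (18, 26), (19, 37), (19, 40), (21, 28), (21, 34), (23, 25), (23, 34),
    (27, 30), (27, 36), (29, 38), (29, 48), (31, 47), (32, 36), (32, 38), (33, 40), (33, 48), (35, 37), (35, 46), (39,
    44), (42, 44), (42, 46), (43, 47)],
    [(7, 45), (8, 31), (8, 43), (9, 43), (9, 45), (11, 19), (11, 41), (12, 32), (12, 37), (13, 33), (13, 47), (14,
    48), (15, 19), (16, 36), (16, 46), (17, 31), (18, 35), (18, 39), (20, 38), (20, 46), (21, 32), (21, 42), (22, 48),
    (23, 47), (24, 40), (25, 37), (25, 44), (26, 36), (27, 33), (27, 39), (28, 40), (28, 44), (29, 35), (29, 41), (30,
    42), (34, 38)],
    [(8, 10), (9, 10), (9, 12), (11, 12), (11, 14), (13, 14), (13, 16), (15, 16), (15, 22), (17, 20), (17, 24), (18,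
    20), (18, 22), (19, 30), (19, 32), (21, 24), (21, 26), (23, 26), (23, 28), (25, 28), (25, 34), (27, 30), (27, 34),
    (29, 32), (29, 36), (31, 42), (31, 44), (33, 36), (33, 38), (35, 38), (35, 40), (37, 40), (37, 48), (39, 42), (39,
    48), (41, 44), (41, 46), (43, 46)],
    [(9, 45), (11, 35), (11, 39), (12, 22), (12, 26), (13, 38), (13, 40), (15, 35), (15, 41), (16, 22), (18, 32), (18,
    42), (19, 41), (20, 26), (20, 48), (21, 37), (23, 32), (23, 44), (24, 36), (24, 46), (25, 40), (27, 42), (28, 38),
    (28, 46), (29, 39), (29, 47), (30, 37), (30, 44), (33, 47), (34, 36), (34, 48), (43, 45)],
    [(11, 14), (11, 16), (12, 14), (13, 16), (13, 22), (15, 20), (15, 22), (17, 47), (18, 20), (18, 26), (19, 39),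
    (19, 42), (21, 25), (21, 36), (23, 36), (23, 38), (24, 26), (27, 40), (27, 48), (29, 42), (29, 44), (30, 38), (30,
    48), (32, 40), (32, 46), (33, 44), (35, 39), (37, 46), (41, 47)],
    [(11, 17), (12, 29), (12, 41), (13, 17), (13, 31), (14, 38), (14, 46), (15, 31), (15, 43), (16, 33), (16, 35),
    (18, 29), (18, 45), (19, 43), (19, 45), (20, 30), (20, 32), (21, 27), (21, 41), (23, 27), (23, 35), (24, 39), (24,
    42), (25, 30), (25, 33), (26, 38), (28, 32), (28, 39), (34, 44), (34, 47), (36, 46), (37, 42), (37, 47), (40, 44)],
    [(13, 26), (13, 34), (15, 45), (17, 43), (18, 36), (18, 38), (20, 26), (21, 40), (21, 46), (23, 37), (24, 34),
    (24, 48), (25, 38), (25, 46), (27, 42), (27, 44), (28, 36), (28, 48), (29, 47), (30, 40), (31, 43), (31, 45), (32,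
    37), (32, 44), (33, 42), (39, 47)],
    [(13, 17), (15, 17), (15, 31), (18, 43), (18, 45), (19, 31), (19, 43), (20, 36), (20, 48), (21, 33), (21, 35),
    (23, 33), (23, 39), (24, 38), (24, 46), (25, 44), (26, 48), (27, 35), (28, 38), (29, 45), (30, 39), (30, 47), (34,
    36), (34, 46), (37, 44), (42, 47)],
    [(15, 43), (15, 45), (18, 35), (18, 41), (19, 45), (21, 32), (21, 44), (23, 42), (24, 36), (24, 48), (27, 35),
    (27, 39), (28, 36), (28, 46), (29, 41), (30, 32), (30, 42), (31, 43), (33, 39), (34, 48), (37, 44), (38, 46)],
    [(15, 17), (16, 17), (16, 19), (18, 19), (18, 31), (20, 33), (20, 35), (21, 31), (21, 43), (23, 29), (23, 43),
    (24, 32), (24, 39), (25, 35), (25, 41), (26, 44), (27, 29), (27, 41), (28, 32), (28, 45), (30, 33), (30, 45), (34,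
    42), (34, 47), (37, 39), (37, 42), (40, 44), (40, 47)],
    [(18, 36), (18, 48), (21, 38), (21, 46), (23, 40), (24, 34), (25, 36), (25, 38), (27, 37), (27, 44), (28, 34),
    (28, 48), (29, 42), (30, 40), (30, 46), (32, 37), (33, 42), (33, 44), (35, 47), (39, 47)],
    [(18, 31), (18, 43), (19, 31), (20, 40), (20, 44), (21, 29), (21, 43), (22, 48), (23, 29), (23, 41), (24, 37),
    (24, 44), (25, 39), (25, 42), (26, 48), (27, 41), (27, 45), (28, 37), (28, 47), (30, 39), (32, 42), (32, 47), (34,
    40), (35, 45)],
    [(18, 22), (19, 37), (19, 46), (20, 22), (21, 26), (21, 28), (23, 28), (23, 34), (24, 26), (25, 34), (27, 36),
    (27, 38), (29, 40), (29, 48), (30, 36), (31, 45), (32, 38), (32, 48), (33, 37), (33, 40), (35, 44), (35, 46), (42,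
    44), (43, 45)],
    [(21, 40), (23, 37), (23, 44), (25, 40), (25, 46), (27, 47), (28, 34), (30, 37), (32, 44), (33, 47), (38, 46)],
    [(20, 22), (21, 22), (21, 24), (23, 24), (23, 26), (25, 26), (25, 28), (27, 28), (27, 34), (29, 36), (29, 38),
    (30, 34), (32, 36), (33, 38), (33, 48), (35, 47), (40, 48), (41, 47)],
    [(21, 31), (23, 31), (23, 43), (24, 42), (24, 47), (25, 29), (25, 41), (27, 29), (27, 43), (28, 39), (28, 42),
    (30, 45), (32, 39), (33, 45), (35, 41), (37, 47)],
    [(23, 39), (23, 47), (29, 45), (30, 47), (33, 39), (36, 48), (38, 48), (41, 45)],
    [(23, 31), (24, 27), (24, 29), (25, 27), (25, 31), (26, 29), (26, 30), (28, 30), (28, 33), (32, 33), (32, 35),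
    (34, 35), (34, 41), (36, 42), (36, 44), (37, 41), (37, 43), (38, 44), (38, 47), (39, 43), (39, 45), (40, 42), (40,
    45), (46, 47)],
    [(27, 45), (30, 46), (30, 48), (38, 48), (40, 46), (41, 45)],
    [(25, 31), (27, 31), (28, 41), (28, 45), (29, 43), (30, 35), (30, 43), (32, 45), (33, 35), (33, 41)],
    [(27, 43), (29, 43), (32, 47), (33, 45), (35, 45), (36, 48), (42, 47)],
    [(27, 31), (28, 35), (28, 41), (29, 31), (30, 43), (32, 41), (32, 45), (33, 35), (33, 43), (34, 39), (34, 42),
    (37, 39), (37, 45), (40, 42), (40, 47), (44, 47)],
    [(32, 46), (40, 46)],
    [(29, 31), (30, 31), (33, 43), (35, 43)],
    [(30, 34), (32, 34), (33, 46), (37, 46)],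
    [(33, 41), (35, 41)],
    [(32, 34), (33, 34), (33, 36), (35, 36), (35, 38), (37, 38), (37, 40), (39, 40), (39, 48), (41, 46), (42, 48),
    (44, 46)],
    [(35, 43), (41, 43)],
    [],
    [(37, 43), (37, 45), (39, 45), (41, 43)],
    [(37, 48), (40, 48)],
    [(37, 41), (38, 47), (39, 41), (39, 43), (40, 43), (40, 45), (42, 45), (44, 47)],
    [],
    [(39, 41), (40, 41), (40, 43), (42, 43), (42, 45), (44, 45)],
    [(42, 46), (44, 46)],
    [],
    [(42, 48), (44, 48)],
    [],
    [(44, 48), (46, 48)],
    [],
    [(46, 48), (47, 48)],
    [],
    [],
    []]"

section \<open>Evaluation of the conditions on the tables\<close>

definition consec_row :: "int list \<Rightarrow> nat \<Rightarrow> nat \<Rightarrow> bool" where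
  "consec_row r j k = (let a = r ! j; b = r ! k in
     if a < b then list_all (\<lambda>x. x \<le> a \<or> b \<le> x) r else list_all (\<lambda>x. x \<le> b \<or> a \<le> x) r)"

lemma length_rows: "length time_rows = 49" "list_all (\<lambda>r. length r = 49) time_rows"
  by code_simp+

lemma rows_symmetric: "list_all (\<lambda>i. map (\<lambda>r. r ! i) time_rows = time_rows ! i) [0..<49]"
  by code_simp

text \<open>Two rows are traversed in parallel beyond position \<open>j\<close>, which tests all
  triples with these two smallest wires in one pass.\<close>

definition cross_pair :: "nat \<Rightarrow> int list \<Rightarrow> int list \<Rightarrow> bool" where
  "cross_pair j r r' = (let a = r ! j in
     list_all (\<lambda>(x, y). a < x \<and> x < y \<or> y < x \<and> x < a) (drop (Suc j) (zip r r')))"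

primrec cross_row :: "int list \<Rightarrow> nat \<Rightarrow> int list list \<Rightarrow> bool" where
  "cross_row r j [] \<longleftrightarrow> True"
| "cross_row r j (r' # R) \<longleftrightarrow> cross_pair j r r' \<and> cross_row r (Suc j) R"

primrec cross_rows :: "nat \<Rightarrow> int list list \<Rightarrow> bool" where
  "cross_rows i [] \<longleftrightarrow> True"
| "cross_rows i (r # R) \<longleftrightarrow> cross_row r (Suc i) R \<and> cross_rows (Suc i) R"

lemma rows_between: "cross_rows 0 time_rows"
  by code_simp

lemma cross_row_nth: "cross_row r j R \<Longrightarrow> p < length R \<Longrightarrow> cross_pair (j + p) r (R ! p)"
proof (induction R arbitrary: j p)
  case (Cons r' R)
  then show ?case using Cons.IH[of "Suc j" "p - 1"] by (cases p) auto
qed simp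

lemma cross_rows_nth: "cross_rows i R \<Longrightarrow> p < q \<Longrightarrow> q < length R \<Longrightarrow> cross_pair (i + q) (R ! p) (R ! q)"
proof (induction R arbitrary: i p q)
  case (Cons r R)
  obtain q' where q: "q = Suc q'" using Cons.prems by (cases q) auto
  show ?case
  proof (cases p)
    case 0
    then show ?thesis using cross_row_nth[of r "Suc i" R q'] Cons.prems q by auto
  next
    case (Suc p')
    then show ?thesis using Cons.IH[of "Suc i" p' q'] Cons.prems q by auto
  qed
qed simp

text \<open>Rows are numbered from 0 and wires from 1, so the parity is opposite to the one in
  \<open>alternating\<close>.\<close>

lemma rows_alternating:
  "list_all (\<lambda>i. let a = time_rows ! i ! Suc i in
     list_all (\<lambda>(e, x, y). e = i \<or> e = Suc i \<or> (if odd i then a < x \<and> a < y else x < a \<and> y < a))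
     (zip [0..<49] (zip (time_rows ! i) (time_rows ! Suc i)))) [0..<48]"
  by code_simp

lemma rows_ends:
  "let a = time_rows ! 0 ! 48 in
     list_all (\<lambda>(e, x, y). e = 0 \<or> e = 48 \<or> a < x \<and> y < a) (zip [0..<49] (zip (time_rows ! 0) (time_rows ! 48)))"
  by code_simp

lemma triangles_consec:
  "list_all (\<lambda>i. list_all (\<lambda>(j, k). i < j \<and> j < k \<and> k < 49 \<and> consec_row (time_rows ! i) j k \<and>
     consec_row (time_rows ! j) i k \<and> consec_row (time_rows ! k) i j) (triangles ! i)) [0..<49]"
  by code_simp

lemma triangles_distinct: "list_all (\<lambda>i. distinct (triangles ! i)) [0..<49]"
  by code_simp

lemma triangles_count: "sum_list (map (\<lambda>i. length (triangles ! i)) [0..<49]) = 766"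
  by code_simp

lemma length_row: "i < 49 \<Longrightarrow> length (time_rows ! i) = 49"
  using length_rows by (simp add: list_all_length)

lemma rows_sym: "i < 49 \<Longrightarrow> j < 49 \<Longrightarrow> time_rows ! i ! j = time_rows ! j ! i"
proof -
  assume ij: "i < 49" "j < 49"
  then have "map (\<lambda>r. r ! i) time_rows = time_rows ! i" using rows_symmetric by (simp add: list_all_iff)
  then have "map (\<lambda>r. r ! i) time_rows ! j = time_rows ! i ! j" by simp
  then show ?thesis using ij length_rows(1) by simp
qed

lemma rows_btw:
  assumes "i < j" "j < k" "k < 49"
  shows "btw (time_rows ! i ! j) (time_rows ! i ! k) (time_rows ! j ! k)"
proof -
  let ?z = "zip (time_rows ! i) (time_rows ! j)"
  have "cross_pair j (time_rows ! i) (time_rows ! j)"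
    using cross_rows_nth[OF rows_between assms(1)] assms length_rows(1) by simp
  then have "list_all (\<lambda>(x, y). time_rows ! i ! j < x \<and> x < y \<or> y < x \<and> x < time_rows ! i ! j) (drop (Suc j) ?z)"
    unfolding cross_pair_def Let_def .
  moreover have "drop (Suc j) ?z ! (k - Suc j) = (time_rows ! i ! k, time_rows ! j ! k)"
    using assms length_row[of i] length_row[of j] by simp
  then have "(time_rows ! i ! k, time_rows ! j ! k) \<in> set (drop (Suc j) ?z)"
    using nth_mem[of "k - Suc j" "drop (Suc j) ?z"] assms length_row[of i] length_row[of j] by simp
  ultimately show ?thesis unfolding list_all_iff btw_def by auto
qed

lemma rows_alt:
  assumes "i < 48" "e < 49" "e \<noteq> i" "e \<noteq> Suc i"
  shows "if odd i then time_rows ! i ! Suc i < time_rows ! i ! e \<and> time_rows ! i ! Suc i < time_rows ! Suc i ! e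
     else time_rows ! i ! e < time_rows ! i ! Suc i \<and> time_rows ! Suc i ! e < time_rows ! i ! Suc i"
proof -
  let ?z = "zip [0..<49] (zip (time_rows ! i) (time_rows ! Suc i))"
  define P where "P = (\<lambda>(e, x, y). e = i \<or> e = Suc i \<or>
      (if odd i then time_rows ! i ! Suc i < x \<and> time_rows ! i ! Suc i < y else x < time_rows ! i ! Suc i \<and> y < time_rows ! i ! Suc i))"
  have "i \<in> set [0..<48]" using assms by simp
  from rows_alternating[unfolded list_all_iff, rule_format, OF this]
  have lp: "list_all P ?z" unfolding P_def list_all_iff[symmetric] Let_def .
  have len: "length ?z = 49" and ze: "?z ! e = (e, time_rows ! i ! e, time_rows ! Suc i ! e)"
    using assms length_row[of i] length_row[of "Suc i"] by auto
  have "e < length ?z" unfolding len using assms by simp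
  from lp[unfolded list_all_length, rule_format, OF this]
  show ?thesis using assms unfolding ze P_def by simp
qed

lemma rows_end:
  assumes "0 < e" "e < 48"
  shows "time_rows ! 0 ! 48 < time_rows ! 0 ! e \<and> time_rows ! 48 ! e < time_rows ! 0 ! 48"
proof -
  let ?z = "zip [0..<49] (zip (time_rows ! 0) (time_rows ! 48))"
  define P where "P = (\<lambda>(e, x, y). e = (0::nat) \<or> e = 48 \<or> time_rows ! 0 ! 48 < x \<and> y < time_rows ! 0 ! 48)"
  have lp: "list_all P ?z" using rows_ends unfolding P_def Let_def .
  have len: "length ?z = 49" and ze: "?z ! e = (e, time_rows ! 0 ! e, time_rows ! 48 ! e)"
    using assms length_row[of 0] length_row[of 48] by auto
  have "e < length ?z" unfolding len using assms by simp
  from lp[unfolded list_all_length, rule_format, OF this]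
  show ?thesis using assms unfolding ze P_def by simp
qed

lemma rows_consec:
  assumes "i < 49" "e < 49" "consec_row (time_rows ! i) j k"
  shows "\<not> btw (time_rows ! i ! j) (time_rows ! i ! e) (time_rows ! i ! k)"
  using assms length_row[of i] unfolding consec_row_def Let_def btw_def list_all_length
  by (auto split: if_splits dest!: spec[of _ e])

text \<open>The 766 triangles off infinity and the 49 at infinity use \<open>3 * 815 = 2445\<close>
  of the \<open>49 * 50 = 2450\<close> segments.\<close>

theorem scheme_49: "scheme 49 5"
proof -
  \<comment> \<open>The value 0 outside the table makes \<open>X\<close> symmetric for all indices,
    as \<open>crossing_times\<close> demands.\<close>
  define X where "X i j = (if i \<in> {1..49} \<and> j \<in> {1..49} then real_of_int (time_rows ! (i - 1) ! (j - 1)) else 0)" for i j :: nat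
  have X: "X (Suc i) (Suc j) = real_of_int (time_rows ! i ! j)" if "i < 49" "j < 49" for i j
    using that by (simp add: X_def)
  have sym: "X i j = X j i" for i j
    unfolding X_def using rows_sym[of "i - 1" "j - 1"] by auto
  have ct: "crossing_times {1..49} X" unfolding crossing_times_def
  proof (intro conjI allI ballI impI)
    show "X i j = X j i" for i j by (rule sym)
    fix i j k :: nat assume "i \<in> {1..49}" "j \<in> {1..49}" "k \<in> {1..49}" "i < j" "j < k"
    then show "btw (X i j) (X i k) (X j k)"
      using rows_btw[of "i - 1" "j - 1" "k - 1"] by (auto simp: X_def btw_def)
  qed
  have alt: "alternating 49 X" unfolding alternating_def
  proof (intro conjI ballI)
    fix i e assume i: "i \<in> {1..<49::nat}" and e: "e \<in> {1..49} - {i, i + 1}"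
    obtain i' where i': "i = Suc i'" "i' < 48" using i by (cases i) auto
    obtain e' where e': "e = Suc e'" "e' < 49" "e' \<noteq> i'" "e' \<noteq> Suc i'" using e i' by (cases e) auto
    show "if even i then X i (i + 1) < X i e \<and> X i (i + 1) < X (i + 1) e
        else X i e < X i (i + 1) \<and> X (i + 1) e < X i (i + 1)"
      using rows_alt[OF i'(2) e'(2-4)] i' e' by (simp add: X)
  next
    fix e :: nat assume "e \<in> {1<..<49}"
    then obtain e' where e': "e = Suc e'" "0 < e'" "e' < 48" by (cases e) auto
    have "X 1 49 = real_of_int (time_rows ! 0 ! 48)" "X 1 e = real_of_int (time_rows ! 0 ! e')" "X 49 e = real_of_int (time_rows ! 48 ! e')"
      using e' by (auto simp: X_def)
    then show "X 1 49 < X 1 e" "X 49 e < X 1 49" using rows_end[OF e'(2,3)] by auto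
  qed
  define S where "S = (SIGMA i:{..<49}. set (triangles ! i))"
  have S: "i < j \<and> j < k \<and> k < 49 \<and> consec_row (time_rows ! i) j k \<and> consec_row (time_rows ! j) i k \<and> consec_row (time_rows ! k) i j"
    if "(i, j, k) \<in> S" for i j k
    using that triangles_consec unfolding S_def list_all_iff by auto
  let ?f = "\<lambda>(i, j, k). {Suc i, Suc j, Suc k}"
  have inj: "inj_on ?f S"
  proof (rule inj_onI)
    fix x y assume *: "x \<in> S" "y \<in> S" "?f x = ?f y"
    obtain i j k i' j' k' where xy: "x = (i, j, k)" "y = (i', j', k')" by (metis prod_cases3)
    have o: "i < j" "j < k" "i' < j'" "j' < k'" using S * xy by blast+
    have "{i, j, k} = {i', j', k'}" using *(3) xy by (auto simp: insert_eq_iff)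
    then have "sorted_list_of_set {i, j, k} = sorted_list_of_set {i', j', k'}" by simp
    then show "x = y" using o xy by simp
  qed
  have co: "consec 49 X (Suc i) (Suc j) (Suc k)"
    if "i < 49" "j < 49" "k < 49" "consec_row (time_rows ! i) j k" for i j k
    unfolding consec_def
  proof
    fix e assume "e \<in> {1..49} - {Suc i, Suc j, Suc k}"
    then obtain e' where e': "e = Suc e'" "e' < 49" by (cases e) auto
    then show "\<not> btw (X (Suc i) (Suc j)) (X (Suc i) e) (X (Suc i) (Suc k))"
      using rows_consec[OF that(1) e'(2) that(4)] that by (simp add: X)
  qed
  have "?f ` S \<subseteq> tris 49 X"
  proof
    fix t assume "t \<in> ?f ` S"
    then obtain i j k where t: "t = {Suc i, Suc j, Suc k}" and "(i, j, k) \<in> S" by auto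
    from S[OF this(2)] have "tri3 49 X (Suc i) (Suc j) (Suc k)"
      unfolding tri3_def using co[of i j k] co[of j i k] co[of k i j] by auto
    then show "t \<in> tris 49 X" unfolding tris_def t by blast
  qed
  moreover have "finite (tris 49 X)"
    by (rule finite_subset[of _ "Pow {1..49}"]) (auto simp: tris_def tri3_def)
  ultimately have "card (?f ` S) \<le> card (tris 49 X)" by (rule card_mono[rotated])
  moreover have "card S = 766"
  proof -
    have "card S = (\<Sum>i<49. card (set (triangles ! i)))" unfolding S_def by simp
    also have "\<dots> = (\<Sum>i<49. length (triangles ! i))"
      using triangles_distinct by (intro sum.cong refl) (simp add: list_all_iff distinct_card)
    also have "\<dots> = 766"
      using triangles_count by (simp only: interv_sum_list_conv_sum_set_nat atLeast_upt lessThan_atLeast0 set_upt)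
    finally show ?thesis .
  qed
  ultimately have "766 \<le> card (tris 49 X)" using card_image[OF inj] by simp
  then show ?thesis unfolding scheme_def using ct alt by (intro conjI exI[of _ X]) auto
qed

section \<open>Extremal arrangements\<close>

text \<open>In terms of \<open>M - 1\<close>, doubling is multiplication by 2.\<close>

lemma scheme_iterate: "scheme (m + 1) d \<Longrightarrow> scheme (2 ^ r * m + 1) d"
proof (induction r)
  case (Suc r)
  then have "scheme (2 * (2 ^ r * m + 1) - 1) d" by (intro scheme_double) simp
  then show ?case by (simp add: algebra_simps)
qed simp

definition attains_bound :: "nat \<Rightarrow> bool" where
  "attains_bound n \<longleftrightarrow> (\<exists>\<A>. simple_arrangement n \<A> \<and> real (p3 \<A>) = triangle_bound n)"

lemma p3_le_bound: "4 \<le> n \<Longrightarrow> simple_arrangement n A \<Longrightarrow> real (p3 A) \<le> triangle_bound n"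
  by (rule arrangement.upper_bound[OF arrangement.intro])

text \<open>Carries the topological upper bound over to the combinatorial count. Deletion relies on
  it, because averaging over the lines needs an upper bound for the number of triangles.\<close>

lemma realizable_le_bound:
  assumes "realizable n t" "4 \<le> n" shows "real t \<le> triangle_bound n"
proof -
  obtain A where "simple_arrangement n A" "t \<le> p3 A" using realizable_arrangement[OF assms] by blast
  then show ?thesis using p3_le_bound[OF assms(2)] by force
qed

lemma attains_boundI:
  assumes "realizable n t" "4 \<le> n" "triangle_bound n \<le> real t" shows "attains_bound n"
proof -
  obtain A where A: "simple_arrangement n A" "t \<le> p3 A" using realizable_arrangement[OF assms(1,2)] by blast
  then have "real (p3 A) = triangle_bound n" using p3_le_bound[OF assms(2) A(1)] assms(3) by linarith
  then show ?thesis unfolding attains_bound_def using A(1) by blast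
qed

lemma attains_bound_0_4:
  assumes "scheme M 0" "(M + 1) mod 6 = 0 \<or> (M + 1) mod 6 = 4" "5 \<le> M"
  shows "attains_bound (M + 1)" "attains_bound M"
proof -
  obtain t where t: "realizable (M + 1) t" "(M + 1) * M \<le> 3 * t" using scheme_realizable[OF assms(1)] by auto
  have b: "triangle_bound (M + 1) = (real M + 1) * real M / 3" using assms(2) by (auto simp: triangle_bound_def)
  have le: "(real M + 1) * real M \<le> 3 * real t" using of_nat_mono[OF t(2), where 'a=real] by (simp add: algebra_simps)
  then show "attains_bound (M + 1)" using t(1) b assms(3) by (intro attains_boundI) auto
  have "3 * real t \<le> (real M + 1) * real M" using realizable_le_bound[OF t(1)] b assms(3) by simp
  then have "real (3 * t) = real ((M + 1) * M)" using le by (simp add: algebra_simps)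
  then have eq: "3 * t = (M + 1) * M" by (simp only: of_nat_eq_iff)
  \<comment> \<open>By the exact count a line lies on \<open>M\<close> triangles on average, so some
    line lies on at most \<open>M\<close>.\<close>
  then have r: "realizable M (t - M)" using realizable_delete[OF t(1), of M 0] by simp
  have "3 * M \<le> (M + 1) * M" using assms(3) by simp
  then have "M \<le> t" using eq by linarith
  then have "real (t - M) = real t - real M" by simp
  moreover have "3 * real t = (real M + 1) * real M" using arg_cong[OF eq, of real] by (simp add: algebra_simps)
  moreover have "M mod 6 = 5 \<or> M mod 6 = 3" using assms(2) by presburger
  then have "triangle_bound M = real M * (real M - 2) / 3" by (auto simp: triangle_bound_def)
  ultimately have "triangle_bound M \<le> real (t - M)" by (simp add: algebra_simps)
  then show "attains_bound M" using attains_boundI[OF r] assms(3) by simp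
qed

lemma attains_bound_2:
  assumes "scheme M 5" "(M + 1) mod 6 = 2" "5 \<le> M"
  shows "attains_bound (M + 1)" "attains_bound M"
proof -
  obtain t where t: "realizable (M + 1) t" "(M + 1) * M \<le> 3 * t + 5" using scheme_realizable[OF assms(1)] by auto
  have b: "triangle_bound (M + 1) = ((real M + 1) * real M - 5) / 3" using assms(2) by (auto simp: triangle_bound_def)
  have le: "(real M + 1) * real M \<le> 3 * real t + 5" using of_nat_mono[OF t(2), where 'a=real] by (simp add: algebra_simps)
  then show "attains_bound (M + 1)" using t(1) b assms(3) by (intro attains_boundI) auto
  have "3 * real t + 5 \<le> (real M + 1) * real M" using realizable_le_bound[OF t(1)] b assms(3) by simp
  then have "real (3 * t + 5) = real ((M + 1) * M)" using le by (simp add: algebra_simps)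
  then have eq: "3 * t + 5 = (M + 1) * M" by (simp only: of_nat_eq_iff)
  obtain m where m: "M = m + 5" using assms(3) by (metis add.commute le_Suc_ex)
  \<comment> \<open>The remainder \<open>M - 4\<close> is less than the number \<open>M + 1\<close>
    of lines, so some line lies on at most \<open>M - 1\<close> triangles.\<close>
  have "3 * t \<le> (M + 1) * (M - 1) + (M - 4)" using eq unfolding m by (simp add: algebra_simps)
  then have r: "realizable M (t - (M - 1))" using realizable_delete[OF t(1), of "M - 1" "M - 4"] by simp
  have "M - 1 \<le> t" using eq unfolding m by (simp add: algebra_simps)
  then have "real (t - (M - 1)) = real t - real M + 1" using assms(3) by simp
  moreover have "3 * real t + 5 = (real M + 1) * real M" using arg_cong[OF eq, of real] by (simp add: algebra_simps)
  moreover have "M mod 6 = 1" using assms(2) by presburger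
  then have "triangle_bound M = (real M * (real M - 2) - 2) / 3" by (simp add: triangle_bound_def)
  ultimately have "triangle_bound M \<le> real (t - (M - 1))" by (simp add: algebra_simps)
  then show "attains_bound M" using attains_boundI[OF r] assms(3) by simp
qed

lemma power_4_mod_6: "2 * 4 ^ s mod 6 = (2::nat)"
proof (induction s)
  case (Suc s)
  have "2 * 4 ^ Suc s mod 6 = 4 * (2 * 4 ^ s mod 6) mod (6::nat)" by (simp add: mod_mult_right_eq)
  then show ?case using Suc by simp
qed simp

theorem theorem1p2:
  "(\<forall>n \<A>. 4 \<le> n \<longrightarrow> simple_arrangement n \<A> \<longrightarrow> real (p3 \<A>) \<le> triangle_bound n) \<and>
   (\<forall>k::nat. k \<le> 5 \<longrightarrow>
      infinite {n. 4 \<le> n \<and> n mod 6 = k \<and>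
                   (\<exists>\<A>. simple_arrangement n \<A> \<and> real (p3 \<A>) = triangle_bound n)})"
proof (intro conjI allI impI)
  show "4 \<le> n \<Longrightarrow> simple_arrangement n A \<Longrightarrow> real (p3 A) \<le> triangle_bound n" for n A
    by (rule p3_le_bound)
  fix k :: nat assume k: "k \<le> 5"
  have "\<exists>n. s < n \<and> 4 \<le> n \<and> n mod 6 = k \<and> attains_bound n" for s
  proof -
    have s2: "s < 2 ^ s" by (rule less_exp)
    have "(2::nat) ^ s \<le> 4 ^ s" by (rule power_mono) auto
    then have s4: "s < 4 ^ s" using s2 by linarith
    \<comment> \<open>From 3 wires, \<open>M - 1 = 2 * 2^r\<close>: odd \<open>r\<close> makes
      \<open>M + 1\<close> divisible by 6, even \<open>r\<close> gives it residue 4. From 49 wires,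
      \<open>M - 1\<close> remains a multiple of 48, so \<open>M + 1\<close> always has residue 2.
      Deleting a line then supplies the odd residues.\<close>
    have sc: "scheme (2 ^ r * 2 + 1) 0" "scheme (2 ^ r * 48 + 1) 5" for r
      using scheme_iterate[of 2 0 r] scheme_3 scheme_iterate[of 48 5 r] scheme_49 by simp_all
    have p: "(2::nat) ^ (2 * s) = 4 ^ s" by (simp add: power_mult)
    have "scheme (8 * 4 ^ s + 1) 0" "scheme (4 * 4 ^ s + 1) 0"
      using sc(1)[of "2 * s + 2"] sc(1)[of "2 * s + 1"] by (simp_all add: p)
    moreover have m4: "(8 * 4 ^ s + 1 + 1) mod 6 = (4::nat)" and m0: "(4 * 4 ^ s + 1 + 1) mod 6 = (0::nat)"
      using power_4_mod_6[of s] by presburger+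
    ultimately have a: "attains_bound (8 * 4 ^ s + 1 + 1)" "attains_bound (8 * 4 ^ s + 1)"
        "attains_bound (4 * 4 ^ s + 1 + 1)" "attains_bound (4 * 4 ^ s + 1)"
      using attains_bound_0_4[of "8 * 4 ^ s + 1"] attains_bound_0_4[of "4 * 4 ^ s + 1"] by simp_all
    have m2: "(2 ^ s * 48 + 1 + 1) mod 6 = (2::nat)" by presburger
    have b: "attains_bound (2 ^ s * 48 + 1 + 1)" "attains_bound (2 ^ s * 48 + 1)"
      using attains_bound_2[OF sc(2)[of s] m2] s2 by simp_all
    have m: "(8 * 4 ^ s + 1) mod 6 = (3::nat)" "(4 * 4 ^ s + 1) mod 6 = (5::nat)" "(2 ^ s * 48 + 1) mod 6 = (1::nat)"
      using m4 m0 m2 by presburger+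
    have g: "s < 4 * 4 ^ s + 1 + 1" "s < 2 ^ s * 48 + 1" "s < 2 ^ s * 48 + 1 + 1" "s < 8 * 4 ^ s + 1"
        "s < 8 * 4 ^ s + 1 + 1" "s < 4 * 4 ^ s + 1" using s2 s4 by linarith+
    have p1: "1 \<le> (4::nat) ^ s" "1 \<le> (2::nat) ^ s" by simp_all
    have h: "4 \<le> 4 * 4 ^ s + (1::nat) + 1" "4 \<le> 2 ^ s * 48 + (1::nat)" "4 \<le> 2 ^ s * 48 + (1::nat) + 1"
        "4 \<le> 8 * 4 ^ s + (1::nat)" "4 \<le> 8 * 4 ^ s + (1::nat) + 1" "4 \<le> 4 * 4 ^ s + (1::nat)" using p1 by linarith+
    consider "k = 0" | "k = 1" | "k = 2" | "k = 3" | "k = 4" | "k = 5" using k by linarith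
    then show ?thesis
    proof cases
      case 1 show ?thesis unfolding 1 by (intro exI[of _ "4 * 4 ^ s + 1 + 1"] conjI) (fact a b g h m m0 m2 m4)+
    next
      case 2 show ?thesis unfolding 2 by (intro exI[of _ "2 ^ s * 48 + 1"] conjI) (fact a b g h m m0 m2 m4)+
    next
      case 3 show ?thesis unfolding 3 by (intro exI[of _ "2 ^ s * 48 + 1 + 1"] conjI) (fact a b g h m m0 m2 m4)+
    next
      case 4 show ?thesis unfolding 4 by (intro exI[of _ "8 * 4 ^ s + 1"] conjI) (fact a b g h m m0 m2 m4)+
    next
      case 5 show ?thesis unfolding 5 by (intro exI[of _ "8 * 4 ^ s + 1 + 1"] conjI) (fact a b g h m m0 m2 m4)+
    next
      case 6 show ?thesis unfolding 6 by (intro exI[of _ "4 * 4 ^ s + 1"] conjI) (fact a b g h m m0 m2 m4)+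
    qed
  qed
  then show "infinite {n. 4 \<le> n \<and> n mod 6 = k \<and>
      (\<exists>\<A>. simple_arrangement n \<A> \<and> real (p3 \<A>) = triangle_bound n)}"
    unfolding infinite_nat_iff_unbounded attains_bound_def by blast
qed

end
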